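(* Let $h_n:=\beta(\gamma_n)-p_c$, where $\gamma$ is the backbone of invasion percolation on the Galton–Watson tree $\mathbf T$ and $\beta(\gamma_n)$ is the pivot of its $n$-th vertex. For any $\varepsilon>0$, as $k\to\infty$, $$\left(k\,h_{\lceil kt\rceil}/p_c\right)_{t\ge\varepsilon}\Longrightarrow (L(t))_{t\ge\varepsilon},$$ where $L$ is the Poisson lower envelope process and $\Longrightarrow$ denotes convergence in distribution of càdlàg paths in the Skorohod topology.
   Context: The offspring variable $Z$ takes values in $\{1,2,\dots\}$, with $\mu:=\mathbf E[Z]>1$ and $\mathbf E[Z^2]<\infty$; $p_c:=1/\mu$. Let $\mathcal V=\bigcup_{n\ge 0}\mathbb N^n$ be the vertex set of the Ulam–Harris tree, with root $\mathbf 0=\emptyset$. On $\Omega=(\mathbb N\times[0,1])^{\mathcal V}$ let $\mathbf P$ be the probability making the coordinates $(\deg_v,U_v)$, $v\in\mathcal V$, i.i.d. with the law of $(Z,U)$, where $U$ is uniform on $[0,1]$ and independent of $Z$. The Galton–Watson tree $\mathbf T$ is the random subtree containing $\mathbf 0$ and, for each $v\in\mathbf T$, exactly its first $\deg_v$ children. Invasion percolation on $\mathbf T$: $I_0=\{\mathbf 0\}$, and $I_{n+1}$ consists of $I_n$ together with the vertex of minimal weight $U_v$ among the vertices of $\mathbf T$ adjacent to $I_n$ and not in it; $I=\bigcup_n I_n$. Almost surely $I$ contains a unique infinite non-backtracking path $\gamma=(\mathbf 0,\gamma_1,\gamma_2,\dots)$ from the root, called the backbone. The pivot $\beta(v)$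 of a vertex $v$ is the least $x$ such that there is an infinite downward path from $v$ in the subtree of $\mathbf T$ at $v$ along which all $U$ variables (not including the one at $v$) are at most $x$. Laws are taken under $\mathbf P$ (tree and weights both random). Poisson lower envelope process: let $\mathcal P$ be an intensity $1$ Poisson point process on the upper half-plane; then $L(t):=\min\{y>0:(x,y)\in\mathcal P\text{ for some }x\in[0,t]\}$. Step functions such as $t\mapsto h_{\lceil kt\rceil}$ are identified with their right-continuous versions. *)

theory Defs
  imports "HOL-Probability.Probability"
begin

section \<open>Galton--Watson trees with weights\<close>

(* Vertices of the Ulam--Harris tree are finite words; the children of v are v @ [i], with i
   counted from 0, so that the first d children are those with i < d.  A sample point assigns
   to every vertex of the full Ulam--Harris tree its offspring number and its weight. *)

type_synonym vertex = "nat list"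
type_synonym sample = "vertex \<Rightarrow> nat \<times> real"

definition offspring :: "sample \<Rightarrow> vertex \<Rightarrow> nat" where
  "offspring \<omega> v = fst (\<omega> v)"

definition weight :: "sample \<Rightarrow> vertex \<Rightarrow> real" where
  "weight \<omega> v = snd (\<omega> v)"

definition GW_space :: "nat pmf \<Rightarrow> sample measure" where
  "GW_space Z = PiM UNIV (\<lambda>_. measure_pmf Z \<Otimes>\<^sub>M uniform_measure lborel {0..1})"

inductive_set GW_tree :: "sample \<Rightarrow> vertex set" for \<omega> :: sample where
  root: "[] \<in> GW_tree \<omega>"
| child: "v \<in> GW_tree \<omega> \<Longrightarrow> i < offspring \<omega> v \<Longrightarrow> v @ [i] \<in> GW_tree \<omega>"

definition child_of :: "vertex \<Rightarrow> vertex \<Rightarrow> bool" where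
  "child_of w v \<longleftrightarrow> (\<exists>i. w = v @ [i])"

definition adjacent :: "vertex \<Rightarrow> vertex \<Rightarrow> bool" where
  "adjacent v w \<longleftrightarrow> child_of w v \<or> child_of v w"

definition critical_prob :: "nat pmf \<Rightarrow> real" where
  "critical_prob Z = 1 / measure_pmf.expectation Z real"


section \<open>Invasion percolation, backbone and pivots\<close>

definition outer_boundary :: "sample \<Rightarrow> vertex set \<Rightarrow> vertex set" where
  "outer_boundary \<omega> S = {v \<in> GW_tree \<omega> - S. \<exists>w\<in>S. adjacent w v}"

(* Almost surely the minimiser is unique; on the null set of ties it is chosen arbitrarily. *)
fun invasion_step :: "sample \<Rightarrow> nat \<Rightarrow> vertex set" where
  "invasion_step \<omega> 0 = {[]}"
| "invasion_step \<omega> (Suc n) =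
     insert (arg_min_on (weight \<omega>) (outer_boundary \<omega> (invasion_step \<omega> n))) (invasion_step \<omega> n)"

definition invasion_cluster :: "sample \<Rightarrow> vertex set" where
  "invasion_cluster \<omega> = (\<Union>n. invasion_step \<omega> n)"

definition nonbacktracking_path :: "vertex set \<Rightarrow> (nat \<Rightarrow> vertex) \<Rightarrow> bool" where
  "nonbacktracking_path S \<gamma> \<longleftrightarrow>
     (\<forall>n. \<gamma> n \<in> S \<and> adjacent (\<gamma> n) (\<gamma> (Suc n)) \<and> \<gamma> (Suc (Suc n)) \<noteq> \<gamma> n)"

(* The path is unique almost surely; elsewhere the value is unspecified. *)
definition backbone :: "sample \<Rightarrow> nat \<Rightarrow> vertex" where
  "backbone \<omega> = (THE \<gamma>. \<gamma> 0 = [] \<and> nonbacktracking_path (invasion_cluster \<omega>) \<gamma>)"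

definition downward_path :: "sample \<Rightarrow> vertex \<Rightarrow> (nat \<Rightarrow> vertex) \<Rightarrow> bool" where
  "downward_path \<omega> v \<eta> \<longleftrightarrow>
     \<eta> 0 = v \<and> (\<forall>n. \<eta> n \<in> GW_tree \<omega> \<and> child_of (\<eta> (Suc n)) (\<eta> n))"

definition pivot :: "sample \<Rightarrow> vertex \<Rightarrow> real" where
  "pivot \<omega> v = (LEAST x. \<exists>\<eta>. downward_path \<omega> v \<eta> \<and> (\<forall>n. weight \<omega> (\<eta> (Suc n)) \<le> x))"

definition pivot_excess :: "nat pmf \<Rightarrow> sample \<Rightarrow> nat \<Rightarrow> real" where
  "pivot_excess Z \<omega> n = pivot \<omega> (backbone \<omega> n) - critical_prob Z"


section \<open>Poisson point processes and the lower envelope\<close>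

(* A simple point process is a random set of points; its counts take values in [0, \<infinity>].
   The distribution of the counts of sets of infinite intensity is not prescribed, since for
   a sigma-finite intensity it follows from the other conditions. *)
definition point_count :: "('w \<Rightarrow> 'a set) \<Rightarrow> 'a set \<Rightarrow> 'w \<Rightarrow> ennreal" where
  "point_count P A \<omega> = emeasure (count_space UNIV) (P \<omega> \<inter> A)"

definition poisson_point_process :: "'w measure \<Rightarrow> 'a measure \<Rightarrow> ('w \<Rightarrow> 'a set) \<Rightarrow> bool" where
  "poisson_point_process M \<nu> P \<longleftrightarrow>
     prob_space M \<and>
     (\<forall>\<omega>\<in>space M. P \<omega> \<subseteq> space \<nu>) \<and>
     (\<forall>A\<in>sets \<nu>. point_count P A \<in> borel_measurable M) \<and>
     (\<forall>A\<in>sets \<nu>. emeasure \<nu> A < \<infinity> \<longrightarrow>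
        (\<forall>n. measure M {\<omega> \<in> space M. point_count P A \<omega> = of_nat n} =
              measure \<nu> A ^ n / fact n * exp (- measure \<nu> A))) \<and>
     (\<forall>A :: nat \<Rightarrow> 'a set. range A \<subseteq> sets \<nu> \<longrightarrow> disjoint_family A \<longrightarrow>
        prob_space.indep_vars M (\<lambda>_. borel) (\<lambda>i. point_count P (A i)) UNIV)"

definition upper_half_plane :: "(real \<times> real) measure" where
  "upper_half_plane = restrict_space lborel {p. snd p > 0}"

definition lower_envelope :: "(real \<times> real) set \<Rightarrow> real \<Rightarrow> real" where
  "lower_envelope P t = (LEAST y. y > 0 \<and> (\<exists>x\<in>{0..t}. (x, y) \<in> P))"


section \<open>The Skorohod topology on cadlag paths indexed by a half-line\<close>

definition cadlag_paths :: "real \<Rightarrow> (real \<Rightarrow> real) set" where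
  "cadlag_paths a =
     {x \<in> extensional {a..}. \<forall>t\<ge>a. continuous (at_right t) x \<and>
                                   (t > a \<longrightarrow> (\<exists>l. (x \<longlongrightarrow> l) (at_left t)))}"

(* Surjectivity makes a strictly increasing map a homeomorphism of the half-line fixing a. *)
definition time_change :: "real \<Rightarrow> (real \<Rightarrow> real) \<Rightarrow> bool" where
  "time_change a \<tau> \<longleftrightarrow> strict_mono_on {a..} \<tau> \<and> \<tau> ` {a..} = {a..}"

(* A sequence y\<^sub>n is eventually in every skorohod_nbhd a x m \<delta> iff there are time changes
   \<tau>\<^sub>n with sup |\<tau>\<^sub>n t - t| --> 0 and sup {|y\<^sub>n (\<tau>\<^sub>n t) - x t|. a \<le> t \<le> m} --> 0 for all m,
   which is the usual description of convergence in the (metrizable) Skorohod J1 topology on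
   a half-line.  As the pairs (m, 1/m) are cofinal, a set is Skorohod-open iff it contains
   such a set around each of its elements. *)
definition skorohod_nbhd :: "real \<Rightarrow> (real \<Rightarrow> real) \<Rightarrow> real \<Rightarrow> real \<Rightarrow> (real \<Rightarrow> real) set" where
  "skorohod_nbhd a x m \<delta> =
     {y \<in> cadlag_paths a. \<exists>\<tau>. time_change a \<tau> \<and> (\<forall>t\<ge>a. \<bar>\<tau> t - t\<bar> < \<delta>) \<and>
                                 (\<forall>t\<in>{a..m}. \<bar>y (\<tau> t) - x t\<bar> < \<delta>)}"

definition skorohod_topology :: "real \<Rightarrow> (real \<Rightarrow> real) topology" where
  "skorohod_topology a = topology (\<lambda>U. U \<subseteq> cadlag_paths a \<and>
     (\<forall>x\<in>U. \<exists>m. \<exists>\<delta>>0. skorohod_nbhd a x m \<delta> \<subseteq> U))"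

lemma skorohod_nbhd_mono:
  assumes "m \<le> m'" "\<delta>' \<le> \<delta>"
  shows "skorohod_nbhd a x m' \<delta>' \<subseteq> skorohod_nbhd a x m \<delta>"
proof
  fix y assume "y \<in> skorohod_nbhd a x m' \<delta>'"
  then obtain \<tau> where y: "y \<in> cadlag_paths a" and \<tau>: "time_change a \<tau>"
      "\<forall>t\<ge>a. \<bar>\<tau> t - t\<bar> < \<delta>'" "\<forall>t\<in>{a..m'}. \<bar>y (\<tau> t) - x t\<bar> < \<delta>'"
    unfolding skorohod_nbhd_def by blast
  have "\<forall>t\<ge>a. \<bar>\<tau> t - t\<bar> < \<delta>"
    using \<tau>(2) assms(2) less_le_trans by blast
  moreover have "\<forall>t\<in>{a..m}. \<bar>y (\<tau> t) - x t\<bar> < \<delta>"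
  proof
    fix t assume "t \<in> {a..m}"
    then have "t \<in> {a..m'}" using assms(1) by simp
    then have "\<bar>y (\<tau> t) - x t\<bar> < \<delta>'" using \<tau>(3) by blast
    then show "\<bar>y (\<tau> t) - x t\<bar> < \<delta>" using assms(2) by simp
  qed
  ultimately show "y \<in> skorohod_nbhd a x m \<delta>"
    unfolding skorohod_nbhd_def using y \<tau>(1) by blast
qed

lemma skorohod_nbhd_subset: "skorohod_nbhd a x m \<delta> \<subseteq> cadlag_paths a"
  unfolding skorohod_nbhd_def by (rule Collect_restrict)

lemma openin_skorohod_topology:
  "openin (skorohod_topology a) U \<longleftrightarrow>
     U \<subseteq> cadlag_paths a \<and> (\<forall>x\<in>U. \<exists>m. \<exists>\<delta>>0. skorohod_nbhd a x m \<delta> \<subseteq> U)"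
proof -
  let ?L = "\<lambda>U. U \<subseteq> cadlag_paths a \<and> (\<forall>x\<in>U. \<exists>m. \<exists>\<delta>>0. skorohod_nbhd a x m \<delta> \<subseteq> U)"
  have "istopology ?L"
    unfolding istopology_def
  proof (intro conjI allI impI)
    fix S T assume S: "?L S" and T: "?L T"
    show "S \<inter> T \<subseteq> cadlag_paths a" using S by blast
    show "\<forall>x\<in>S \<inter> T. \<exists>m. \<exists>\<delta>>0. skorohod_nbhd a x m \<delta> \<subseteq> S \<inter> T"
    proof
      fix x assume "x \<in> S \<inter> T"
      then have "x \<in> S" "x \<in> T" by auto
      obtain m \<delta> where 1: "\<delta> > 0" "skorohod_nbhd a x m \<delta> \<subseteq> S"
        using S \<open>x \<in> S\<close> by blast
      obtain m' \<delta>' where 2: "\<delta>' > 0" "skorohod_nbhd a x m' \<delta>' \<subseteq> T"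
        using T \<open>x \<in> T\<close> by blast
      have "skorohod_nbhd a x (max m m') (min \<delta> \<delta>') \<subseteq> S \<inter> T"
        using 1(2) 2(2) skorohod_nbhd_mono[of m "max m m'" "min \<delta> \<delta>'" \<delta> a x]
          skorohod_nbhd_mono[of m' "max m m'" "min \<delta> \<delta>'" \<delta>' a x] by auto
      moreover have "min \<delta> \<delta>' > 0" using 1(1) 2(1) by simp
      ultimately show "\<exists>m. \<exists>\<delta>>0. skorohod_nbhd a x m \<delta> \<subseteq> S \<inter> T" by blast
    qed
  next
    fix \<K> assume K: "\<forall>U\<in>\<K>. ?L U"
    show "\<Union>\<K> \<subseteq> cadlag_paths a" using K by blast
    show "\<forall>x\<in>\<Union>\<K>. \<exists>m. \<exists>\<delta>>0. skorohod_nbhd a x m \<delta> \<subseteq> \<Union>\<K>"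
    proof
      fix x assume "x \<in> \<Union>\<K>"
      then obtain U where U: "U \<in> \<K>" "x \<in> U" by blast
      then have "?L U" using K by blast
      then obtain m \<delta> where "\<delta> > 0" "skorohod_nbhd a x m \<delta> \<subseteq> U" using U(2) by blast
      then show "\<exists>m. \<exists>\<delta>>0. skorohod_nbhd a x m \<delta> \<subseteq> \<Union>\<K>" using U(1) by blast
    qed
  qed
  then show ?thesis
    unfolding skorohod_topology_def by (simp add: topology_inverse')
qed

lemma topspace_skorohod_topology: "topspace (skorohod_topology a) = cadlag_paths a"
proof -
  have "openin (skorohod_topology a) (cadlag_paths a)"
    unfolding openin_skorohod_topology
    by (intro conjI ballI subset_refl exI[of _ 0] exI[of _ "1::real"] zero_less_one
        skorohod_nbhd_subset)
  then show ?thesis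
    using openin_skorohod_topology[of a "topspace (skorohod_topology a)"]
      openin_subset[of "skorohod_topology a" "cadlag_paths a"] by auto
qed

definition right_continuous_version :: "(real \<Rightarrow> real) \<Rightarrow> real \<Rightarrow> real" where
  "right_continuous_version f t = Lim (at_right t) f"


section \<open>Convergence in distribution in a topological space\<close>

definition borel_space_of :: "'a topology \<Rightarrow> 'a measure" where
  "borel_space_of T = sigma (topspace T) {U. openin T U}"

(* The maps of interest are only determined up to null sets (and for instance need not be
   cadlag on a null set), so a random element is a map having a measurable version. *)
definition measurable_version ::
  "'w measure \<Rightarrow> 'a topology \<Rightarrow> ('w \<Rightarrow> 'a) \<Rightarrow> ('w \<Rightarrow> 'a) \<Rightarrow> bool" where
  "measurable_version M T X X' \<longleftrightarrow>
     X' \<in> measurable M (borel_space_of T) \<and> (AE \<omega> in M. X \<omega> = X' \<omega>)"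

(* The integrals do not depend on the choice of the versions. *)
definition converges_in_distribution ::
  "'a topology \<Rightarrow> 'v measure \<Rightarrow> (nat \<Rightarrow> 'v \<Rightarrow> 'a) \<Rightarrow> 'w measure \<Rightarrow> ('w \<Rightarrow> 'a) \<Rightarrow> bool" where
  "converges_in_distribution T M X N Y \<longleftrightarrow>
     (\<exists>X' Y'. (\<forall>k. measurable_version M T (X k) (X' k)) \<and> measurable_version N T Y Y' \<and>
        (\<forall>F :: 'a \<Rightarrow> real. continuous_map T euclideanreal F \<longrightarrow> bounded (F ` topspace T) \<longrightarrow>
           (\<lambda>k. \<integral>\<omega>. F (X' k \<omega>) \<partial>M) \<longlonglongrightarrow> (\<integral>\<omega>. F (Y' \<omega>) \<partial>N)))"

end

theory Submission
  imports Defs "HOL-Analysis.Function_Metric"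
begin

text \<open>
  The pivot of the root is the minimum over the children \<open>c\<close> of \<open>max (U c) (\<beta> c)\<close>, and every
  vertex invaded below \<open>v\<close> has weight at most \<open>\<beta> v\<close>, so the backbone always proceeds to the child
  that attains this minimum.  By independence of the subtrees, the pivots along the backbone form a
  Markov chain.  Let \<open>\<psi> s = 1 - E (1 - s)^Z\<close> and \<open>\<theta>\<close> its inverse.  In the coordinate
  \<open>y = P(\<beta> \<le> \<beta>(\<gamma> n))\<close> the chain starts uniformly on \<open>[0, 1]\<close>; from \<open>y\<close> it stays with
  probability \<open>\<theta> y * \<psi>' (\<theta> y) / y = 1 - r y\<close> and otherwise jumps to a uniform point of \<open>[0, y]\<close>.
  The second moment makes the jump probability \<open>r y\<close> and the relative excess
  \<open>H y = (\<beta> - p\<^sub>c) / p\<^sub>c\<close> asymptotically equal as \<open>y\<close> tends to \<open>0\<close>.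

  The chain is driven by independent uniform variables, for which one can take the rescaled lowest
  points of the Poisson process in the vertical strips of width \<open>1 / k\<close>.  Under this coupling the chain
  jumps, up to a factor close to \<open>1\<close>, to the lowest point seen so far, so that for almost every
  configuration the rescaled chain converges to the lower envelope in the Skorohod topology.
\<close>

section \<open>Skorohod neighbourhoods\<close>

text \<open>The subtree at the next backbone vertex is not a fresh Galton-Watson tree: it was
  selected for its small entry value, which biases its law. The Markov property is therefore
  obtained from the child towards the parent: a fresh tree of level \<open>y\<close> with an
  independent weight \<open>u\<close> forces the pivot \<open>max u (b y)\<close> on its parent, and
  reading the biased joint law from the parent's side gives the kernel. The factor by which
  \<open>r y\<close> differs from \<open>(\<theta> y)\<^sup>2 / y\<close> is the second-order Taylor
  remainder of the generating function around \<open>\<theta> y\<close>, that of \<open>H y\<close>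
  the remainder at 0. Both tend to half the second factorial moment of \<open>Z\<close>; this number
  depends on \<open>Z\<close>, but only the quotient of the two matters, so no parameter is left in
  the limit. Each \<open>k\<close> has its own driving variables, all cut from one Poisson
  configuration: only the law of the chain for fixed \<open>k\<close> has to be matched, and
  convergence in distribution follows from convergence for almost every configuration by dominated
  convergence.\<close>

lemma time_change_inverse:
  assumes "time_change a \<tau>" "\<forall>t\<ge>a. \<bar>\<tau> t - t\<bar> < \<delta>"
  obtains \<sigma> where "time_change a \<sigma>" "\<forall>t\<ge>a. \<bar>\<sigma> t - t\<bar> < \<delta>" "\<forall>s\<ge>a. \<sigma> s \<ge> a \<and> \<tau> (\<sigma> s) = s"
proof -
  define \<sigma> where "\<sigma> = inv_into {a..} \<tau>"
  have mono: "strict_mono_on {a..} \<tau>" and im: "\<tau> ` {a..} = {a..}"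
    using assms(1) by (auto simp: time_change_def)
  have inj: "inj_on \<tau> {a..}" using mono by (rule strict_mono_on_imp_inj_on)
  have \<sigma>: "\<sigma> s \<ge> a \<and> \<tau> (\<sigma> s) = s" if "s \<ge> a" for s
  proof -
    have "s \<in> \<tau> ` {a..}" using that im by auto
    then show ?thesis
      unfolding \<sigma>_def using inv_into_into[of s \<tau> "{a..}"] f_inv_into_f[of s \<tau> "{a..}"] by auto
  qed
  have "strict_mono_on {a..} \<sigma>"
  proof (rule strict_mono_onI)
    fix r s assume "r \<in> {a..}" "s \<in> {a..}" "r < s"
    then show "\<sigma> r < \<sigma> s"
      using \<sigma>[of r] \<sigma>[of s] strict_mono_on_leD[OF mono, of "\<sigma> s" "\<sigma> r"] by force
  qed
  moreover have "\<sigma> ` {a..} = {a..}"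
    using inv_into_image_cancel[OF inj, of "{a..}"] im unfolding \<sigma>_def by simp
  ultimately have "time_change a \<sigma>" by (simp add: time_change_def)
  moreover have "\<forall>t\<ge>a. \<bar>\<sigma> t - t\<bar> < \<delta>"
    using \<sigma> assms(2) by (metis abs_minus_commute)
  ultimately show thesis using that \<sigma> by blast
qed

lemma time_change_compose:
  assumes "time_change a \<tau>" "time_change a \<sigma>"
  shows "time_change a (\<sigma> \<circ> \<tau>)"
proof -
  have "(\<sigma> \<circ> \<tau>) ` {a..} = {a..}"
    using assms unfolding time_change_def by (metis image_comp)
  moreover have "\<tau> t \<in> {a..}" if "t \<in> {a..}" for t
    using assms(1) that unfolding time_change_def by blast
  ultimately show ?thesis
    using assms unfolding time_change_def strict_mono_on_def by simp
qed

lemma time_change_ge: "time_change a \<tau> \<Longrightarrow> t \<ge> a \<Longrightarrow> \<tau> t \<ge> a"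
  unfolding time_change_def by auto

text \<open>The first time change can carry a time of \<open>[a, m]\<close> almost up to
  \<open>m + \<delta>\<close>, so the second closeness has to hold on that longer window.\<close>

lemma skorohod_nbhd_trans:
  assumes "y \<in> skorohod_nbhd a x m \<delta>" "z \<in> skorohod_nbhd a y m' \<delta>'" "m + \<delta> \<le> m'"
  shows "z \<in> skorohod_nbhd a x m (\<delta> + \<delta>')"
proof -
  obtain \<tau> where \<tau>: "time_change a \<tau>" "\<forall>t\<ge>a. \<bar>\<tau> t - t\<bar> < \<delta>" "\<forall>t\<in>{a..m}. \<bar>y (\<tau> t) - x t\<bar> < \<delta>"
    using assms(1) unfolding skorohod_nbhd_def by blast
  obtain \<sigma> where \<sigma>: "time_change a \<sigma>" "\<forall>t\<ge>a. \<bar>\<sigma> t - t\<bar> < \<delta>'" "\<forall>t\<in>{a..m'}. \<bar>z (\<sigma> t) - y t\<bar> < \<delta>'"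
    and z: "z \<in> cadlag_paths a"
    using assms(2) unfolding skorohod_nbhd_def by blast
  have "\<bar>(\<sigma> \<circ> \<tau>) t - t\<bar> < \<delta> + \<delta>'" if "t \<ge> a" for t
  proof -
    have "\<bar>\<sigma> (\<tau> t) - \<tau> t\<bar> < \<delta>'" "\<bar>\<tau> t - t\<bar> < \<delta>"
      using \<tau>(2) \<sigma>(2) time_change_ge[OF \<tau>(1)] that by blast+
    then show ?thesis by simp
  qed
  moreover have "\<bar>z ((\<sigma> \<circ> \<tau>) t) - x t\<bar> < \<delta> + \<delta>'" if "t \<in> {a..m}" for t
  proof -
    have "\<bar>\<tau> t - t\<bar> < \<delta>" "\<tau> t \<ge> a"
      using \<tau>(2) time_change_ge[OF \<tau>(1)] that by auto
    then have "\<tau> t \<in> {a..m'}" using that assms(3) by auto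
    then have "\<bar>z (\<sigma> (\<tau> t)) - y (\<tau> t)\<bar> < \<delta>'" using \<sigma>(3) by blast
    moreover have "\<bar>y (\<tau> t) - x t\<bar> < \<delta>" using \<tau>(3) that by blast
    ultimately show ?thesis by simp
  qed
  ultimately show ?thesis
    using time_change_compose[OF \<tau>(1) \<sigma>(1)] z unfolding skorohod_nbhd_def by blast
qed

text \<open>The inverse time change moves times by no more than the original one, but it may carry
  them past \<open>m'\<close>; this is why the window loses \<open>\<delta>\<close>.\<close>

lemma skorohod_nbhd_sym:
  assumes "y \<in> skorohod_nbhd a x m \<delta>" "x \<in> cadlag_paths a" "m' + \<delta> \<le> m"
  shows "x \<in> skorohod_nbhd a y m' \<delta>"
proof -
  obtain \<tau> where \<tau>: "time_change a \<tau>" "\<forall>t\<ge>a. \<bar>\<tau> t - t\<bar> < \<delta>" "\<forall>t\<in>{a..m}. \<bar>y (\<tau> t) - x t\<bar> < \<delta>"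
    using assms(1) unfolding skorohod_nbhd_def by blast
  obtain \<sigma> where \<sigma>: "time_change a \<sigma>" "\<forall>t\<ge>a. \<bar>\<sigma> t - t\<bar> < \<delta>" "\<forall>s\<ge>a. \<sigma> s \<ge> a \<and> \<tau> (\<sigma> s) = s"
    using time_change_inverse[OF \<tau>(1,2)] by blast
  have "\<bar>x (\<sigma> t) - y t\<bar> < \<delta>" if "t \<in> {a..m'}" for t
  proof -
    have "\<bar>\<sigma> t - t\<bar> < \<delta>" and s: "\<sigma> t \<ge> a" "\<tau> (\<sigma> t) = t" using \<sigma> that by auto
    then have "\<sigma> t \<in> {a..m}" using that assms(3) by auto
    then have "\<bar>y (\<tau> (\<sigma> t)) - x (\<sigma> t)\<bar> < \<delta>" using \<tau>(3) by blast
    then show ?thesis using s by simp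
  qed
  then show ?thesis using \<sigma> assms(2) unfolding skorohod_nbhd_def by blast
qed

lemma skorohod_nbhd_refl:
  assumes "x \<in> cadlag_paths a" "y \<in> cadlag_paths a" "\<delta> > 0" "\<And>t. t \<in> {a..m} \<Longrightarrow> \<bar>y t - x t\<bar> < \<delta>"
  shows "y \<in> skorohod_nbhd a x m \<delta>"
  unfolding skorohod_nbhd_def using assms
  by (auto intro!: exI[of _ "\<lambda>t. t"] simp: time_change_def strict_mono_on_def)

text \<open>A replacement for metrizability: \<open>U\<close> is exhausted by open sets whose points all have a
  neighbourhood of the same size inside \<open>U\<close>.\<close>

definition skorohod_core :: "real \<Rightarrow> (real \<Rightarrow> real) set \<Rightarrow> nat \<Rightarrow> (real \<Rightarrow> real) set" where
  "skorohod_core a U j = {y \<in> cadlag_paths a. \<exists>m. \<exists>\<delta>>0.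
     \<forall>z \<in> skorohod_nbhd a y m \<delta>. skorohod_nbhd a z (real j) (1 / real (Suc j)) \<subseteq> U}"

text \<open>The condition in the core is imposed on a whole neighbourhood of \<open>y\<close> and
  not at \<open>y\<close> alone, so it is inherited by every point of the neighbourhood of half the
  radius.\<close>

lemma openin_skorohod_core: "openin (skorohod_topology a) (skorohod_core a U j)"
  unfolding openin_skorohod_topology
proof (intro conjI ballI)
  show "skorohod_core a U j \<subseteq> cadlag_paths a" by (auto simp: skorohod_core_def)
next
  fix y assume "y \<in> skorohod_core a U j"
  then obtain m \<delta> where \<delta>: "\<delta> > 0"
    and *: "\<forall>z \<in> skorohod_nbhd a y m \<delta>. skorohod_nbhd a z (real j) (1 / real (Suc j)) \<subseteq> U"
    by (auto simp: skorohod_core_def)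
  have "skorohod_nbhd a y m (\<delta>/2) \<subseteq> skorohod_core a U j"
  proof
    fix z assume z: "z \<in> skorohod_nbhd a y m (\<delta>/2)"
    have "w \<in> skorohod_nbhd a y m \<delta>" if "w \<in> skorohod_nbhd a z (m + \<delta>/2) (\<delta>/2)" for w
      using skorohod_nbhd_trans[OF z that] by simp
    then show "z \<in> skorohod_core a U j"
      using * \<delta> z skorohod_nbhd_subset half_gt_zero[OF \<delta>] unfolding skorohod_core_def by blast
  qed
  then show "\<exists>m. \<exists>\<delta>>0. skorohod_nbhd a y m \<delta> \<subseteq> skorohod_core a U j"
    using \<delta> by (meson half_gt_zero)
qed

definition skorohod_tendsto :: "real \<Rightarrow> (nat \<Rightarrow> real \<Rightarrow> real) \<Rightarrow> (real \<Rightarrow> real) \<Rightarrow> bool" where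
  "skorohod_tendsto a f x \<longleftrightarrow> x \<in> cadlag_paths a \<and>
     (\<forall>m. \<forall>\<delta>>0. eventually (\<lambda>n. f n \<in> skorohod_nbhd a x m \<delta>) sequentially)"

lemma skorohod_tendsto_eventually:
  assumes "skorohod_tendsto a f x" "openin (skorohod_topology a) U" "x \<in> U"
  shows "eventually (\<lambda>n. f n \<in> U) sequentially"
proof -
  obtain m \<delta> where "\<delta> > 0" "skorohod_nbhd a x m \<delta> \<subseteq> U"
    using assms(2,3) unfolding openin_skorohod_topology by blast
  then show ?thesis
    using assms(1) unfolding skorohod_tendsto_def by (metis (mono_tags, lifting) eventually_mono subsetD)
qed

lemma skorohod_tendsto_continuous:
  assumes "skorohod_tendsto a f x" "continuous_map (skorohod_topology a) euclideanreal F"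
  shows "(\<lambda>n. F (f n)) \<longlonglongrightarrow> F x"
proof (rule topological_tendstoI)
  fix S :: "real set" assume S: "open S" "F x \<in> S"
  have "openin (skorohod_topology a) {y \<in> topspace (skorohod_topology a). F y \<in> S}"
    using assms(2) S(1) by (auto simp: continuous_map_def)
  moreover have "x \<in> cadlag_paths a" using assms(1) by (simp add: skorohod_tendsto_def)
  ultimately show "eventually (\<lambda>n. F (f n) \<in> S) sequentially"
    using skorohod_tendsto_eventually[OF assms(1), of "{y \<in> topspace (skorohod_topology a). F y \<in> S}"] S(2)
    by (auto simp: topspace_skorohod_topology elim: eventually_mono)
qed

text \<open>This writes membership of the limit in an open set through countably many conditions on
  the approximants, which is the form that measurability of limits requires. In the converse
  direction the fixed size of the neighbourhoods in the core is decisive: around \<open>f n\<close>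
  they cannot shrink with \<open>n\<close>, so one of them eventually contains the limit.\<close>

lemma skorohod_tendsto_iff_core:
  assumes U: "openin (skorohod_topology a) U" and lim: "skorohod_tendsto a f x"
  shows "x \<in> U \<longleftrightarrow> (\<exists>j. \<exists>N. \<forall>n\<ge>N. f n \<in> skorohod_core a U j)"
proof
  assume "x \<in> U"
  then obtain m \<delta> where \<delta>: "\<delta> > 0" "skorohod_nbhd a x m \<delta> \<subseteq> U"
    using U unfolding openin_skorohod_topology by blast
  \<comment> \<open>Half of \<open>\<delta>\<close> is spent on moving from \<open>x\<close> to
    \<open>z\<close>; \<open>j\<close> is so large that its standard neighbourhood of
    \<open>z\<close> fits into the other half.\<close>
  obtain j :: nat where j: "real j > max (m + \<delta>/2) (2 / \<delta>)" using reals_Archimedean2 by blast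
  have "2 / \<delta> < real (Suc j)" using j by simp
  then have j2: "1 / real (Suc j) \<le> \<delta>/2" using \<delta>(1) by (simp add: field_simps)
  have "skorohod_nbhd a z (real j) (1 / real (Suc j)) \<subseteq> U" if z: "z \<in> skorohod_nbhd a x m (\<delta>/2)" for z
  proof
    fix w assume "w \<in> skorohod_nbhd a z (real j) (1 / real (Suc j))"
    then have "w \<in> skorohod_nbhd a z (m + \<delta>/2) (\<delta>/2)"
      using skorohod_nbhd_mono[of "m + \<delta>/2" "real j" "1 / real (Suc j)" "\<delta>/2" a z] j j2 by auto
    from skorohod_nbhd_trans[OF z this] show "w \<in> U" using \<delta>(2) by auto
  qed
  then have "x \<in> skorohod_core a U j"
    using \<delta>(1) lim unfolding skorohod_core_def skorohod_tendsto_def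
    by (intro CollectI conjI exI[of _ m] exI[of _ "\<delta>/2"]) auto
  then show "\<exists>j. \<exists>N. \<forall>n\<ge>N. f n \<in> skorohod_core a U j"
    using skorohod_tendsto_eventually[OF lim openin_skorohod_core]
    unfolding eventually_sequentially by blast
next
  assume "\<exists>j. \<exists>N. \<forall>n\<ge>N. f n \<in> skorohod_core a U j"
  then obtain j N where jN: "\<And>n. n \<ge> N \<Longrightarrow> f n \<in> skorohod_core a U j" by blast
  have x: "x \<in> cadlag_paths a" using lim by (simp add: skorohod_tendsto_def)
  define \<delta> where "\<delta> = 1 / real (Suc j)"
  have "\<delta> > 0" by (simp add: \<delta>_def)
  \<comment> \<open>The additional \<open>\<delta>\<close> of window is what
    \<open>skorohod_nbhd_sym\<close> consumes.\<close>
  then have "eventually (\<lambda>n. f n \<in> skorohod_nbhd a x (real j + \<delta>) \<delta> \<and> n \<ge> N) sequentially"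
    using lim unfolding skorohod_tendsto_def by (intro eventually_conj eventually_ge_at_top) blast
  then obtain n where n: "f n \<in> skorohod_nbhd a x (real j + \<delta>) \<delta>" "n \<ge> N"
    unfolding eventually_sequentially by blast
  have "x \<in> skorohod_nbhd a (f n) (real j) \<delta>"
    using skorohod_nbhd_sym[OF n(1) x] by simp
  moreover from jN[OF n(2)] obtain m' \<delta>' where "\<delta>' > 0"
    "\<forall>z \<in> skorohod_nbhd a (f n) m' \<delta>'. skorohod_nbhd a z (real j) \<delta> \<subseteq> U" "f n \<in> cadlag_paths a"
    unfolding skorohod_core_def \<delta>_def by blast
  ultimately show "x \<in> U" using skorohod_nbhd_refl[of "f n" a "f n" \<delta>' m'] by auto
qed

section \<open>Borel sets of a topology and measurability of Skorohod limits\<close>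

lemma space_borel_space_of [simp]: "space (borel_space_of T) = topspace T"
  unfolding borel_space_of_def by (rule space_measure_of) (auto dest: openin_subset)

lemma sets_borel_space_of: "sets (borel_space_of T) = sigma_sets (topspace T) {U. openin T U}"
  unfolding borel_space_of_def by (rule sets_measure_of) (auto dest: openin_subset)

lemma measurable_borel_space_ofI:
  assumes "\<And>x. x \<in> space M \<Longrightarrow> f x \<in> topspace T"
    and "\<And>U. openin T U \<Longrightarrow> f -` U \<inter> space M \<in> sets M"
  shows "f \<in> measurable M (borel_space_of T)"
  unfolding borel_space_of_def
  by (rule measurable_measure_of) (use assms in \<open>auto dest: openin_subset\<close>)

lemma measurable_continuous_map:
  assumes "continuous_map T euclideanreal F"
  shows "F \<in> borel_measurable (borel_space_of T)"
proof (rule borel_measurableI)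
  fix S :: "real set" assume "open S"
  then have "openin T {x \<in> topspace T. F x \<in> S}" using assms by (auto simp: continuous_map_def)
  moreover have "F -` S \<inter> space (borel_space_of T) = {x \<in> topspace T. F x \<in> S}" by auto
  ultimately show "F -` S \<inter> space (borel_space_of T) \<in> sets (borel_space_of T)"
    by (auto simp: sets_borel_space_of)
qed

lemma skorohod_limit_measurable:
  assumes f: "\<And>n. f n \<in> measurable M (borel_space_of (skorohod_topology a))"
    and lim: "\<And>\<omega>. \<omega> \<in> space M \<Longrightarrow> skorohod_tendsto a (\<lambda>n. f n \<omega>) (g \<omega>)"
  shows "g \<in> measurable M (borel_space_of (skorohod_topology a))"
proof (rule measurable_borel_space_ofI)
  show "g \<omega> \<in> topspace (skorohod_topology a)" if "\<omega> \<in> space M" for \<omega>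
    using lim[OF that] by (simp add: topspace_skorohod_topology skorohod_tendsto_def)
next
  fix U assume U: "openin (skorohod_topology a) U"
  define E where "E n j = f n -` skorohod_core a U j \<inter> space M" for n j
  have "E n j \<in> sets M" for n j
    using openin_skorohod_core[of a U j] unfolding E_def
    by (intro measurable_sets[OF f]) (simp add: sets_borel_space_of)
  then have "(\<Inter>n\<in>{N..}. E n j) \<in> sets M" for N j
    by (intro sets.countable_INT) auto
  then have "(\<Union>j. \<Union>N. \<Inter>n\<in>{N..}. E n j) \<in> sets M"
    by (intro sets.countable_UN) auto
  also have "(\<Union>j. \<Union>N. \<Inter>n\<in>{N..}. E n j) = g -` U \<inter> space M"
  proof (intro set_eqI)
    fix \<omega>
    have "\<omega> \<in> (\<Inter>n\<in>{N..}. E n j) \<longleftrightarrow> \<omega> \<in> space M \<and> (\<forall>n\<ge>N. f n \<omega> \<in> skorohod_core a U j)" for N j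
      by (auto simp: E_def)
    then show "\<omega> \<in> (\<Union>j. \<Union>N. \<Inter>n\<in>{N..}. E n j) \<longleftrightarrow> \<omega> \<in> g -` U \<inter> space M"
      using skorohod_tendsto_iff_core[OF U lim, of \<omega>] by simp blast
  qed
  finally show "g -` U \<inter> space M \<in> sets M" .
qed

section \<open>Step paths on a grid\<close>

text \<open>Just to the right of \<open>t\<close> the ceiling of \<open>k * s\<close> equals the
  floor of \<open>k * t\<close> plus 1, so this is the right-continuous version of the step function
  with value \<open>v \<lceil>k * t\<rceil>\<close> at \<open>t\<close>.\<close>

definition grid_path :: "real \<Rightarrow> nat \<Rightarrow> (nat \<Rightarrow> real) \<Rightarrow> real \<Rightarrow> real" where
  "grid_path a k v = restrict (\<lambda>t. v (nat \<lfloor>real k * t\<rfloor> + 1)) {a..}"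

lemma eventually_floor_at_right: "eventually (\<lambda>s. \<lfloor>c * s\<rfloor> = \<lfloor>c * t\<rfloor>) (at_right t)" if "c \<ge> 0" for c t :: real
proof (cases "c = 0")
  case False
  then have c: "c > 0" using that by simp
  have "\<lfloor>c * s\<rfloor> = \<lfloor>c * t\<rfloor>" if "s > t" "s < (of_int \<lfloor>c * t\<rfloor> + 1) / c" for s
  proof -
    have "c * s > c * t" "c * s < of_int \<lfloor>c * t\<rfloor> + 1" using that c by (auto simp: field_simps)
    then show ?thesis by linarith
  qed
  moreover have "t < (of_int \<lfloor>c * t\<rfloor> + 1) / c" using c by (simp add: field_simps) linarith
  ultimately show ?thesis unfolding eventually_at_right_field by blast
qed simp

lemma eventually_floor_at_left: "\<exists>n. eventually (\<lambda>s. \<lfloor>c * s\<rfloor> = n) (at_left t)" if "c \<ge> 0" for c t :: real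
proof (cases "c = 0")
  case False
  then have c: "c > 0" using that by simp
  have "\<lfloor>c * s\<rfloor> = \<lceil>c * t\<rceil> - 1" if "s < t" "s > (of_int \<lceil>c * t\<rceil> - 1) / c" for s
  proof -
    have "c * s < c * t" "c * s > of_int \<lceil>c * t\<rceil> - 1" using that c by (auto simp: field_simps)
    then show ?thesis by linarith
  qed
  moreover have "t > (of_int \<lceil>c * t\<rceil> - 1) / c" using c by (simp add: field_simps) linarith
  ultimately show ?thesis unfolding eventually_at_left_field by blast
qed simp

lemma grid_path_cadlag: "grid_path a k v \<in> cadlag_paths a"
  unfolding cadlag_paths_def
proof (intro CollectI conjI allI impI)
  show "grid_path a k v \<in> extensional {a..}" by (simp add: grid_path_def)
  fix t assume t: "a \<le> t"
  have "eventually (\<lambda>s. grid_path a k v s = grid_path a k v t) (at_right t)"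
    using eventually_floor_at_right[OF of_nat_0_le_iff, of k t] eventually_at_right_less[of t]
    by eventually_elim (use t in \<open>auto simp: grid_path_def\<close>)
  then show "continuous (at_right t) (grid_path a k v)"
    unfolding continuous_within by (rule tendsto_eventually)
  assume t: "a < t"
  obtain n where "eventually (\<lambda>s. \<lfloor>real k * s\<rfloor> = n) (at_left t)"
    using eventually_floor_at_left[of "real k" t] by auto
  moreover have "eventually (\<lambda>s. s > a) (at_left t)"
    using t unfolding eventually_at_left_field by blast
  ultimately have "eventually (\<lambda>s. grid_path a k v s = v (nat n + 1)) (at_left t)"
    by eventually_elim (auto simp: grid_path_def)
  then show "\<exists>l. (grid_path a k v \<longlongrightarrow> l) (at_left t)"
    by (intro exI) (rule tendsto_eventually)
qed

text \<open>The map is continuous for the product topology, since up to time \<open>m\<close> a path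
  reads only finitely many entries of \<open>v\<close>; on this countable product the Borel sets are
  those of the product sigma-algebra.\<close>

lemma grid_path_measurable:
  "grid_path a k \<in> measurable (PiM UNIV (\<lambda>_. borel)) (borel_space_of (skorohod_topology a))"
proof (rule measurable_borel_space_ofI)
  fix U assume U: "openin (skorohod_topology a) U"
  have "open (grid_path a k -` U)"
  proof (subst open_subopen, intro ballI)
    fix v assume "v \<in> grid_path a k -` U"
    then obtain m \<delta> where \<delta>: "\<delta> > 0" "skorohod_nbhd a (grid_path a k v) m \<delta> \<subseteq> U"
      using U unfolding openin_skorohod_topology by blast
    define I where "I = {..nat \<lfloor>real k * m\<rfloor> + 1}"
    define V where "V = {w. \<forall>i\<in>I. w i \<in> ball (v i) \<delta>}"
    have "open ((\<lambda>w::nat \<Rightarrow> real. w i) -` ball (v i) \<delta>)" for i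
      by (rule open_vimage) (auto intro: continuous_on_product_coordinates)
    moreover have "V = (\<Inter>i\<in>I. (\<lambda>w. w i) -` ball (v i) \<delta>)" by (auto simp: V_def)
    ultimately have "open V" by (auto intro: open_INT simp: I_def)
    moreover have "v \<in> V" using \<delta> by (simp add: V_def)
    moreover have "V \<subseteq> grid_path a k -` U"
    proof
      fix w assume w: "w \<in> V"
      have "grid_path a k w \<in> skorohod_nbhd a (grid_path a k v) m \<delta>"
      proof (rule skorohod_nbhd_refl[OF grid_path_cadlag grid_path_cadlag \<delta>(1)])
        fix t assume t: "t \<in> {a..m}"
        then have "real k * t \<le> real k * m" by (simp add: mult_left_mono)
        then have "nat \<lfloor>real k * t\<rfloor> + 1 \<in> I" unfolding I_def by (simp add: floor_mono nat_mono)
        then show "\<bar>grid_path a k w t - grid_path a k v t\<bar> < \<delta>"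
          using w t by (auto simp: V_def grid_path_def dist_real_def)
      qed
      then show "w \<in> grid_path a k -` U" using \<delta>(2) by auto
    qed
    ultimately show "\<exists>T. open T \<and> v \<in> T \<and> T \<subseteq> grid_path a k -` U" by blast
  qed
  then have "grid_path a k -` U \<in> sets borel" by simp
  then show "grid_path a k -` U \<inter> space (PiM UNIV (\<lambda>_. borel)) \<in> sets (PiM UNIV (\<lambda>_. borel))"
    by (simp add: sets_PiM_equal_borel space_PiM)
qed (simp add: topspace_skorohod_topology grid_path_cadlag)

section \<open>Pivots and the backbone, sample by sample\<close>

definition subsample :: "sample \<Rightarrow> vertex \<Rightarrow> sample" where
  "subsample \<omega> v = (\<lambda>w. \<omega> (v @ w))"

definition child :: "sample \<Rightarrow> nat \<Rightarrow> sample" where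
  "child \<omega> i = (\<lambda>w. \<omega> (i # w))"

text \<open>The smallest, over downward paths of length \<open>n\<close>, of the largest weight met
  below the root. Truncating the depth gives a recursion from which measurability and the law can be
  read off; the value 0 at depth 0 is neutral because weights are nonnegative on regular
  samples.\<close>

fun pivot_upto :: "nat \<Rightarrow> sample \<Rightarrow> real" where
  "pivot_upto 0 \<omega> = 0"
| "pivot_upto (Suc n) \<omega> =
     Min ((\<lambda>i. max (weight (child \<omega> i) []) (pivot_upto n (child \<omega> i))) ` {..<offspring \<omega> []})"

definition root_pivot :: "sample \<Rightarrow> real" where
  "root_pivot \<omega> = lim (\<lambda>n. pivot_upto n \<omega>)"

text \<open>The least level at which an infinite path can be entered through this vertex, its own
  weight included.\<close>

definition entry :: "sample \<Rightarrow> real" where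
  "entry \<omega> = max (weight \<omega> []) (root_pivot \<omega>)"

text \<open>Among ties the smallest index is taken, so the choice is deterministic and its
  measurability reduces to countably many comparisons.\<close>

definition best :: "sample \<Rightarrow> nat" where
  "best \<omega> = (LEAST i. i < offspring \<omega> [] \<and> entry (child \<omega> i) = root_pivot \<omega>)"

definition advance :: "sample \<Rightarrow> sample" where
  "advance \<omega> = child \<omega> (best \<omega>)"

definition ray :: "sample \<Rightarrow> nat \<Rightarrow> vertex" where
  "ray \<omega> n = map (\<lambda>j. best ((advance ^^ j) \<omega>)) [0..<n]"

definition regular :: "sample \<Rightarrow> bool" where
  "regular \<omega> \<longleftrightarrow> (\<forall>v. offspring \<omega> v \<ge> 1 \<and> 0 \<le> weight \<omega> v \<and> weight \<omega> v \<le> 1)"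

definition distinct_entries :: "sample \<Rightarrow> bool" where
  "distinct_entries \<omega> \<longleftrightarrow>
     (\<forall>v. \<forall>i<offspring \<omega> v. \<forall>j<offspring \<omega> v. i \<noteq> j \<longrightarrow>
        entry (subsample \<omega> (v @ [i])) \<noteq> entry (subsample \<omega> (v @ [j])))"

lemma subsample_simps [simp]:
  "offspring (subsample \<omega> v) w = offspring \<omega> (v @ w)"
  "weight (subsample \<omega> v) w = weight \<omega> (v @ w)"
  "offspring (child \<omega> i) w = offspring \<omega> (i # w)"
  "weight (child \<omega> i) w = weight \<omega> (i # w)"
  "child (subsample \<omega> v) i = subsample \<omega> (v @ [i])"
  "subsample \<omega> [] = \<omega>"
  "subsample (subsample \<omega> v) w = subsample \<omega> (v @ w)"
  by (auto simp: subsample_def child_def offspring_def weight_def)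

lemma child_eq_subsample: "child \<omega> i = subsample \<omega> [i]"
  by (simp add: child_def subsample_def)

lemma regular_subsample: "regular \<omega> \<Longrightarrow> regular (subsample \<omega> v)"
  by (simp add: regular_def)

lemma regular_child: "regular \<omega> \<Longrightarrow> regular (child \<omega> i)"
  by (simp add: regular_def)

lemma Min_image_mono:
  fixes f g :: "'a \<Rightarrow> real"
  assumes "finite A" "A \<noteq> {}" "\<And>x. x \<in> A \<Longrightarrow> f x \<le> g x"
  shows "Min (f ` A) \<le> Min (g ` A)"
  using assms by (subst Min_ge_iff) (auto intro: order_trans[OF Min_le])

lemma pivot_upto_bounds: "regular \<omega> \<Longrightarrow> 0 \<le> pivot_upto n \<omega> \<and> pivot_upto n \<omega> \<le> 1"
proof (induction n arbitrary: \<omega>)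
  case (Suc n)
  have "0 < offspring \<omega> []" using Suc.prems by (auto simp: regular_def Suc_le_eq)
  then have ne: "{..<offspring \<omega> []} \<noteq> {}" by auto
  moreover have "0 \<le> max (weight (child \<omega> i) []) (pivot_upto n (child \<omega> i)) \<and>
      max (weight (child \<omega> i) []) (pivot_upto n (child \<omega> i)) \<le> 1" for i
    using Suc.IH[OF regular_child[OF Suc.prems]] Suc.prems by (auto simp: regular_def le_max_iff_disj)
  ultimately show ?case by (auto simp: Min_ge_iff Min_le_iff)
qed simp

lemma pivot_upto_Suc_mono: "regular \<omega> \<Longrightarrow> pivot_upto n \<omega> \<le> pivot_upto (Suc n) \<omega>"
proof (induction n arbitrary: \<omega>)
  case 0
  then show ?case using pivot_upto_bounds[of \<omega> "Suc 0"] by simp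
next
  case (Suc n)
  have "0 < offspring \<omega> []" using Suc.prems by (auto simp: regular_def Suc_le_eq)
  then have ne: "{..<offspring \<omega> []} \<noteq> {}" by auto
  have "max (weight (child \<omega> i) []) (pivot_upto n (child \<omega> i))
      \<le> max (weight (child \<omega> i) []) (pivot_upto (Suc n) (child \<omega> i))" for i
    using Suc.IH[OF regular_child[OF Suc.prems], of i] by (rule max.mono[OF order_refl])
  then show ?case
    unfolding pivot_upto.simps(2)[of "Suc n" \<omega>] pivot_upto.simps(2)[of n \<omega>]
    by (intro Min_image_mono ne) auto
qed

lemma pivot_upto_mono: "regular \<omega> \<Longrightarrow> m \<le> n \<Longrightarrow> pivot_upto m \<omega> \<le> pivot_upto n \<omega>"
  by (rule lift_Suc_mono_le[of "\<lambda>n. pivot_upto n \<omega>"]) (auto intro: pivot_upto_Suc_mono simp del: pivot_upto.simps)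

lemma pivot_upto_tendsto: "regular \<omega> \<Longrightarrow> (\<lambda>n. pivot_upto n \<omega>) \<longlonglongrightarrow> root_pivot \<omega>"
  unfolding root_pivot_def
  by (rule convergent_LIMSEQ_iff[THEN iffD1], rule Bseq_mono_convergent)
     (auto intro!: BseqI'[of _ 1] pivot_upto_mono simp: pivot_upto_bounds abs_le_iff intro: order_trans[of _ 0])

lemma pivot_upto_le: "regular \<omega> \<Longrightarrow> pivot_upto n \<omega> \<le> root_pivot \<omega>"
  by (rule incseq_le[OF _ pivot_upto_tendsto]) (auto simp: incseq_def intro: pivot_upto_mono)

lemma root_pivot_le_iff: "regular \<omega> \<Longrightarrow> root_pivot \<omega> \<le> x \<longleftrightarrow> (\<forall>n. pivot_upto n \<omega> \<le> x)"
  using pivot_upto_le LIMSEQ_le_const2[OF pivot_upto_tendsto] by (meson order_trans)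

lemma root_pivot_bounds: "regular \<omega> \<Longrightarrow> 0 \<le> root_pivot \<omega> \<and> root_pivot \<omega> \<le> 1"
  using pivot_upto_le[of \<omega> 0] pivot_upto_bounds[of \<omega>] by (auto simp: root_pivot_le_iff)

text \<open>The recursion for the truncated pivots survives the limit because the minimum runs over
  finitely many children: if the entries of all children exceeded the limit, each would do so at
  some finite depth, and one depth \<open>N\<close> would serve for all of them.\<close>

lemma root_pivot_eq_Min:
  assumes "regular \<omega>"
  shows "root_pivot \<omega> = Min ((\<lambda>i. entry (child \<omega> i)) ` {..<offspring \<omega> []})"
proof (rule antisym)
  have pos: "0 < offspring \<omega> []" using assms by (auto simp: regular_def Suc_le_eq)
  then have ne: "{..<offspring \<omega> []} \<noteq> {}" by auto
  have le: "max (weight (child \<omega> i) []) (pivot_upto n (child \<omega> i)) \<le> entry (child \<omega> i)" for i n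
    unfolding entry_def using pivot_upto_le[OF regular_child[OF assms]] by (intro max.mono) auto
  show "root_pivot \<omega> \<le> Min ((\<lambda>i. entry (child \<omega> i)) ` {..<offspring \<omega> []})"
    unfolding root_pivot_le_iff[OF assms]
  proof
    fix n
    have "pivot_upto n \<omega> \<le> pivot_upto (Suc n) \<omega>" by (rule pivot_upto_Suc_mono[OF assms])
    also have "\<dots> \<le> Min ((\<lambda>i. entry (child \<omega> i)) ` {..<offspring \<omega> []})"
      unfolding pivot_upto.simps by (intro Min_image_mono ne le) auto
    finally show "pivot_upto n \<omega> \<le> Min ((\<lambda>i. entry (child \<omega> i)) ` {..<offspring \<omega> []})" .
  qed
  show "Min ((\<lambda>i. entry (child \<omega> i)) ` {..<offspring \<omega> []}) \<le> root_pivot \<omega>"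
  proof (rule ccontr)
    assume "\<not> ?thesis"
    then have gt: "entry (child \<omega> i) > root_pivot \<omega>" if "i < offspring \<omega> []" for i
      using ne that by (auto simp: not_le Min_gr_iff)
    have "\<exists>n. max (weight (child \<omega> i) []) (pivot_upto n (child \<omega> i)) > root_pivot \<omega>"
      if "i < offspring \<omega> []" for i
    proof (cases "weight (child \<omega> i) [] > root_pivot \<omega>")
      case False
      then have "\<not> root_pivot (child \<omega> i) \<le> root_pivot \<omega>"
        using gt[OF that] by (auto simp: entry_def)
      then show ?thesis
        unfolding root_pivot_le_iff[OF regular_child[OF assms]] by (auto simp: less_max_iff_disj not_le)
    qed (auto simp: less_max_iff_disj)
    then obtain n where n: "\<And>i. i < offspring \<omega> [] \<Longrightarrow>
        max (weight (child \<omega> i) []) (pivot_upto (n i) (child \<omega> i)) > root_pivot \<omega>" by metis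
    define N where "N = Max (n ` {..<offspring \<omega> []})"
    have "max (weight (child \<omega> i) []) (pivot_upto N (child \<omega> i)) > root_pivot \<omega>"
      if "i < offspring \<omega> []" for i
    proof -
      have "n i \<le> N" unfolding N_def using that by (intro Max_ge) auto
      then have "pivot_upto (n i) (child \<omega> i) \<le> pivot_upto N (child \<omega> i)"
        by (rule pivot_upto_mono[OF regular_child[OF assms]])
      then show ?thesis using n[OF that] by (auto simp: less_max_iff_disj)
    qed
    then have "pivot_upto (Suc N) \<omega> > root_pivot \<omega>"
      unfolding pivot_upto.simps using ne by (subst Min_gr_iff) auto
    then show False using pivot_upto_le[OF assms, of "Suc N"] by simp
  qed
qed

lemma best_works:
  assumes "regular \<omega>"
  shows "best \<omega> < offspring \<omega> []" "entry (child \<omega> (best \<omega>)) = root_pivot \<omega>"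
proof -
  have "0 < offspring \<omega> []" using assms by (auto simp: regular_def Suc_le_eq)
  then have ne: "{..<offspring \<omega> []} \<noteq> {}" by auto
  have "root_pivot \<omega> \<in> (\<lambda>i. entry (child \<omega> i)) ` {..<offspring \<omega> []}"
    unfolding root_pivot_eq_Min[OF assms] using ne by (intro Min_in) auto
  then have "\<exists>i. i < offspring \<omega> [] \<and> entry (child \<omega> i) = root_pivot \<omega>" by auto
  from LeastI_ex[OF this] show "best \<omega> < offspring \<omega> []" "entry (child \<omega> (best \<omega>)) = root_pivot \<omega>"
    unfolding best_def by auto
qed

lemma root_pivot_le_entry: "regular \<omega> \<Longrightarrow> i < offspring \<omega> [] \<Longrightarrow> root_pivot \<omega> \<le> entry (child \<omega> i)"
  by (subst root_pivot_eq_Min) auto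

text \<open>The choice of the child is expressed by comparisons of entries alone, so that it can be
  integrated over independent subtrees. The strict comparison to the left and the weak one to the
  right reflect the tie-breaking by the smallest index.\<close>

lemma best_eq_iff:
  assumes "regular \<omega>" "i < offspring \<omega> []"
  shows "best \<omega> = i \<longleftrightarrow> (\<forall>j<offspring \<omega> []. (j < i \<longrightarrow> entry (child \<omega> i) < entry (child \<omega> j)) \<and>
                                    (i < j \<longrightarrow> entry (child \<omega> i) \<le> entry (child \<omega> j)))" (is "_ \<longleftrightarrow> ?R")
proof
  assume b: "best \<omega> = i"
  have e: "entry (child \<omega> i) = root_pivot \<omega>" using best_works(2)[OF assms(1)] b by simp
  show ?R
  proof (intro allI impI conjI)
    fix j assume j: "j < offspring \<omega> []"
    show "entry (child \<omega> i) \<le> entry (child \<omega> j)" using root_pivot_le_entry[OF assms(1) j] e by simp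
    assume "j < i"
    then have "entry (child \<omega> j) \<noteq> root_pivot \<omega>" using not_less_Least[of j] j b unfolding best_def by blast
    then show "entry (child \<omega> i) < entry (child \<omega> j)" using root_pivot_le_entry[OF assms(1) j] e by simp
  qed
next
  assume R: ?R
  then have "entry (child \<omega> i) \<le> entry (child \<omega> j)" if "j < offspring \<omega> []" for j
    using that by (metis less_imp_le linorder_neqE_nat order_refl)
  then have e: "entry (child \<omega> i) = root_pivot \<omega>"
    using best_works[OF assms(1)] root_pivot_le_entry[OF assms] by (metis order_antisym)
  show "best \<omega> = i" unfolding best_def
  proof (rule Least_equality)
    show "i < offspring \<omega> [] \<and> entry (child \<omega> i) = root_pivot \<omega>" using e assms by simp
    fix j assume "j < offspring \<omega> [] \<and> entry (child \<omega> j) = root_pivot \<omega>"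
    then show "i \<le> j" using R e by (metis less_irrefl not_le)
  qed
qed

lemma advance_pow_eq_subsample: "(advance ^^ n) \<omega> = subsample \<omega> (ray \<omega> n)"
proof (induction n)
  case (Suc n)
  have "ray \<omega> (Suc n) = ray \<omega> n @ [best ((advance ^^ n) \<omega>)]" by (simp add: ray_def)
  then show ?case using Suc by (simp add: advance_def)
qed (simp add: ray_def)

lemma ray_Suc: "ray \<omega> (Suc n) = ray \<omega> n @ [best (subsample \<omega> (ray \<omega> n))]"
  unfolding advance_pow_eq_subsample[symmetric] by (simp add: ray_def)

lemma ray_0 [simp]: "ray \<omega> 0 = []" by (simp add: ray_def)

text \<open>The entry of each vertex of the ray is the pivot of its predecessor. Hence the pivots do
  not increase along the ray, and each of them bounds the next weight.\<close>

lemma ray_pivot_le: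
  assumes "regular \<omega>"
  shows "root_pivot (subsample \<omega> (ray \<omega> n)) \<le> root_pivot \<omega>"
    "weight \<omega> (ray \<omega> (Suc n)) \<le> root_pivot \<omega>"
proof -
  have e: "entry (subsample \<omega> (ray \<omega> (Suc n))) = root_pivot (subsample \<omega> (ray \<omega> n))" for n
    using best_works(2)[OF regular_subsample[OF assms, of "ray \<omega> n"]] by (simp add: ray_Suc)
  then have e': "root_pivot (subsample \<omega> (ray \<omega> (Suc n))) \<le> root_pivot (subsample \<omega> (ray \<omega> n))"
    "weight \<omega> (ray \<omega> (Suc n)) \<le> root_pivot (subsample \<omega> (ray \<omega> n))" for n
  proof -
    have "max (weight \<omega> (ray \<omega> (Suc n))) (root_pivot (subsample \<omega> (ray \<omega> (Suc n)))) = root_pivot (subsample \<omega> (ray \<omega> n))"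
      using e[of n] by (simp add: entry_def)
    then show "root_pivot (subsample \<omega> (ray \<omega> (Suc n))) \<le> root_pivot (subsample \<omega> (ray \<omega> n))"
      "weight \<omega> (ray \<omega> (Suc n)) \<le> root_pivot (subsample \<omega> (ray \<omega> n))"
      by linarith+
  qed
  show *: "root_pivot (subsample \<omega> (ray \<omega> n)) \<le> root_pivot \<omega>" for n
    by (induction n) (auto intro: order_trans[OF e'(1)])
  show "weight \<omega> (ray \<omega> (Suc n)) \<le> root_pivot \<omega>" using e'(2)[of n] *[of n] by simp
qed

lemma GW_tree_snoc: "v @ [i] \<in> GW_tree \<omega> \<longleftrightarrow> v \<in> GW_tree \<omega> \<and> i < offspring \<omega> v"
  by (auto intro: GW_tree.child elim: GW_tree.cases)

lemma append_ray_in_tree: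
  assumes "regular \<omega>" "v \<in> GW_tree \<omega>"
  shows "v @ ray (subsample \<omega> v) n \<in> GW_tree \<omega>"
proof (induction n)
  case (Suc n)
  have "best (subsample \<omega> (v @ ray (subsample \<omega> v) n)) < offspring \<omega> (v @ ray (subsample \<omega> v) n)"
    using best_works(1)[OF regular_subsample[OF assms(1), of "v @ ray (subsample \<omega> v) n"]] by simp
  then show ?case using Suc by (simp add: ray_Suc GW_tree_snoc flip: append_assoc)
qed (use assms in simp)

text \<open>The ray of best children attains the bound, so the \<open>LEAST\<close> in
  \<open>pivot\<close> is taken over a set that has a minimum.\<close>

lemma pivot_path:
  assumes "regular \<omega>" "v \<in> GW_tree \<omega>"
  shows "\<exists>\<eta>. downward_path \<omega> v \<eta> \<and> (\<forall>n. weight \<omega> (\<eta> (Suc n)) \<le> root_pivot (subsample \<omega> v))"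
proof (intro exI conjI allI)
  show "downward_path \<omega> v (\<lambda>n. v @ ray (subsample \<omega> v) n)"
    using append_ray_in_tree[OF assms] by (simp add: downward_path_def child_of_def ray_Suc)
  show "weight \<omega> (v @ ray (subsample \<omega> v) (Suc n)) \<le> root_pivot (subsample \<omega> v)" for n
    using ray_pivot_le(2)[OF regular_subsample[OF assms(1), of v], of n] by simp
qed

text \<open>Following the path through the recursion bounds the truncated pivot of every depth, and
  these determine the limit.\<close>

lemma root_pivot_le_path:
  assumes "regular \<omega>" "downward_path \<omega> v \<eta>" "\<forall>n. weight \<omega> (\<eta> (Suc n)) \<le> x"
  shows "root_pivot (subsample \<omega> v) \<le> x"
  unfolding root_pivot_le_iff[OF regular_subsample[OF assms(1)]]
proof
  fix n
  show "pivot_upto n (subsample \<omega> v) \<le> x"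
    using assms(2,3)
  proof (induction n arbitrary: v \<eta>)
    case 0
    have "0 \<le> weight \<omega> (\<eta> (Suc 0))" using assms(1) by (auto simp: regular_def)
    also have "\<dots> \<le> x" using 0 by blast
    finally show ?case by simp
  next
    case (Suc n)
    from Suc.prems(1) obtain i where i: "\<eta> (Suc 0) = v @ [i]" "\<eta> (Suc 0) \<in> GW_tree \<omega>"
      unfolding downward_path_def child_of_def by metis
    then have "i < offspring \<omega> v" by (simp add: GW_tree_snoc)
    moreover have "pivot_upto n (subsample \<omega> (v @ [i])) \<le> x"
    proof (rule Suc.IH)
      show "downward_path \<omega> (v @ [i]) (\<lambda>n. \<eta> (Suc n))"
        using Suc.prems(1) i unfolding downward_path_def by auto
    qed (use Suc.prems in auto)
    moreover have "weight \<omega> (v @ [i]) \<le> x" using Suc.prems(2) i by metis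
    ultimately have "max (weight (child (subsample \<omega> v) i) []) (pivot_upto n (child (subsample \<omega> v) i)) \<le> x"
      by simp
    moreover have "pivot_upto (Suc n) (subsample \<omega> v)
        \<le> max (weight (child (subsample \<omega> v) i) []) (pivot_upto n (child (subsample \<omega> v) i))"
      unfolding pivot_upto.simps using \<open>i < offspring \<omega> v\<close> by (intro Min_le imageI finite_imageI) auto
    ultimately show ?case by (rule order_trans[rotated])
  qed
qed

lemma pivot_eq_root_pivot:
  assumes "regular \<omega>" "v \<in> GW_tree \<omega>"
  shows "pivot \<omega> v = root_pivot (subsample \<omega> v)"
  unfolding pivot_def
  by (rule Least_equality) (use pivot_path[OF assms] root_pivot_le_path[OF assms(1)] in blast)+

section \<open>The invasion cluster and its infinite path\<close>

definition tree_cluster :: "sample \<Rightarrow> vertex set \<Rightarrow> bool" where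
  "tree_cluster \<omega> S \<longleftrightarrow> finite S \<and> [] \<in> S \<and> S \<subseteq> GW_tree \<omega> \<and> (\<forall>v i. v @ [i] \<in> S \<longrightarrow> v \<in> S)"

lemma outer_boundary_eq:
  assumes "tree_cluster \<omega> S"
  shows "outer_boundary \<omega> S = {v @ [i] | v i. v \<in> S \<and> i < offspring \<omega> v \<and> v @ [i] \<notin> S}"
  using assms unfolding outer_boundary_def adjacent_def child_of_def tree_cluster_def
  by (auto simp: GW_tree_snoc)

lemma outer_boundary_finite_nonempty:
  assumes "tree_cluster \<omega> S" "regular \<omega>"
  shows "finite (outer_boundary \<omega> S)" "outer_boundary \<omega> S \<noteq> {}"
proof -
  have S: "finite S" "[] \<in> S" using assms by (auto simp: tree_cluster_def)
  have "outer_boundary \<omega> S \<subseteq> (\<Union>v\<in>S. (\<lambda>i. v @ [i]) ` {..<offspring \<omega> v})"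
    unfolding outer_boundary_eq[OF assms(1)] by auto
  then show "finite (outer_boundary \<omega> S)" by (rule finite_subset) (use S in auto)
  \<comment> \<open>A deepest vertex of \<open>S\<close> has its first child outside
    \<open>S\<close>.\<close>
  define l where "l = Max (length ` S)"
  have "l \<in> length ` S" unfolding l_def using S by (intro Max_in) auto
  then obtain v where v: "v \<in> S" "length v = l" by auto
  have "v @ [0] \<notin> S"
  proof
    assume "v @ [0] \<in> S"
    then have "length (v @ [0]) \<le> l" unfolding l_def using S by (intro Max_ge imageI finite_imageI)
    then show False using v by simp
  qed
  moreover have "0 < offspring \<omega> v" using assms(2) by (auto simp: regular_def Suc_le_eq)
  ultimately show "outer_boundary \<omega> S \<noteq> {}" unfolding outer_boundary_eq[OF assms(1)] using v by auto
qed

lemma invasion_next: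
  assumes "tree_cluster \<omega> S" "regular \<omega>"
  defines "w \<equiv> arg_min_on (weight \<omega>) (outer_boundary \<omega> S)"
  shows "w \<in> outer_boundary \<omega> S" "\<And>u. u \<in> outer_boundary \<omega> S \<Longrightarrow> weight \<omega> w \<le> weight \<omega> u"
  using arg_min_if_finite[OF outer_boundary_finite_nonempty[OF assms(1,2)], of "weight \<omega>"]
  unfolding w_def by (auto simp: not_less)

lemma tree_cluster_invasion_step: "regular \<omega> \<Longrightarrow> tree_cluster \<omega> (invasion_step \<omega> n)"
proof (induction n)
  case 0
  then show ?case by (auto simp: tree_cluster_def intro: GW_tree.root)
next
  case (Suc n)
  have IH: "tree_cluster \<omega> (invasion_step \<omega> n)" using Suc by blast
  define w where "w = arg_min_on (weight \<omega>) (outer_boundary \<omega> (invasion_step \<omega> n))"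
  have "w \<in> outer_boundary \<omega> (invasion_step \<omega> n)"
    unfolding w_def by (rule invasion_next(1)[OF IH Suc.prems])
  then obtain v i where "w = v @ [i]" "v \<in> invasion_step \<omega> n" "i < offspring \<omega> v"
    unfolding outer_boundary_eq[OF IH] by auto
  then have "tree_cluster \<omega> (insert w (invasion_step \<omega> n))"
    using IH by (auto simp: tree_cluster_def GW_tree_snoc)
  then show ?case by (simp add: w_def)
qed

lemma card_invasion_step: "regular \<omega> \<Longrightarrow> card (invasion_step \<omega> n) = Suc n"
proof (induction n)
  case (Suc n)
  have tc: "tree_cluster \<omega> (invasion_step \<omega> n)" by (rule tree_cluster_invasion_step[OF Suc.prems])
  have "arg_min_on (weight \<omega>) (outer_boundary \<omega> (invasion_step \<omega> n)) \<notin> invasion_step \<omega> n"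
    using invasion_next(1)[OF tc Suc.prems] by (auto simp: outer_boundary_def)
  moreover have "finite (invasion_step \<omega> n)" using tc by (simp add: tree_cluster_def)
  ultimately show ?case using Suc by simp
qed simp

lemma tree_cluster_prefix:
  assumes "\<And>v i. v @ [i] \<in> S \<Longrightarrow> v \<in> S" "v @ u \<in> S"
  shows "v \<in> S"
  using assms(2) by (induction u rule: rev_induct) (auto dest: assms(1) simp flip: append_assoc)

lemma invasion_cluster_snoc: "regular \<omega> \<Longrightarrow> v @ [i] \<in> invasion_cluster \<omega> \<Longrightarrow> v \<in> invasion_cluster \<omega>"
  using tree_cluster_invasion_step unfolding invasion_cluster_def tree_cluster_def by blast

lemma invasion_cluster_subset: "regular \<omega> \<Longrightarrow> invasion_cluster \<omega> \<subseteq> GW_tree \<omega>"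
  using tree_cluster_invasion_step unfolding invasion_cluster_def tree_cluster_def by blast

lemma infinite_invasion_cluster:
  assumes "regular \<omega>"
  shows "infinite (invasion_cluster \<omega>)"
proof
  assume fin: "finite (invasion_cluster \<omega>)"
  have "invasion_step \<omega> (card (invasion_cluster \<omega>)) \<subseteq> invasion_cluster \<omega>"
    by (auto simp: invasion_cluster_def)
  from card_mono[OF fin this] show False by (simp add: card_invasion_step[OF assms])
qed

lemma downward_path_length: "downward_path \<omega> v \<eta> \<Longrightarrow> length (\<eta> n) = length v + n"
  by (induction n) (auto simp: downward_path_def child_of_def, metis length_append_singleton)

text \<open>As long as the path realising the pivot of \<open>v\<close> is not exhausted, its first vertex outside the
  current cluster competes with every vertex invaded below \<open>v\<close>.\<close>

lemma invaded_weight_le_pivot: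
  assumes "regular \<omega>" "v @ u \<in> invasion_cluster \<omega>" "u \<noteq> []"
  shows "weight \<omega> (v @ u) \<le> root_pivot (subsample \<omega> v)"
proof -
  define w where "w = v @ u"
  have "\<exists>n. w \<in> invasion_step \<omega> n" using assms by (auto simp: invasion_cluster_def w_def)
  define N where "N = (LEAST n. w \<in> invasion_step \<omega> n)"
  have N: "w \<in> invasion_step \<omega> N" unfolding N_def by (rule LeastI_ex) fact
  have "w \<noteq> []" using assms by (simp add: w_def)
  then have "N \<noteq> 0" using N by (cases N) auto
  then obtain n where n: "N = Suc n" by (cases N) auto
  have "w \<notin> invasion_step \<omega> n" using not_less_Least[of n "\<lambda>n. w \<in> invasion_step \<omega> n"] n unfolding N_def by auto
  define S where "S = invasion_step \<omega> n"
  have tc: "tree_cluster \<omega> S" unfolding S_def by (rule tree_cluster_invasion_step[OF assms(1)])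
  have w: "w = arg_min_on (weight \<omega>) (outer_boundary \<omega> S)"
    using N \<open>w \<notin> invasion_step \<omega> n\<close> unfolding n S_def by simp
  obtain u' i where u: "u = u' @ [i]" using assms(3) by (cases u rule: rev_cases) auto
  have "w \<in> outer_boundary \<omega> S" unfolding w by (rule invasion_next(1)[OF tc assms(1)])
  then have "v @ u' \<in> S"
    unfolding outer_boundary_eq[OF tc] w_def u by (auto simp flip: append_assoc)
  then have "v \<in> S" by (rule tree_cluster_prefix[rotated]) (use tc in \<open>auto simp: tree_cluster_def\<close>)
  then have "v \<in> GW_tree \<omega>" using tc by (auto simp: tree_cluster_def)
  from pivot_path[OF assms(1) this] obtain \<eta> where \<eta>: "downward_path \<omega> v \<eta>"
    "\<And>n. weight \<omega> (\<eta> (Suc n)) \<le> root_pivot (subsample \<omega> v)" by auto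
  have "inj \<eta>" using downward_path_length[OF \<eta>(1)] by (intro injI) (metis add_left_cancel)
  then have "\<not> range \<eta> \<subseteq> S"
    using tc by (metis finite_subset infinite_UNIV_nat finite_imageD tree_cluster_def)
  then have ex: "\<exists>j. \<eta> j \<notin> S" by auto
  define J where "J = (LEAST j. \<eta> j \<notin> S)"
  have J: "\<eta> J \<notin> S" unfolding J_def by (rule LeastI_ex[OF ex])
  have "J \<noteq> 0" using J \<eta>(1) \<open>v \<in> S\<close> by (metis downward_path_def)
  then obtain j where j: "J = Suc j" by (cases J) auto
  have "\<eta> j \<in> S" using not_less_Least[of j "\<lambda>j. \<eta> j \<notin> S"] j unfolding J_def by auto
  moreover obtain i where "\<eta> J = \<eta> j @ [i]" "\<eta> J \<in> GW_tree \<omega>"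
    using \<eta>(1) unfolding downward_path_def child_of_def j by metis
  ultimately have "\<eta> J \<in> outer_boundary \<omega> S"
    using J unfolding outer_boundary_eq[OF tc] by (auto simp: GW_tree_snoc)
  from invasion_next(2)[OF tc assms(1) this] have "weight \<omega> w \<le> weight \<omega> (\<eta> J)" unfolding w .
  also have "\<dots> \<le> root_pivot (subsample \<omega> v)" unfolding j by (rule \<eta>(2))
  finally show ?thesis by (simp add: w_def)
qed

text \<open>Koenig's lemma: a vertex with infinitely many invaded descendants has a child with the
  same property, because its degree is finite.\<close>

lemma invasion_path_exists:
  assumes "regular \<omega>"
  shows "\<exists>\<gamma>. \<gamma> 0 = [] \<and> nonbacktracking_path (invasion_cluster \<omega>) \<gamma>"
proof -
  let ?I = "invasion_cluster \<omega>"
  define D where "D v = {w \<in> ?I. \<exists>u. w = v @ u}" for v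
  have DI: "v \<in> ?I" if inf: "infinite (D v)" for v
  proof -
    have "D v \<noteq> {}" using inf by auto
    then obtain u where "v @ u \<in> ?I" by (auto simp: D_def)
    then show ?thesis by (rule tree_cluster_prefix[rotated]) (rule invasion_cluster_snoc[OF assms])
  qed
  have step: "\<exists>w. infinite (D w) \<and> child_of w v" if inf: "infinite (D v)" for v
  proof (rule ccontr)
    assume "\<not> ?thesis"
    then have fin: "finite (D (v @ [i]))" for i by (auto simp: child_of_def)
    have "D v \<subseteq> insert v (\<Union>i<offspring \<omega> v. D (v @ [i]))"
    proof
      fix w assume "w \<in> D v"
      then obtain u where u: "w = v @ u" "w \<in> ?I" by (auto simp: D_def)
      show "w \<in> insert v (\<Union>i<offspring \<omega> v. D (v @ [i]))"
      proof (cases u)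
        case (Cons i u')
        have "(v @ [i]) @ u' \<in> ?I" using u Cons by simp
        then have "v @ [i] \<in> ?I" by (rule tree_cluster_prefix[rotated]) (rule invasion_cluster_snoc[OF assms])
        then have "i < offspring \<omega> v" using invasion_cluster_subset[OF assms] by (auto simp: GW_tree_snoc)
        then show ?thesis using u Cons by (auto simp: D_def)
      qed (use u in auto)
    qed
    then show False using inf fin by (meson finite.insertI finite_UN finite_lessThan finite_subset)
  qed
  have "D [] = ?I" by (auto simp: D_def)
  then have "infinite (D [])" using infinite_invasion_cluster[OF assms] by simp
  then have "\<exists>\<gamma>. \<forall>n. (infinite (D (\<gamma> n)) \<and> (n = 0 \<longrightarrow> \<gamma> n = [])) \<and> child_of (\<gamma> (Suc n)) (\<gamma> n)"
    using step by (intro dependent_nat_choice) auto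
  then obtain \<gamma> where \<gamma>: "\<And>n. infinite (D (\<gamma> n))" "\<gamma> 0 = []" "\<And>n. child_of (\<gamma> (Suc n)) (\<gamma> n)" by blast
  have "\<gamma> (Suc (Suc n)) \<noteq> \<gamma> n" for n
    using \<gamma>(3)[of n] \<gamma>(3)[of "Suc n"] by (auto simp: child_of_def)
  then have "nonbacktracking_path ?I \<gamma>"
    using \<gamma> DI unfolding nonbacktracking_path_def adjacent_def by blast
  then show ?thesis using \<gamma>(2) by blast
qed

text \<open>At the root there is no way up, and after a step down the only upward neighbour is the
  vertex just left.\<close>

lemma nonbacktracking_path_downward:
  assumes "\<gamma> 0 = []" "nonbacktracking_path S \<gamma>"
  shows "child_of (\<gamma> (Suc n)) (\<gamma> n)"
proof (induction n)
  case 0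
  then show ?case using assms unfolding nonbacktracking_path_def adjacent_def child_of_def
    by (metis Nil_is_append_conv not_Cons_self2)
next
  case (Suc n)
  have "adjacent (\<gamma> (Suc n)) (\<gamma> (Suc (Suc n)))" "\<gamma> (Suc (Suc n)) \<noteq> \<gamma> n"
    using assms unfolding nonbacktracking_path_def by blast+
  then show ?case using Suc unfolding adjacent_def child_of_def by auto
qed

lemma invasion_path_eq_ray:
  assumes "regular \<omega>" "distinct_entries \<omega>" "\<gamma> 0 = []" "nonbacktracking_path (invasion_cluster \<omega>) \<gamma>"
  shows "\<gamma> n = ray \<omega> n"
proof (induction n)
  case (Suc n)
  let ?I = "invasion_cluster \<omega>"
  have down: "child_of (\<gamma> (Suc n)) (\<gamma> n)" for n
    by (rule nonbacktracking_path_downward[OF assms(3,4)])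
  have inI: "\<gamma> n \<in> ?I" for n using assms(4) by (simp add: nonbacktracking_path_def)
  have ext: "\<exists>u. \<gamma> (m + k) = \<gamma> m @ u \<and> length u = k" for m k
  proof (induction k)
    case (Suc k)
    then show ?case using down[of "m + k"] by (auto simp: child_of_def)
  qed simp
  have wt: "weight \<omega> (\<gamma> (n + Suc k)) \<le> root_pivot (subsample \<omega> (\<gamma> n))" for k
  proof -
    obtain u where "\<gamma> (n + Suc k) = \<gamma> n @ u" "length u = Suc k" using ext[of n "Suc k"] by blast
    moreover from this have "u \<noteq> []" by auto
    ultimately show ?thesis using invaded_weight_le_pivot[OF assms(1), of "\<gamma> n" u] inI[of "n + Suc k"] by auto
  qed
  obtain i where i: "\<gamma> (Suc n) = \<gamma> n @ [i]" using down[of n] by (auto simp: child_of_def)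
  \<comment> \<open>The tail of \<open>\<gamma>\<close> is itself a downward path whose weights stay
    below the pivot of \<open>\<gamma> n\<close>, so it bounds the pivot of the next vertex.\<close>
  have "downward_path \<omega> (\<gamma> (Suc n)) (\<lambda>k. \<gamma> (Suc n + k))"
    unfolding downward_path_def using down inI invasion_cluster_subset[OF assms(1)] by auto
  then have "root_pivot (subsample \<omega> (\<gamma> (Suc n))) \<le> root_pivot (subsample \<omega> (\<gamma> n))"
  proof (rule root_pivot_le_path[OF assms(1)], intro allI)
    fix k
    show "weight \<omega> (\<gamma> (Suc n + Suc k)) \<le> root_pivot (subsample \<omega> (\<gamma> n))"
      using wt[of "Suc k"] by simp
  qed
  then have le: "entry (child (subsample \<omega> (\<gamma> n)) i) \<le> root_pivot (subsample \<omega> (\<gamma> n))"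
    using wt[of 0] i by (simp add: entry_def)
  have reg: "regular (subsample \<omega> (\<gamma> n))" by (rule regular_subsample[OF assms(1)])
  have "\<gamma> (Suc n) \<in> GW_tree \<omega>" using inI invasion_cluster_subset[OF assms(1)] by auto
  then have off: "i < offspring \<omega> (\<gamma> n)" using i by (simp add: GW_tree_snoc)
  have "entry (child (subsample \<omega> (\<gamma> n)) i) = root_pivot (subsample \<omega> (\<gamma> n))"
    using le root_pivot_le_entry[OF reg, of i] off by simp
  then have "entry (subsample \<omega> (\<gamma> n @ [i])) = entry (subsample \<omega> (\<gamma> n @ [best (subsample \<omega> (\<gamma> n))]))"
    using best_works(2)[OF reg] by simp
  then have "i = best (subsample \<omega> (\<gamma> n))"
    using assms(2) off best_works(1)[OF reg] unfolding distinct_entries_def by auto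
  then show ?case using i Suc by (simp add: ray_Suc)
qed (use assms in simp)

theorem pivot_backbone:
  assumes "regular \<omega>" "distinct_entries \<omega>"
  shows "pivot \<omega> (backbone \<omega> n) = root_pivot ((advance ^^ n) \<omega>)"
proof -
  obtain \<gamma> where \<gamma>: "\<gamma> 0 = [] \<and> nonbacktracking_path (invasion_cluster \<omega>) \<gamma>"
    using invasion_path_exists[OF assms(1)] by blast
  have eq: "\<gamma>' = ray \<omega>" if "\<gamma>' 0 = [] \<and> nonbacktracking_path (invasion_cluster \<omega>) \<gamma>'" for \<gamma>'
    using invasion_path_eq_ray[OF assms] that by blast
  have "backbone \<omega> = ray \<omega>" unfolding backbone_def
    by (rule the_equality) (use \<gamma> eq in metis)+
  moreover have "ray \<omega> n \<in> GW_tree \<omega>"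
    using append_ray_in_tree[OF assms(1) GW_tree.root, of n] by simp
  ultimately show ?thesis
    by (simp add: pivot_eq_root_pivot[OF assms(1)] advance_pow_eq_subsample)
qed

section \<open>The offspring generating function\<close>

text \<open>The quadratic remainder grows only like \<open>d\<^sup>2\<close>, uniformly in
  \<open>a\<close> and \<open>b\<close>, and is therefore integrable over an offspring law with a
  second moment.\<close>

lemma power_taylor2:
  fixes a b :: real
  assumes "\<bar>a\<bar> \<le> 1" "\<bar>b\<bar> \<le> 1"
  shows "\<bar>a ^ d - b ^ d - real d * b ^ (d - 1) * (a - b)\<bar> \<le> (real d)\<^sup>2 * (a - b)\<^sup>2"
proof (induction d)
  case (Suc d)
  let ?E = "a ^ d - b ^ d - real d * b ^ (d - 1) * (a - b)"
  define c where "c = real d * b ^ (d - 1)"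
  have "real d * b ^ d = c * b" unfolding c_def by (cases d) auto
  then have "a ^ Suc d - b ^ Suc d - real (Suc d) * b ^ (Suc d - 1) * (a - b)
      = a * a ^ d - b * b ^ d - (c * b + b ^ d) * (a - b)"
    by (simp add: algebra_simps)
  also have "\<dots> = a * (a ^ d - b ^ d - c * (a - b)) + c * (a - b)\<^sup>2"
    by (simp add: algebra_simps power2_eq_square)
  finally have "a ^ Suc d - b ^ Suc d - real (Suc d) * b ^ (Suc d - 1) * (a - b)
      = a * ?E + real d * b ^ (d - 1) * (a - b)\<^sup>2" by (simp only: c_def)
  moreover have "\<bar>a * ?E\<bar> \<le> \<bar>?E\<bar>"
    using assms(1) by (simp add: abs_mult mult_left_le_one_le)
  moreover have "\<bar>b ^ (d - 1)\<bar> \<le> 1" using assms(2) by (simp add: power_abs power_le_one)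
  then have "real d * \<bar>b ^ (d - 1)\<bar> * (a - b)\<^sup>2 \<le> real d * 1 * (a - b)\<^sup>2"
    by (intro mult_right_mono mult_left_mono) auto
  then have "\<bar>real d * b ^ (d - 1) * (a - b)\<^sup>2\<bar> \<le> real d * (a - b)\<^sup>2"
    by (simp add: abs_mult)
  ultimately have "\<bar>a ^ Suc d - b ^ Suc d - real (Suc d) * b ^ (Suc d - 1) * (a - b)\<bar>
      \<le> (real d)\<^sup>2 * (a - b)\<^sup>2 + real d * (a - b)\<^sup>2"
    using Suc by linarith
  also have "\<dots> = ((real d)\<^sup>2 + real d) * (a - b)\<^sup>2" by (simp add: distrib_right)
  also have "\<dots> \<le> (real (Suc d))\<^sup>2 * (a - b)\<^sup>2"
  proof (rule mult_right_mono)
    have "(real (Suc d))\<^sup>2 = (real d)\<^sup>2 + real d + (real d + 1)" by (simp add: power2_eq_square algebra_simps)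
    then show "(real d)\<^sup>2 + real d \<le> (real (Suc d))\<^sup>2" by linarith
  qed simp
  finally show ?case .
qed simp

text \<open>Divided by \<open>s\<^sup>2\<close>, the second order remainders of \<open>(1 - s) ^ d\<close> at \<open>0\<close> and of its
  expansion around \<open>s\<close> are the following polynomials.\<close>

fun remainder_at_0 :: "nat \<Rightarrow> real \<Rightarrow> real" where
  "remainder_at_0 0 s = 0"
| "remainder_at_0 (Suc d) s = (1 - s) * remainder_at_0 d s + real d"

fun remainder_at_s :: "nat \<Rightarrow> real \<Rightarrow> real" where
  "remainder_at_s 0 s = 0"
| "remainder_at_s (Suc d) s = remainder_at_s d s + real d * (1 - s) ^ (d - 1)"

lemma remainder_at_0: "s\<^sup>2 * remainder_at_0 d s = (1 - s) ^ d - 1 + real d * s"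
proof (induction d)
  case (Suc d)
  have "s\<^sup>2 * remainder_at_0 (Suc d) s = (1 - s) * (s\<^sup>2 * remainder_at_0 d s) + real d * s\<^sup>2"
    by (simp add: algebra_simps)
  also have "\<dots> = (1 - s) ^ Suc d - 1 + real (Suc d) * s"
    unfolding Suc by (simp add: algebra_simps power2_eq_square)
  finally show ?case .
qed simp

lemma remainder_at_s: "s\<^sup>2 * remainder_at_s d s = 1 - (1 - s) ^ d - s * (real d * (1 - s) ^ (d - 1))"
proof (induction d)
  case (Suc d)
  have d: "real d * (1 - s) ^ d = real d * (1 - s) ^ (d - 1) * (1 - s)" by (cases d) auto
  have "s\<^sup>2 * remainder_at_s (Suc d) s
      = 1 - (1 - s) ^ d - s * (real d * (1 - s) ^ (d - 1)) + s\<^sup>2 * (real d * (1 - s) ^ (d - 1))"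
    using Suc by (simp add: algebra_simps)
  also have "\<dots> = 1 - (1 - s) ^ d - s * (real d * (1 - s) ^ (d - 1) * (1 - s))"
    by (simp add: algebra_simps power2_eq_square)
  also have "\<dots> = 1 - (1 - s) ^ Suc d - s * (real (Suc d) * (1 - s) ^ (Suc d - 1))"
    unfolding d[symmetric] by (simp add: algebra_simps)
  finally show ?case .
qed simp

text \<open>After taking expectations the bound 1 for \<open>d \<ge> 2\<close> becomes the constant
  \<open>p2\<close>, and the bound \<open>d\<^sup>2\<close> is the majorant for dominated
  convergence.\<close>

lemma remainder_at_0_bounds:
  assumes "0 \<le> s" "s \<le> 1"
  shows "0 \<le> remainder_at_0 d s" "remainder_at_0 d s \<le> (real d)\<^sup>2" "d \<ge> 2 \<Longrightarrow> remainder_at_0 d s \<ge> 1"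
proof -
  show nn: "0 \<le> remainder_at_0 d s" for d using assms by (induction d) auto
  show "remainder_at_0 d s \<le> (real d)\<^sup>2"
  proof (induction d)
    case (Suc d)
    have "(1 - s) * remainder_at_0 d s \<le> remainder_at_0 d s"
      using assms nn[of d] by (simp add: mult_left_le_one_le)
    then show ?case using Suc by (simp add: power2_eq_square algebra_simps)
  qed simp
  assume "d \<ge> 2"
  then obtain e where e: "d = Suc e" "e \<ge> 1" by (cases d) auto
  have "0 \<le> (1 - s) * remainder_at_0 e s" using assms nn[of e] by simp
  then show "remainder_at_0 d s \<ge> 1" using e by simp
qed

lemma remainder_at_s_bounds:
  assumes "0 \<le> s" "s \<le> 1"
  shows "0 \<le> remainder_at_s d s" "remainder_at_s d s \<le> (real d)\<^sup>2" "d \<ge> 2 \<Longrightarrow> remainder_at_s d s \<ge> 1"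
proof -
  show nn: "0 \<le> remainder_at_s d s" for d using assms by (induction d) auto
  show "remainder_at_s d s \<le> (real d)\<^sup>2"
  proof (induction d)
    case (Suc d)
    have "real d * (1 - s) ^ (d - 1) \<le> real d"
      using assms by (simp add: mult_left_le power_le_one)
    then show ?case using Suc by (simp add: power2_eq_square algebra_simps)
  qed simp
  assume "d \<ge> 2"
  then show "remainder_at_s d s \<ge> 1"
  proof (induction d rule: dec_induct)
    case (step d)
    then show ?case using assms by (simp add: add_increasing2)
  qed (simp add: numeral_2_eq_2)
qed

text \<open>Both remainders have the same limit \<open>d * (d - 1) / 2\<close>. This coincidence is
  the origin of the common rate of \<open>H\<close> and \<open>r\<close>.\<close>

lemma tendsto_remainder:
  "((\<lambda>s. remainder_at_0 d s) \<longlongrightarrow> (\<Sum>i<d. real i)) (at_right 0)"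
  "((\<lambda>s. remainder_at_s d s) \<longlongrightarrow> (\<Sum>i<d. real i)) (at_right 0)"
proof -
  show "((\<lambda>s. remainder_at_0 d s) \<longlongrightarrow> (\<Sum>i<d. real i)) (at_right 0)"
  proof (induction d)
    case (Suc d)
    have "((\<lambda>s. (1 - s) * remainder_at_0 d s + real d) \<longlongrightarrow> (1 - 0) * (\<Sum>i<d. real i) + real d) (at_right 0)"
      by (intro tendsto_intros Suc)
    then show ?case by simp
  qed simp
  show "((\<lambda>s. remainder_at_s d s) \<longlongrightarrow> (\<Sum>i<d. real i)) (at_right 0)"
  proof (induction d)
    case (Suc d)
    have "((\<lambda>s. remainder_at_s d s + real d * (1 - s) ^ (d - 1)) \<longlongrightarrow>
        (\<Sum>i<d. real i) + real d * (1 - 0) ^ (d - 1)) (at_right 0)"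
      by (intro tendsto_intros Suc)
    then show ?case by simp
  qed simp
qed

section \<open>Calculus of the offspring generating function\<close>

locale offspring_law =
  fixes Z :: "nat pmf"
  assumes zero_notin: "0 \<notin> set_pmf Z"
    and mean_gt_1: "measure_pmf.expectation Z real > 1"
    and square_integrable: "integrable (measure_pmf Z) (\<lambda>n. (real n)\<^sup>2)"
begin

abbreviation expect :: "(nat \<Rightarrow> real) \<Rightarrow> real" where
  "expect \<equiv> measure_pmf.expectation Z"

definition \<mu> :: real where "\<mu> = expect real"

text \<open>The probability that some child of a vertex succeeds when each child does so
  independently with probability \<open>s\<close>.\<close>

definition \<psi> :: "real \<Rightarrow> real" where
  "\<psi> s = expect (\<lambda>d. 1 - (1 - s) ^ d)"

definition \<psi>' :: "real \<Rightarrow> real" where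
  "\<psi>' s = expect (\<lambda>d. real d * (1 - s) ^ (d - 1))"

lemma \<mu>_gt_1: "\<mu> > 1" using mean_gt_1 by (simp add: \<mu>_def)

lemma AE_pos: "AE d in measure_pmf Z. d \<ge> 1"
  using zero_notin by (auto simp: AE_measure_pmf_iff Suc_le_eq intro: ccontr)

lemma integrable_square_bound:
  assumes "\<And>d. \<bar>f d\<bar> \<le> C * (real d)\<^sup>2 + D"
  shows "integrable (measure_pmf Z) f"
  by (rule Bochner_Integration.integrable_bound[of _ "\<lambda>d. C * (real d)\<^sup>2 + D"])
     (use assms square_integrable in \<open>auto intro!: AE_I2 order_trans[OF assms]\<close>)

lemma real_le_square: "real d \<le> (real d)\<^sup>2"
  by (cases d) (auto simp: power2_eq_square)

lemma integrable_real: "integrable (measure_pmf Z) real"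
  by (rule integrable_square_bound[of _ 1 0]) (use real_le_square in auto)

lemma abs_power_le_1: "\<bar>1 - s\<bar> ^ d \<le> 1" if "0 \<le> s" "s \<le> 2" for s :: real
  using that by (intro power_le_one) auto

lemma integrable_\<psi>: "0 \<le> (s::real) \<Longrightarrow> s \<le> 2 \<Longrightarrow> integrable (measure_pmf Z) (\<lambda>d. 1 - (1 - s) ^ d)"
  by (rule integrable_square_bound[of _ 0 2])
     (use abs_power_le_1[of s] in \<open>auto simp: power_abs intro!: order_trans[OF abs_triangle_ineq4]\<close>)

lemma integrable_\<psi>': "0 \<le> (s::real) \<Longrightarrow> s \<le> 2 \<Longrightarrow> integrable (measure_pmf Z) (\<lambda>d. real d * (1 - s) ^ (d - 1))"
proof (rule integrable_square_bound[of _ 1 0])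
  fix d assume "0 \<le> s" "s \<le> 2"
  then have "\<bar>real d * (1 - s) ^ (d - 1)\<bar> \<le> real d"
    using abs_power_le_1[of s "d - 1"] by (simp add: abs_mult power_abs mult_left_le)
  then show "\<bar>real d * (1 - s) ^ (d - 1)\<bar> \<le> 1 * (real d)\<^sup>2 + 0" using real_le_square[of d] by linarith
qed

lemma expect_abs_le:
  assumes "integrable (measure_pmf Z) f" "integrable (measure_pmf Z) g" "\<And>d. \<bar>f d\<bar> \<le> g d"
  shows "\<bar>expect f\<bar> \<le> expect g"
proof -
  have "\<bar>expect f\<bar> \<le> expect (\<lambda>d. \<bar>f d\<bar>)" using integral_norm_bound[of "measure_pmf Z" f] by simp
  also have "\<dots> \<le> expect g" using assms by (intro integral_mono) auto
  finally show ?thesis .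
qed

lemma \<psi>_0 [simp]: "\<psi> 0 = 0" by (simp add: \<psi>_def)

lemma \<psi>_1 [simp]: "\<psi> 1 = 1"
proof -
  have "\<psi> 1 = expect (\<lambda>d. 1)" unfolding \<psi>_def
    by (intro integral_cong_AE) (use AE_pos in \<open>auto elim!: eventually_mono\<close>)
  then show ?thesis by simp
qed

lemma \<psi>_taylor:
  assumes "0 \<le> s" "s \<le> 2" "0 \<le> t" "t \<le> 2"
  shows "\<bar>\<psi> t - \<psi> s - \<psi>' s * (t - s)\<bar> \<le> expect (\<lambda>d. (real d)\<^sup>2) * (t - s)\<^sup>2"
proof -
  note int = integrable_\<psi>[OF assms(1,2)] integrable_\<psi>[OF assms(3,4)] integrable_\<psi>'[OF assms(1,2)]
  have int': "integrable (measure_pmf Z) (\<lambda>d. real d * (1 - s) ^ (d - 1) * (t - s))"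
    using int(3) by simp
  note int'' = Bochner_Integration.integrable_diff[OF int(2,1)]
  have "\<psi> t - \<psi> s - \<psi>' s * (t - s)
      = expect (\<lambda>d. (1 - (1 - t) ^ d) - (1 - (1 - s) ^ d) - real d * (1 - s) ^ (d - 1) * (t - s))"
    unfolding \<psi>_def \<psi>'_def
    using Bochner_Integration.integral_diff[OF int'' int'] Bochner_Integration.integral_diff[OF int(2,1)] by simp
  also have "\<bar>\<dots>\<bar> \<le> expect (\<lambda>d. (real d)\<^sup>2 * (t - s)\<^sup>2)"
  proof (rule expect_abs_le)
    fix d
    have "\<bar>(1 - t) ^ d - (1 - s) ^ d - real d * (1 - s) ^ (d - 1) * ((1 - t) - (1 - s))\<bar>
        \<le> (real d)\<^sup>2 * ((1 - t) - (1 - s))\<^sup>2"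
      by (rule power_taylor2) (use assms in auto)
    then show "\<bar>(1 - (1 - t) ^ d) - (1 - (1 - s) ^ d) - real d * (1 - s) ^ (d - 1) * (t - s)\<bar>
        \<le> (real d)\<^sup>2 * (t - s)\<^sup>2"
      by (simp add: algebra_simps power2_eq_square abs_minus_commute)
  qed (use Bochner_Integration.integrable_diff[OF int'' int'] square_integrable in auto)
  finally show ?thesis by simp
qed

lemma \<psi>_deriv:
  assumes "0 < s" "s < 2"
  shows "(\<psi> has_real_derivative \<psi>' s) (at s)"
proof -
  define C where "C = expect (\<lambda>d. (real d)\<^sup>2)"
  have "((\<lambda>t. (\<psi> t - \<psi> s) / (t - s) - \<psi>' s) \<longlongrightarrow> 0) (at s)"
  proof (rule Lim_null_comparison)
    have "eventually (\<lambda>t. t \<in> {0<..<2} \<and> t \<noteq> s) (at s)"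
      using assms by (intro eventually_conj eventually_at_in_open' eventually_neq_at_within) auto
    then show "eventually (\<lambda>t. norm ((\<psi> t - \<psi> s) / (t - s) - \<psi>' s) \<le> C * \<bar>t - s\<bar>) (at s)"
    proof eventually_elim
      case (elim t)
      have "norm ((\<psi> t - \<psi> s) / (t - s) - \<psi>' s) = \<bar>\<psi> t - \<psi> s - \<psi>' s * (t - s)\<bar> / \<bar>t - s\<bar>"
        using elim by (simp add: divide_simps abs_divide flip: abs_divide)
      also have "\<dots> \<le> C * (t - s)\<^sup>2 / \<bar>t - s\<bar>"
        unfolding C_def using elim assms by (intro divide_right_mono \<psi>_taylor) auto
      also have "\<dots> = C * \<bar>t - s\<bar>" using elim
        by (simp add: power2_eq_square abs_if field_simps)
      finally show ?case .
    qed
    have "((\<lambda>t. C * \<bar>t - s\<bar>) \<longlongrightarrow> C * \<bar>s - s\<bar>) (at s)" by (intro tendsto_intros)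
    then show "((\<lambda>t. C * \<bar>t - s\<bar>) \<longlongrightarrow> 0) (at s)" by simp
  qed
  then show ?thesis
    unfolding has_field_derivative_iff by (simp add: LIM_zero_iff)
qed

lemma \<psi>'_lipschitz:
  assumes "0 \<le> s" "s \<le> 2" "0 \<le> t" "t \<le> 2"
  shows "\<bar>\<psi>' t - \<psi>' s\<bar> \<le> expect (\<lambda>d. (real d)\<^sup>2) * \<bar>t - s\<bar>"
proof -
  note int = integrable_\<psi>'[OF assms(1,2)] integrable_\<psi>'[OF assms(3,4)]
  have "\<psi>' t - \<psi>' s = expect (\<lambda>d. real d * (1 - t) ^ (d - 1) - real d * (1 - s) ^ (d - 1))"
    unfolding \<psi>'_def using int by simp
  also have "\<bar>\<dots>\<bar> \<le> expect (\<lambda>d. (real d)\<^sup>2 * \<bar>t - s\<bar>)"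
  proof (rule expect_abs_le)
    fix d
    have "norm ((1 - t) ^ (d - 1) - (1 - s) ^ (d - 1)) \<le> real (d - 1) * norm ((1 - t) - (1 - s))"
      by (rule norm_power_diff) (use assms in auto)
    also have "\<dots> \<le> real d * \<bar>t - s\<bar>" by (auto intro: mult_right_mono simp: abs_minus_commute)
    finally have "real d * \<bar>(1 - t) ^ (d - 1) - (1 - s) ^ (d - 1)\<bar> \<le> real d * (real d * \<bar>t - s\<bar>)"
      by (intro mult_left_mono) auto
    then show "\<bar>real d * (1 - t) ^ (d - 1) - real d * (1 - s) ^ (d - 1)\<bar> \<le> (real d)\<^sup>2 * \<bar>t - s\<bar>"
      by (simp add: power2_eq_square abs_mult mult.assoc flip: right_diff_distrib)
  qed (use Bochner_Integration.integrable_diff[OF int(2,1)] square_integrable in auto)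
  finally show ?thesis by simp
qed

lemma continuous_\<psi>': "continuous_on {0..2} \<psi>'"
proof (rule continuous_onI)
  define C where "C = expect (\<lambda>d. (real d)\<^sup>2)"
  have "C \<ge> 0" unfolding C_def by (intro integral_nonneg_AE) auto
  fix s e :: real assume s: "s \<in> {0..2}" and e: "e > 0"
  show "\<exists>d>0. \<forall>t\<in>{0..2}. dist t s < d \<longrightarrow> dist (\<psi>' t) (\<psi>' s) \<le> e"
  proof (intro exI conjI ballI impI)
    show "e / (C + 1) > 0" using e \<open>C \<ge> 0\<close> by simp
    fix t assume "t \<in> {0..2}" "dist t s < e / (C + 1)"
    then have "\<bar>\<psi>' t - \<psi>' s\<bar> \<le> C * \<bar>t - s\<bar>" "\<bar>t - s\<bar> * (C + 1) \<le> e"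
      using \<psi>'_lipschitz[of s t] s \<open>C \<ge> 0\<close> unfolding C_def[symmetric]
      by (auto simp: dist_real_def field_simps)
    then show "dist (\<psi>' t) (\<psi>' s) \<le> e" by (simp add: dist_real_def algebra_simps)
  qed
qed

lemma continuous_\<psi>: "continuous_on {0..1} \<psi>"
proof -
  \<comment> \<open>\<open>\<psi>_deriv\<close> excludes 0, where the Taylor bound takes its
    place.\<close>
  have "(\<psi> \<longlongrightarrow> \<psi> 0) (at 0 within {0..1})"
  proof (rule Lim_null_comparison[of "\<lambda>s. \<psi> s - \<psi> 0" "\<lambda>s. \<psi>' 0 * s + expect (\<lambda>d. (real d)\<^sup>2) * s\<^sup>2", THEN LIM_zero_cancel])
    have "\<psi>' 0 \<ge> 0" unfolding \<psi>'_def by (intro integral_nonneg_AE) auto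
    have "\<bar>\<psi> s\<bar> \<le> \<psi>' 0 * s + expect (\<lambda>d. (real d)\<^sup>2) * s\<^sup>2" if "s \<in> {0..1}" for s
    proof -
      have "\<bar>\<psi> s - \<psi>' 0 * s\<bar> \<le> expect (\<lambda>d. (real d)\<^sup>2) * s\<^sup>2" "0 \<le> \<psi>' 0 * s"
        using \<psi>_taylor[of 0 s] that \<open>\<psi>' 0 \<ge> 0\<close> by auto
      then show ?thesis by linarith
    qed
    then show "eventually (\<lambda>s. norm (\<psi> s - \<psi> 0) \<le> \<psi>' 0 * s + expect (\<lambda>d. (real d)\<^sup>2) * s\<^sup>2) (at 0 within {0..1})"
      by (auto simp: eventually_at_filter)
    have "((\<lambda>s. \<psi>' 0 * s + expect (\<lambda>d. (real d)\<^sup>2) * s\<^sup>2) \<longlongrightarrow> \<psi>' 0 * 0 + expect (\<lambda>d. (real d)\<^sup>2) * 0\<^sup>2) (at 0 within {0..1})"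
      by (intro tendsto_intros)
    then show "((\<lambda>s. \<psi>' 0 * s + expect (\<lambda>d. (real d)\<^sup>2) * s\<^sup>2) \<longlongrightarrow> 0) (at 0 within {0..1})" by simp
  qed
  moreover have "(\<psi> \<longlongrightarrow> \<psi> s) (at s within {0..1})" if "s \<in> {0<..1}" for s
    using DERIV_isCont[OF \<psi>_deriv[of s]] that
    by (auto simp: continuous_at intro: tendsto_within_subset[of _ _ s UNIV])
  ultimately have "(\<psi> \<longlongrightarrow> \<psi> s) (at s within {0..1})" if "s \<in> {0..1}" for s
    using that by (cases "s = 0") auto
  then show ?thesis unfolding continuous_on_def by blast
qed

lemma expect_strict_mono:
  assumes "integrable (measure_pmf Z) f" "integrable (measure_pmf Z) g" "\<And>d. d \<ge> 1 \<Longrightarrow> f d < g d"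
  shows "expect f < expect g"
proof (rule measure_pmf.integral_less_AE_space)
  show "AE d in measure_pmf Z. f d < g d" using AE_pos by eventually_elim (rule assms(3))
  show "emeasure (measure_pmf Z) (space (measure_pmf Z)) \<noteq> 0"
    by (simp add: measure_pmf.emeasure_space_1 del: space_measure_pmf)
qed fact+

lemma \<psi>_less: assumes "0 \<le> s" "s < t" "t \<le> 1" shows "\<psi> s < \<psi> t"
  unfolding \<psi>_def
proof (rule expect_strict_mono)
  fix d :: nat assume "d \<ge> 1"
  then have "(1 - t) ^ d < (1 - s) ^ d" using assms by (intro power_strict_mono) auto
  then show "1 - (1 - s) ^ d < 1 - (1 - t) ^ d" by simp
qed (rule integrable_\<psi>; use assms in simp)+

lemma strict_mono_\<psi>: "strict_mono_on {0..1} \<psi>"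
  by (intro strict_mono_onI \<psi>_less) auto

lemma \<psi>_le_iff: "s \<in> {0..1} \<Longrightarrow> t \<in> {0..1} \<Longrightarrow> \<psi> s \<le> \<psi> t \<longleftrightarrow> s \<le> t"
  using \<psi>_less[of s t] \<psi>_less[of t s] by (cases s t rule: linorder_cases) auto

lemma \<psi>_range: "s \<in> {0..1} \<Longrightarrow> \<psi> s \<in> {0..1}"
  using \<psi>_le_iff[of 0 s] \<psi>_le_iff[of s 1] by auto

lemma \<psi>_pos: "0 < s \<Longrightarrow> s \<le> 1 \<Longrightarrow> 0 < \<psi> s"
  using \<psi>_less[of 0 s] by simp

lemma \<psi>_image: "\<psi> ` {0..1} = {0..1}"
proof (intro equalityI subsetI)
  fix y :: real assume y: "y \<in> {0..1}"
  have "\<psi> 0 \<le> y" "y \<le> \<psi> 1" using y by simp_all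
  from IVT'[OF this zero_le_one continuous_\<psi>] show "y \<in> \<psi> ` {0..1}" by force
next
  fix y :: real assume "y \<in> \<psi> ` {0..1}"
  then obtain s where "y = \<psi> s" "s \<in> {0..1}" by blast
  then show "y \<in> {0..1}" using \<psi>_range[of s] by simp
qed

text \<open>Positive because the mean exceeds 1 while no vertex is childless. It bounds both
  second-order remainders from below and so enters every quantitative estimate for the
  chain.\<close>

definition p2 :: real where "p2 = measure_pmf.prob Z {d. d \<ge> 2}"

lemma p2_pos: "p2 > 0"
proof (rule ccontr)
  assume "\<not> p2 > 0"
  then have "p2 = 0" unfolding p2_def by (simp add: order_antisym not_less)
  then have "AE d in measure_pmf Z. \<not> d \<ge> 2"
    unfolding p2_def by (auto simp: measure_pmf.prob_eq_0)
  then have "AE d in measure_pmf Z. real d = 1"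
    using AE_pos by eventually_elim auto
  then have "expect real = expect (\<lambda>_. 1)" by (intro integral_cong_AE) auto
  then show False using mean_gt_1 by simp
qed

definition rem0 :: "real \<Rightarrow> real" where "rem0 s = expect (\<lambda>d. remainder_at_0 d s)"
definition rems :: "real \<Rightarrow> real" where "rems s = expect (\<lambda>d. remainder_at_s d s)"

lemma integrable_remainder:
  assumes "0 \<le> s" "s \<le> 1"
  shows "integrable (measure_pmf Z) (\<lambda>d. remainder_at_0 d s)"
    "integrable (measure_pmf Z) (\<lambda>d. remainder_at_s d s)"
proof -
  show "integrable (measure_pmf Z) (\<lambda>d. remainder_at_0 d s)"
  proof (rule integrable_square_bound[of _ 1 0])
    show "\<bar>remainder_at_0 d s\<bar> \<le> 1 * (real d)\<^sup>2 + 0" for d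
      using remainder_at_0_bounds(1,2)[OF assms, of d] by simp
  qed
  show "integrable (measure_pmf Z) (\<lambda>d. remainder_at_s d s)"
  proof (rule integrable_square_bound[of _ 1 0])
    show "\<bar>remainder_at_s d s\<bar> \<le> 1 * (real d)\<^sup>2 + 0" for d
      using remainder_at_s_bounds(1,2)[OF assms, of d] by simp
  qed
qed

lemma rem0: assumes "0 \<le> s" "s \<le> 1" shows "\<mu> * s - \<psi> s = s\<^sup>2 * rem0 s"
proof -
  have "s\<^sup>2 * rem0 s = expect (\<lambda>d. real d * s - (1 - (1 - s) ^ d))"
    unfolding rem0_def integral_mult_right_zero[symmetric]
    by (intro Bochner_Integration.integral_cong refl) (simp add: remainder_at_0)
  also have "\<dots> = \<mu> * s - \<psi> s"
    unfolding \<mu>_def \<psi>_def using assms integrable_real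
    by (subst Bochner_Integration.integral_diff[OF _ integrable_\<psi>]) auto
  finally show ?thesis by simp
qed

lemma rems: assumes "0 \<le> s" "s \<le> 1" shows "\<psi> s - s * \<psi>' s = s\<^sup>2 * rems s"
proof -
  have "s\<^sup>2 * rems s = expect (\<lambda>d. (1 - (1 - s) ^ d) - s * (real d * (1 - s) ^ (d - 1)))"
    unfolding rems_def integral_mult_right_zero[symmetric] by (simp add: remainder_at_s)
  also have "\<dots> = \<psi> s - s * \<psi>' s"
    unfolding \<psi>_def \<psi>'_def using assms
    by (subst Bochner_Integration.integral_diff[OF integrable_\<psi> integrable_mult_right[OF integrable_\<psi>']]) auto
  finally show ?thesis by simp
qed

lemma rem_ge_p2: assumes "0 \<le> s" "s \<le> 1" shows "rem0 s \<ge> p2" "rems s \<ge> p2"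
proof -
  have p: "p2 = expect (indicator {d. d \<ge> 2})" by (simp add: p2_def)
  have int: "integrable (measure_pmf Z) (indicator {d. d \<ge> 2} :: nat \<Rightarrow> real)"
    by (rule integrable_square_bound[of _ 0 1]) (auto simp: indicator_def)
  have ind: "indicator {d. d \<ge> 2} d \<le> f d" if "0 \<le> f d" "d \<ge> 2 \<Longrightarrow> f d \<ge> 1" for f :: "nat \<Rightarrow> real" and d
    using that by (auto simp: indicator_def)
  show "rem0 s \<ge> p2" unfolding p rem0_def
    by (intro integral_mono int integrable_remainder assms ind) (rule remainder_at_0_bounds[OF assms], assumption?)+
  show "rems s \<ge> p2" unfolding p rems_def
    by (intro integral_mono int integrable_remainder assms ind) (rule remainder_at_s_bounds[OF assms], assumption?)+
qed

text \<open>Dominated convergence along sequences, with \<open>d\<^sup>2\<close> as the integrable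
  majorant.\<close>

lemma tendsto_rem:
  "(rem0 \<longlongrightarrow> expect (\<lambda>d. \<Sum>i<d. real i)) (at_right 0)"
  "(rems \<longlongrightarrow> expect (\<lambda>d. \<Sum>i<d. real i)) (at_right 0)"
proof -
  have *: "((\<lambda>s. expect (\<lambda>d. f d s)) \<longlongrightarrow> expect (\<lambda>d. \<Sum>i<d. real i)) (at_right 0)"
    if lim: "\<And>d. (f d \<longlongrightarrow> (\<Sum>i<d. real i)) (at_right 0)"
      and bnd: "\<And>d s. 0 \<le> s \<Longrightarrow> s \<le> 1 \<Longrightarrow> \<bar>f d s\<bar> \<le> (real d)\<^sup>2" for f :: "nat \<Rightarrow> real \<Rightarrow> real"
  proof (rule tendsto_at_right_sequentially[of 0 1])
    fix S :: "nat \<Rightarrow> real" assume S: "\<And>n. 0 < S n" "\<And>n. S n < 1" "S \<longlonglongrightarrow> 0"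
    show "(\<lambda>n. expect (\<lambda>d. f d (S n))) \<longlonglongrightarrow> expect (\<lambda>d. \<Sum>i<d. real i)"
    proof (rule integral_dominated_convergence[where w = "\<lambda>d. (real d)\<^sup>2"])
      have "filterlim S (at_right 0) sequentially"
        using S by (auto simp: filterlim_at less_imp_neq[OF S(1), symmetric] intro: always_eventually)
      then show "AE d in measure_pmf Z. (\<lambda>n. f d (S n)) \<longlonglongrightarrow> (\<Sum>i<d. real i)"
        using filterlim_compose[OF lim] by (intro AE_I2) auto
    qed (use square_integrable bnd S in \<open>auto intro!: AE_I2 bnd intro: less_imp_le\<close>)
  qed simp
  show "(rem0 \<longlongrightarrow> expect (\<lambda>d. \<Sum>i<d. real i)) (at_right 0)"
    unfolding rem0_def using remainder_at_0_bounds by (intro * tendsto_remainder) auto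
  show "(rems \<longlongrightarrow> expect (\<lambda>d. \<Sum>i<d. real i)) (at_right 0)"
    unfolding rems_def using remainder_at_s_bounds by (intro * tendsto_remainder) auto
qed

lemma \<psi>_less_\<mu>: assumes "0 < s" "s \<le> 1" shows "\<psi> s < \<mu> * s"
proof -
  have "0 < s\<^sup>2 * rem0 s" using rem_ge_p2(1)[of s] p2_pos assms by (intro mult_pos_pos) auto
  then show ?thesis using rem0[of s] assms by linarith
qed

lemma \<psi>_le_\<mu>: "0 \<le> s \<Longrightarrow> s \<le> 1 \<Longrightarrow> \<psi> s \<le> \<mu> * s"
  using \<psi>_less_\<mu>[of s] by (cases "s = 0") auto

lemma \<psi>'_nonneg: "0 \<le> s \<Longrightarrow> s \<le> 1 \<Longrightarrow> \<psi>' s \<ge> 0"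
  unfolding \<psi>'_def by (intro integral_nonneg_AE AE_I2) auto

section \<open>The inverse of the generating function\<close>

text \<open>Clamping the argument to \<open>[0, 1]\<close> makes the inverse a continuous, hence
  measurable, function on the whole line.\<close>

definition \<theta> :: "real \<Rightarrow> real" where
  "\<theta> y = the_inv_into {0..1} \<psi> (max 0 (min 1 y))"

lemma inj_\<psi>: "inj_on \<psi> {0..1}"
  using strict_mono_\<psi> by (rule strict_mono_on_imp_inj_on)

lemma \<theta>_\<psi> [simp]: "s \<in> {0..1} \<Longrightarrow> \<theta> (\<psi> s) = s"
  using \<psi>_range[of s] the_inv_into_f_f[OF inj_\<psi>, of s] by (simp add: \<theta>_def)

lemma \<theta>_range: "\<theta> y \<in> {0..1}"
  unfolding \<theta>_def by (rule the_inv_into_into[OF inj_\<psi> _ order_refl]) (simp add: \<psi>_image)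

lemma \<psi>_\<theta> [simp]: "y \<in> {0..1} \<Longrightarrow> \<psi> (\<theta> y) = y"
  unfolding \<theta>_def using f_the_inv_into_f[OF inj_\<psi>, of y] by (simp add: \<psi>_image)

lemma \<theta>_pos: assumes "0 < y" "y \<le> 1" shows "0 < \<theta> y"
proof (rule ccontr)
  assume "\<not> 0 < \<theta> y"
  then have "\<theta> y = 0" using \<theta>_range[of y] by auto
  then have "\<psi> (\<theta> y) = 0" by simp
  then show False using assms by simp
qed

lemma \<theta>_le_iff: "y \<in> {0..1} \<Longrightarrow> z \<in> {0..1} \<Longrightarrow> \<theta> y \<le> \<theta> z \<longleftrightarrow> y \<le> z"
  using \<psi>_le_iff[OF \<theta>_range \<theta>_range, of y z] by simp

lemma continuous_\<theta>: "continuous_on UNIV \<theta>"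
proof -
  have "continuous_on {0..1} (the_inv_into {0..1} \<psi>)"
    using continuous_on_inv_into[OF continuous_\<psi> compact_Icc inj_\<psi>] by (simp add: \<psi>_image)
  then show ?thesis
    unfolding \<theta>_def by (rule continuous_on_compose2) (auto intro!: continuous_intros)
qed

lemma \<theta>_measurable [measurable]: "\<theta> \<in> borel_measurable borel"
  by (rule borel_measurable_continuous_onI[OF continuous_\<theta>])

lemma \<psi>'_\<theta>_measurable [measurable]: "(\<lambda>y. \<psi>' (\<theta> y)) \<in> borel_measurable borel"
proof (rule borel_measurable_continuous_onI)
  have "\<theta> y \<in> {0..2}" for y using \<theta>_range[of y] by simp
  then have "\<theta> ` UNIV \<subseteq> {0..2}" by blast
  then show "continuous_on UNIV (\<lambda>y. \<psi>' (\<theta> y))"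
    by (rule continuous_on_compose2[OF continuous_\<psi>' continuous_\<theta>])
qed

text \<open>The quantile function of the root pivot, see \<open>pivot_cdf_b\<close>: at
  \<open>x\<close> the distribution function of the pivot solves \<open>y = \<psi> (x * y)\<close>,
  which reads \<open>x = \<theta> y / y\<close>.\<close>

definition b :: "real \<Rightarrow> real" where "b y = \<theta> y / y"
definition r :: "real \<Rightarrow> real" where "r y = 1 - \<theta> y * \<psi>' (\<theta> y) / y"
definition H :: "real \<Rightarrow> real" where "H y = \<mu> * b y - 1"

lemma b_r_H_measurable [measurable]:
  "b \<in> borel_measurable borel" "r \<in> borel_measurable borel" "H \<in> borel_measurable borel"
proof -
  show [measurable]: "b \<in> borel_measurable borel" unfolding b_def[abs_def] by measurable
  show "r \<in> borel_measurable borel" unfolding r_def[abs_def] by measurable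
  show "H \<in> borel_measurable borel" unfolding H_def[abs_def] by measurable
qed

lemma r_eq: assumes "0 < y" "y \<le> 1" shows "r y = (\<theta> y)\<^sup>2 * rems (\<theta> y) / y"
proof -
  have "y - \<theta> y * \<psi>' (\<theta> y) = (\<theta> y)\<^sup>2 * rems (\<theta> y)"
    using rems[of "\<theta> y"] \<theta>_range[of y] assms by simp
  moreover have "r y = (y - \<theta> y * \<psi>' (\<theta> y)) / y" using assms by (simp add: r_def diff_divide_distrib)
  ultimately show ?thesis by simp
qed

lemma H_eq: assumes "0 < y" "y \<le> 1" shows "H y = (\<theta> y)\<^sup>2 * rem0 (\<theta> y) / y"
proof -
  have "\<mu> * \<theta> y - y = (\<theta> y)\<^sup>2 * rem0 (\<theta> y)"
    using rem0[of "\<theta> y"] \<theta>_range[of y] assms by simp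
  moreover have "H y = (\<mu> * \<theta> y - y) / y" using assms by (simp add: H_def b_def diff_divide_distrib)
  ultimately show ?thesis by simp
qed

lemma \<theta>_ge: assumes "0 \<le> y" "y \<le> 1" shows "\<theta> y \<ge> y / \<mu>"
proof -
  have "y \<le> \<mu> * \<theta> y" using \<psi>_le_\<mu>[of "\<theta> y"] \<theta>_range[of y] assms by simp
  then show ?thesis using \<mu>_gt_1 by (simp add: pos_divide_le_eq mult.commute)
qed

text \<open>Combines \<open>\<theta> y \<ge> y / \<mu>\<close> with the lower bound
  \<open>p2\<close> for the remainders; this is the source of the constant
  \<open>p2 / \<mu>\<^sup>2\<close> in the bounds for the chain.\<close>

lemma H_r_ge: assumes "0 < y" "y \<le> 1" shows "H y \<ge> p2 / \<mu>\<^sup>2 * y" "r y \<ge> p2 / \<mu>\<^sup>2 * y"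
proof -
  have sq: "(y / \<mu>)\<^sup>2 \<le> (\<theta> y)\<^sup>2"
    using \<theta>_ge[of y] assms \<mu>_gt_1 by (intro power_mono) auto
  have *: "p2 / \<mu>\<^sup>2 * y \<le> (\<theta> y)\<^sup>2 * x / y" if "x \<ge> p2" for x
  proof -
    have "(y / \<mu>)\<^sup>2 * p2 \<le> (\<theta> y)\<^sup>2 * x" using that p2_pos by (intro mult_mono sq) auto
    then have "(y / \<mu>)\<^sup>2 * p2 / y \<le> (\<theta> y)\<^sup>2 * x / y" using assms by (intro divide_right_mono) auto
    moreover have "(y / \<mu>)\<^sup>2 * p2 / y = p2 / \<mu>\<^sup>2 * y" using assms by (simp add: power2_eq_square field_simps)
    ultimately show ?thesis by simp
  qed
  show "H y \<ge> p2 / \<mu>\<^sup>2 * y" "r y \<ge> p2 / \<mu>\<^sup>2 * y"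
    unfolding H_eq[OF assms] r_eq[OF assms] using \<theta>_range[of y] by (auto intro!: *[simplified] rem_ge_p2)
qed

lemma r_bounds: assumes "0 < y" "y \<le> 1" shows "0 < r y" "r y \<le> 1"
proof -
  have "0 < p2 / \<mu>\<^sup>2 * y" using p2_pos assms \<mu>_gt_1 by simp
  then show "0 < r y" using H_r_ge(2)[OF assms] by simp
  show "r y \<le> 1" using \<psi>'_nonneg[of "\<theta> y"] \<theta>_range[of y] assms by (simp add: r_def)
qed

lemma Q_deriv:
  assumes "0 < s" "s \<le> 1"
  shows "((\<lambda>s. s / \<psi> s) has_real_derivative (\<psi> s - s * \<psi>' s) / (\<psi> s)\<^sup>2) (at s)"
  using \<psi>_pos[OF assms] assms
  by (auto intro!: derivative_eq_intros \<psi>_deriv simp: power2_eq_square algebra_simps)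

text \<open>The numerator of the derivative is the positive quantity
  \<open>s\<^sup>2 * rems s\<close>. Monotonicity of this quotient makes \<open>b\<close> strictly
  increasing, and it later singles out the right fixed point for the law of the pivot.\<close>

lemma Q_less: assumes "0 < s" "s < t" "t \<le> 1" shows "s / \<psi> s < t / \<psi> t"
proof (rule DERIV_pos_imp_increasing[OF assms(2)])
  fix x assume x: "s \<le> x" "x \<le> t"
  have "\<psi> x - x * \<psi>' x > 0"
    using rems[of x] rem_ge_p2(2)[of x] p2_pos x assms by simp
  then have "(\<psi> x - x * \<psi>' x) / (\<psi> x)\<^sup>2 > 0" using \<psi>_pos[of x] x assms by simp
  then show "\<exists>y. ((\<lambda>s. s / \<psi> s) has_real_derivative y) (at x) \<and> y > 0"
    using Q_deriv[of x] x assms by auto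
qed

lemma b_less: assumes "0 < y" "y < z" "z \<le> 1" shows "b y < b z"
proof -
  have "\<theta> y < \<theta> z" using \<theta>_le_iff[of z y] assms by auto
  from Q_less[OF \<theta>_pos this] show ?thesis
    using \<theta>_range[of z] assms by (simp add: b_def)
qed

lemma b_mono: assumes "0 < y" "y \<le> z" "z \<le> 1" shows "b y \<le> b z"
  using b_less[of y z] assms by (cases "y = z") auto

lemma H_mono: assumes "0 < y" "y \<le> z" "z \<le> 1" shows "H y \<le> H z"
  using b_mono[OF assms] \<mu>_gt_1 by (simp add: H_def)

lemma b_1 [simp]: "b 1 = 1"
  using \<theta>_\<psi>[of 1] by (simp add: b_def)

lemma b_gt: assumes "0 < y" "y \<le> 1" shows "b y > 1 / \<mu>"
  using \<psi>_less_\<mu>[of "\<theta> y"] \<theta>_pos[OF assms] \<theta>_range[of y] assms \<mu>_gt_1 by (simp add: b_def field_simps)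

lemma tendsto_\<theta>_0: "filterlim \<theta> (at_right 0) (at_right 0)"
proof -
  have "(\<theta> \<longlongrightarrow> \<theta> 0) (at_right 0)"
    using continuous_\<theta> by (auto simp: continuous_on_def intro: tendsto_within_subset)
  moreover have "\<theta> 0 = 0" using \<theta>_\<psi>[of 0] by simp
  moreover have "eventually (\<lambda>y. \<theta> y > 0) (at_right 0)"
    using \<theta>_pos unfolding eventually_at_right_field by (intro exI[of _ 1]) auto
  ultimately show ?thesis by (simp add: filterlim_at eventually_mono)
qed

text \<open>Near criticality the jump probability and the scaled excess height have the same linear
  rate; this is what makes the intensity of the limiting Poisson process equal to \<open>1\<close>.\<close>

lemma H_r_rate:
  obtains \<kappa> where "\<kappa> > 0" "((\<lambda>y. H y / y) \<longlongrightarrow> \<kappa>) (at_right 0)" "((\<lambda>y. r y / y) \<longlongrightarrow> \<kappa>) (at_right 0)"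
proof -
  define A where "A = expect (\<lambda>d. \<Sum>i<d. real i)"
  have ev: "eventually (\<lambda>y. y \<in> {0<..<1}) (at_right (0::real))"
    by (rule eventually_at_right_real) simp
  have lim0: "(rem0 \<longlongrightarrow> A) (at_right 0)" "(rems \<longlongrightarrow> A) (at_right 0)"
    unfolding A_def by (rule tendsto_rem)+
  have "eventually (\<lambda>y. rem0 y \<ge> p2) (at_right 0)"
    using ev by eventually_elim (use rem_ge_p2 in auto)
  then have "A \<ge> p2" using tendsto_lowerbound[OF lim0(1)] by simp
  then have A: "A > 0" using p2_pos by simp
  have "((\<lambda>s. \<mu> - s * rem0 s) \<longlongrightarrow> \<mu> - 0 * A) (at_right 0)"
    by (intro tendsto_intros lim0)
  moreover have "eventually (\<lambda>s. \<mu> - s * rem0 s = \<psi> s / s) (at_right 0)"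
    using ev
  proof eventually_elim
    case (elim s)
    have "\<mu> * s - s\<^sup>2 * rem0 s = \<psi> s" using rem0[of s] elim by simp
    then have "(\<mu> - s * rem0 s) * s = \<psi> s" by (simp add: power2_eq_square algebra_simps)
    then show ?case using elim by (simp add: eq_divide_eq)
  qed
  ultimately have "((\<lambda>s. \<psi> s / s) \<longlongrightarrow> \<mu>) (at_right 0)"
    by (auto intro: Lim_transform_eventually)
  then have "((\<lambda>y. \<psi> (\<theta> y) / \<theta> y) \<longlongrightarrow> \<mu>) (at_right 0)"
    by (rule filterlim_compose[OF _ tendsto_\<theta>_0])
  then have lim1: "((\<lambda>y. inverse (\<psi> (\<theta> y) / \<theta> y)) \<longlongrightarrow> inverse \<mu>) (at_right 0)"
    using \<mu>_gt_1 by (intro tendsto_inverse) auto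
  \<comment> \<open>Since \<open>\<theta> y / y\<close> tends to \<open>1 / \<mu>\<close>, both
    quotients tend to \<open>A / \<mu>\<^sup>2\<close>.\<close>
  have *: "((\<lambda>y. (\<theta> y)\<^sup>2 * f (\<theta> y) / y / y) \<longlongrightarrow> (inverse \<mu>)\<^sup>2 * A) (at_right 0)"
    if f: "(f \<longlongrightarrow> A) (at_right 0)" for f
  proof (rule Lim_transform_eventually)
    show "((\<lambda>y. (inverse (\<psi> (\<theta> y) / \<theta> y))\<^sup>2 * f (\<theta> y)) \<longlongrightarrow> (inverse \<mu>)\<^sup>2 * A) (at_right 0)"
      by (intro tendsto_intros lim1 filterlim_compose[OF f tendsto_\<theta>_0])
    show "eventually (\<lambda>y. (inverse (\<psi> (\<theta> y) / \<theta> y))\<^sup>2 * f (\<theta> y) = (\<theta> y)\<^sup>2 * f (\<theta> y) / y / y) (at_right 0)"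
      using ev by eventually_elim (simp add: power_divide power2_eq_square)
  qed
  show thesis
  proof (rule that)
    show "(inverse \<mu>)\<^sup>2 * A > 0" using A \<mu>_gt_1 by simp
    have "eventually (\<lambda>y. (\<theta> y)\<^sup>2 * rem0 (\<theta> y) / y / y = H y / y) (at_right 0)"
      "eventually (\<lambda>y. (\<theta> y)\<^sup>2 * rems (\<theta> y) / y / y = r y / y) (at_right 0)"
      using ev by (eventually_elim, simp add: H_eq r_eq)+
    then show "((\<lambda>y. H y / y) \<longlongrightarrow> (inverse \<mu>)\<^sup>2 * A) (at_right 0)"
      "((\<lambda>y. r y / y) \<longlongrightarrow> (inverse \<mu>)\<^sup>2 * A) (at_right 0)"
      using *[OF lim0(1)] *[OF lim0(2)] by (auto intro: Lim_transform_eventually)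
  qed
qed

text \<open>The rate \<open>\<kappa>\<close> cancels in the comparison. Two different points are
  allowed because the jump probability before a step is compared with the excess after it.\<close>

lemma H_r_ratio:
  assumes "q > 1"
  obtains y0 where "0 < y0" "y0 \<le> 1"
    "\<And>y z. 0 < y \<Longrightarrow> y \<le> y0 \<Longrightarrow> 0 < z \<Longrightarrow> z \<le> y0 \<Longrightarrow> H y / y \<le> q * (r z / z) \<and> r z / z \<le> q * (H y / y)"
proof -
  obtain \<kappa> where \<kappa>: "\<kappa> > 0" "((\<lambda>y. H y / y) \<longlongrightarrow> \<kappa>) (at_right 0)" "((\<lambda>y. r y / y) \<longlongrightarrow> \<kappa>) (at_right 0)"
    by (rule H_r_rate)
  \<comment> \<open>Each quotient lies within a factor \<open>p\<close> of \<open>\<kappa>\<close>;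
    two such factors make \<open>q\<close>.\<close>
  define p where "p = sqrt q"
  have p: "p > 1" "p * p = q" using assms by (auto simp: p_def real_sqrt_gt_1_iff)
  have lt: "\<kappa> / p < \<kappa>" "\<kappa> < p * \<kappa>" using p \<kappa>(1) by (auto simp: field_simps)
  have "eventually (\<lambda>y. H y / y > \<kappa> / p \<and> H y / y < p * \<kappa> \<and> r y / y > \<kappa> / p \<and> r y / y < p * \<kappa>) (at_right 0)"
    using lt \<kappa>(2,3) by (intro eventually_conj) (auto dest: order_tendstoD)
  then obtain y1 where y1: "y1 > 0" "\<And>y. 0 < y \<Longrightarrow> y < y1 \<Longrightarrow>
      H y / y > \<kappa> / p \<and> H y / y < p * \<kappa> \<and> r y / y > \<kappa> / p \<and> r y / y < p * \<kappa>"
    unfolding eventually_at_right_field by auto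
  have *: "x \<le> q * x'" if "x < p * \<kappa>" "x' > \<kappa> / p" for x x'
  proof -
    have "p * \<kappa> = q * (\<kappa> / p)" using p by (simp add: field_simps)
    also have "\<dots> \<le> q * x'" using that p assms by (intro mult_left_mono) auto
    finally show ?thesis using that by simp
  qed
  show thesis
  proof (rule that[of "min 1 (y1 / 2)"])
    fix y z assume "0 < y" "y \<le> min 1 (y1 / 2)" "0 < z" "z \<le> min 1 (y1 / 2)"
    then have "y < y1" "z < y1" by auto
    then show "H y / y \<le> q * (r z / z) \<and> r z / z \<le> q * (H y / y)"
      using y1(2)[of y] y1(2)[of z] \<open>0 < y\<close> \<open>0 < z\<close> by (intro conjI *) auto
  qed (use y1 in auto)
qed

section \<open>The Markov chain of pivots\<close>

text \<open>One uniform variable decides both whether the chain jumps and where: given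
  \<open>u < r y\<close>, the value \<open>y * u / r y\<close> is uniform on
  \<open>[0, y]\<close>.\<close>

definition kernel_map :: "real \<Rightarrow> real \<Rightarrow> real" where
  "kernel_map y u = (if u < r y then y * u / r y else y)"

lemma kernel_map_bounds:
  assumes "0 < y" "y \<le> 1" "0 < u"
  shows "0 < kernel_map y u" "kernel_map y u \<le> y"
proof -
  show "0 < kernel_map y u" using assms r_bounds[OF assms(1,2)] by (simp add: kernel_map_def)
  have "y * u / r y \<le> y" if "u < r y"
    using that assms r_bounds[OF assms(1,2)] by (simp add: field_simps)
  then show "kernel_map y u \<le> y" by (simp add: kernel_map_def)
qed

fun chain :: "real \<Rightarrow> (nat \<Rightarrow> real) \<Rightarrow> nat \<Rightarrow> real" where
  "chain y u 0 = y"
| "chain y u (Suc n) = chain (kernel_map y (u 0)) (\<lambda>i. u (Suc i)) n"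

lemma chain_Suc: "chain y u (Suc n) = kernel_map (chain y u n) (u n)"
proof (induction n arbitrary: y u)
  case (Suc n)
  have "chain y u (Suc (Suc n)) = chain (kernel_map y (u 0)) (\<lambda>i. u (Suc i)) (Suc n)" by simp
  also have "\<dots> = kernel_map (chain (kernel_map y (u 0)) (\<lambda>i. u (Suc i)) n) (u (Suc n))" by (rule Suc)
  finally show ?case by simp
qed simp

definition driven_chain :: "(nat \<Rightarrow> real) \<Rightarrow> nat \<Rightarrow> real" where
  "driven_chain u = chain (u 0) (\<lambda>i. u (Suc i))"

lemma driven_chain_simps:
  "driven_chain u 0 = u 0"
  "driven_chain u (Suc n) = kernel_map (driven_chain u n) (u (Suc n))"
  by (simp_all add: driven_chain_def chain_Suc del: chain.simps(2))

section \<open>Pathwise bounds for the chain in terms of its driving variables\<close>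

context
  fixes u :: "nat \<Rightarrow> real"
  assumes u: "\<And>n. 0 < u n" "\<And>n. u n < 1"
begin

lemma driven_chain_bounds: "0 < driven_chain u n \<and> driven_chain u n \<le> 1"
proof (induction n)
  case 0
  then show ?case using u[of 0] by (simp add: driven_chain_simps)
next
  case (Suc n)
  then show ?case
    using kernel_map_bounds[of "driven_chain u n" "u (Suc n)"] u[of "Suc n"] by (auto simp: driven_chain_simps)
qed

lemma driven_chain_antimono: "m \<le> n \<Longrightarrow> driven_chain u n \<le> driven_chain u m"
  by (rule lift_Suc_antimono_le[of "driven_chain u"])
     (use driven_chain_bounds u kernel_map_bounds in \<open>auto simp: driven_chain_simps\<close>)

lemma H_driven_chain_antimono: "m \<le> n \<Longrightarrow> H (driven_chain u n) \<le> H (driven_chain u m)"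
  using driven_chain_bounds driven_chain_antimono by (intro H_mono) auto

text \<open>One small driving variable suffices, wherever the chain is: at \<open>y > y0\<close> the
  jump probability exceeds \<open>p2 / \<mu>\<^sup>2 * y0\<close>, so the chain jumps, and it lands
  no higher than the driving variable divided by \<open>p2 / \<mu>\<^sup>2\<close>.\<close>

lemma driven_chain_enters:
  assumes "0 < y0" "u (Suc n) < p2 / \<mu>\<^sup>2 * y0"
  shows "driven_chain u (Suc n) \<le> y0"
proof (cases "driven_chain u n \<le> y0")
  case True
  then show ?thesis using driven_chain_antimono[of n "Suc n"] by simp
next
  case False
  define y where "y = driven_chain u n"
  have y: "0 < y" "y \<le> 1" "y > y0" using driven_chain_bounds[of n] False by (auto simp: y_def)
  define c where "c = p2 / \<mu>\<^sup>2"
  have c: "c > 0" using p2_pos \<mu>_gt_1 by (simp add: c_def)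
  have r: "r y \<ge> c * y" unfolding c_def by (rule H_r_ge[OF y(1,2)])
  have "c * y0 < c * y" using y c by (intro mult_strict_left_mono) auto
  then have "u (Suc n) < r y" using r assms unfolding c_def by linarith
  then have "driven_chain u (Suc n) = y * u (Suc n) / r y"
    by (simp add: driven_chain_simps kernel_map_def y_def)
  also have "\<dots> \<le> y * u (Suc n) / (c * y)"
    using r c y u[of "Suc n"] by (intro divide_left_mono mult_pos_pos) (auto simp: r_bounds)
  also have "\<dots> = u (Suc n) / c" using y by simp
  also have "\<dots> \<le> y0" using assms(2) c unfolding c_def[symmetric] by (simp add: pos_divide_le_eq mult.commute)
  finally show ?thesis .
qed

context
  fixes q y0 :: real
  assumes q: "q > 1" and y0: "0 < y0" "y0 \<le> 1"
    and ratio: "\<And>y z. 0 < y \<Longrightarrow> y \<le> y0 \<Longrightarrow> 0 < z \<Longrightarrow> z \<le> y0 \<Longrightarrow> H y / y \<le> q * (r z / z) \<and> r z / z \<le> q * (H y / y)"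
begin

text \<open>With \<open>y\<close> before and \<open>z\<close> after step \<open>Suc i\<close>, the
  product \<open>r y / y * z\<close> is at most the driving variable: after a jump they are equal,
  and without a jump the product is \<open>r y\<close>, which the driving variable did not fall
  below.\<close>

lemma H_driven_chain_le:
  assumes "driven_chain u i \<le> y0" "Suc i \<le> n"
  shows "H (driven_chain u n) \<le> q * u (Suc i)"
proof -
  define y where "y = driven_chain u i"
  have y: "0 < y" "y \<le> 1" "y \<le> y0" using driven_chain_bounds[of i] assms by (auto simp: y_def)
  define z where "z = driven_chain u (Suc i)"
  have z: "0 < z" "z \<le> y0" using driven_chain_bounds[of "Suc i"] driven_chain_antimono[of i "Suc i"] y
    by (auto simp: z_def y_def)
  have "H (driven_chain u n) \<le> H z" unfolding z_def by (rule H_driven_chain_antimono[OF assms(2)])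
  also have "H z \<le> q * (r y / y) * z"
    using ratio[of z y] y z by (simp add: pos_divide_le_eq)
  also have "\<dots> \<le> q * u (Suc i)"
  proof (cases "u (Suc i) < r y")
    case True
    then have "z = y * u (Suc i) / r y" by (simp add: z_def driven_chain_simps kernel_map_def y_def)
    then show ?thesis using y r_bounds[OF y(1,2)] by simp
  next
    case False
    then have "z = y" by (simp add: z_def driven_chain_simps kernel_map_def y_def)
    then show ?thesis using y False q by simp
  qed
  finally show ?thesis .
qed

text \<open>Here \<open>i\<close> is the time of the last jump, or 0 if there has been none. A jump
  from a level up to \<open>y0\<close> is controlled up to the factor \<open>q\<close>; for a jump
  from above \<open>y0\<close> only \<open>r y \<le> 1\<close> and the linear bound of
  \<open>H_r_ge\<close> are used, which costs a constant.\<close>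

lemma H_driven_chain_ge:
  "\<exists>i\<le>n. H (driven_chain u n) \<ge> p2 / \<mu>\<^sup>2 * y0 * u i \<and> (i = 0 \<or> driven_chain u (i - 1) > y0) \<or>
         H (driven_chain u n) \<ge> u i / q \<and> i \<ge> 1 \<and> driven_chain u (i - 1) \<le> y0"
proof (induction n)
  case 0
  have c: "p2 / \<mu>\<^sup>2 > 0" using p2_pos \<mu>_gt_1 by simp
  \<comment> \<open>At time 0 the factor \<open>y0\<close> is given away only to obtain the same
    form as for later jumps.\<close>
  have "y0 * u 0 \<le> u 0" using u[of 0] y0 by (simp add: mult_left_le_one_le)
  then have "p2 / \<mu>\<^sup>2 * (y0 * u 0) \<le> p2 / \<mu>\<^sup>2 * u 0" using c by (intro mult_left_mono) auto
  also have "\<dots> \<le> H (u 0)" using H_r_ge(1)[of "u 0"] u[of 0] by simp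
  finally show ?case by (simp add: driven_chain_simps mult.assoc)
next
  case (Suc n)
  define y where "y = driven_chain u n"
  define v where "v = u (Suc n)"
  have y: "0 < y" "y \<le> 1" using driven_chain_bounds[of n] by (auto simp: y_def)
  have v: "0 < v" using u by (simp add: v_def)
  show ?case
  proof (cases "v < r y")
    case False
    then have "driven_chain u (Suc n) = driven_chain u n"
      by (simp add: driven_chain_simps kernel_map_def y_def v_def)
    moreover obtain i where "i \<le> n" "H (driven_chain u n) \<ge> p2 / \<mu>\<^sup>2 * y0 * u i \<and> (i = 0 \<or> driven_chain u (i - 1) > y0) \<or>
         H (driven_chain u n) \<ge> u i / q \<and> i \<ge> 1 \<and> driven_chain u (i - 1) \<le> y0"
      using Suc by blast
    ultimately show ?thesis by (intro exI[of _ i]) simp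
  next
    case True
    define z where "z = driven_chain u (Suc n)"
    have z: "0 < z" "z \<le> y" "z \<le> 1" using driven_chain_bounds[of "Suc n"] driven_chain_antimono[of n "Suc n"]
      by (auto simp: z_def y_def)
    have z_eq: "z = y * v / r y"
      using True by (simp add: z_def driven_chain_simps kernel_map_def y_def v_def)
    show ?thesis
    proof (cases "y \<le> y0")
      case True
      have "r y / y \<le> q * (H z / z)" using ratio[of z y] True z y by auto
      then have "r y / y * z \<le> q * H z" using z by (simp add: pos_le_divide_eq)
      then have "v / q \<le> H z" using q y r_bounds[OF y] unfolding z_eq by (simp add: field_simps)
      then show ?thesis using True by (intro exI[of _ "Suc n"]) (auto simp: z_def y_def v_def)
    next
      case False
      have c: "p2 / \<mu>\<^sup>2 > 0" using p2_pos \<mu>_gt_1 by simp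
      have "y0 * v \<le> y * v" using False v by (intro mult_right_mono) auto
      also have "y * v \<le> z" using r_bounds[OF y] y v unfolding z_eq by (simp add: field_simps mult_left_le)
      finally have "p2 / \<mu>\<^sup>2 * (y0 * v) \<le> p2 / \<mu>\<^sup>2 * z" using c by (intro mult_left_mono) auto
      also have "\<dots> \<le> H z" by (rule H_r_ge(1)[OF z(1,3)])
      finally show ?thesis using False by (intro exI[of _ "Suc n"]) (auto simp: z_def y_def v_def mult.assoc)
    qed
  qed
qed

end

end

end

section \<open>The branching decomposition of the sample space\<close>

abbreviation unit_uniform :: "real measure" where
  "unit_uniform \<equiv> uniform_measure lborel {0..1}"

lemma prob_space_unit_uniform: "prob_space unit_uniform"
  by (rule prob_space_uniform_measure) auto

lemma nn_integral_unit_uniform: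
  assumes "f \<in> borel_measurable borel"
  shows "(\<integral>\<^sup>+u. f u \<partial>unit_uniform) = (\<integral>\<^sup>+u. f u * indicator {0..1} u \<partial>lborel)"
  using assms by (subst nn_integral_uniform_measure) (auto simp: divide_ennreal_def)

lemma AE_unit_uniform: "AE u in unit_uniform. 0 < u \<and> u < 1"
proof (rule AE_uniform_measureI)
  have "AE u in lborel. u \<noteq> (0::real) \<and> u \<noteq> 1"
    using AE_lborel_singleton[of "0::real"] AE_lborel_singleton[of "1::real"] by eventually_elim simp
  then show "AE u in lborel. u \<in> {0..1} \<longrightarrow> 0 < u \<and> u < (1::real)" by eventually_elim auto
qed simp

lemma measure_unit_uniform_atMost: "0 \<le> x \<Longrightarrow> x \<le> 1 \<Longrightarrow> measure unit_uniform {..x} = x"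
proof -
  assume x: "0 \<le> x" "x \<le> 1"
  then have "{0..1} \<inter> {..x} = {0..x}" by auto
  then show ?thesis using x by (simp add: measure_uniform_measure)
qed

definition node :: "nat \<Rightarrow> real \<Rightarrow> (nat \<Rightarrow> sample) \<Rightarrow> sample" where
  "node d u f = (\<lambda>v. case v of [] \<Rightarrow> (d, u) | i # w \<Rightarrow> f i w)"

lemma node_simps [simp]:
  "offspring (node d u f) [] = d" "weight (node d u f) [] = u" "child (node d u f) i = f i"
  by (auto simp: node_def offspring_def weight_def child_def)

lemma regular_node:
  assumes "1 \<le> d" "0 \<le> u" "u \<le> 1" "\<And>i. regular (f i)"
  shows "regular (node d u f)"
  unfolding regular_def
proof
  fix v
  show "1 \<le> offspring (node d u f) v \<and> 0 \<le> weight (node d u f) v \<and> weight (node d u f) v \<le> 1"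
  proof (cases v)
    case (Cons i w)
    have "regular (child (node d u f) i)" using assms(4) by simp
    then show ?thesis unfolding Cons regular_def by (simp del: node_simps)
  qed (use assms in simp)
qed

text \<open>A word is empty or consists of a letter and a word, so a product indexed by words is the
  product of one factor with countably many copies of itself. The equality is checked on
  cylinders.\<close>

lemma distr_list_node:
  assumes D: "prob_space D"
  defines "S \<equiv> PiM (UNIV :: nat list set) (\<lambda>_. D)"
  shows "distr (D \<Otimes>\<^sub>M PiM (UNIV :: nat set) (\<lambda>_. S)) S (\<lambda>(x, f) v. case v of [] \<Rightarrow> x | i # w \<Rightarrow> f i w) = S"
    and "(\<lambda>(x, f) v. case v of [] \<Rightarrow> x | i # w \<Rightarrow> f i w) \<in> measurable (D \<Otimes>\<^sub>M PiM (UNIV :: nat set) (\<lambda>_. S)) S"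
proof -
  let ?F = "PiM (UNIV :: nat set) (\<lambda>_. S)"
  let ?j = "\<lambda>(x, f) v. case v of [] \<Rightarrow> x | i # w \<Rightarrow> f i w"
  have S: "prob_space S" unfolding S_def by (intro prob_space_PiM D)
  have F: "prob_space ?F" by (intro prob_space_PiM S)
  interpret D: prob_space D by fact
  interpret S: prob_space S by fact
  interpret F: prob_space ?F by fact
  interpret DF: pair_prob_space D ?F ..
  have comp: "(\<lambda>g. g w) \<in> measurable S D" for w unfolding S_def by (rule measurable_component_singleton) simp
  have "?j \<in> measurable (D \<Otimes>\<^sub>M ?F) (PiM UNIV (\<lambda>_. D))"
  proof (rule measurable_PiM_single'[where f = "\<lambda>v z. ?j z v"])
    fix v :: "nat list" assume "v \<in> UNIV"
    show "(\<lambda>z. ?j z v) \<in> measurable (D \<Otimes>\<^sub>M ?F) D"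
    proof (cases v)
      case (Cons i w)
      have "(\<lambda>z. snd z i) \<in> measurable (D \<Otimes>\<^sub>M ?F) S"
        by (rule measurable_compose[OF measurable_snd measurable_component_singleton]) simp
      from measurable_compose[OF this comp[of w]] show ?thesis
        unfolding Cons by (simp add: case_prod_beta)
    qed (simp add: case_prod_beta)
  next
    show "?j \<in> space (D \<Otimes>\<^sub>M ?F) \<rightarrow> (\<Pi>\<^sub>E v\<in>UNIV. space D)"
      by (auto simp: space_pair_measure S_def space_PiM PiE_iff split: list.split)
  qed
  then show meas: "?j \<in> measurable (D \<Otimes>\<^sub>M ?F) S" by (simp only: S_def)
  show "distr (D \<Otimes>\<^sub>M ?F) S ?j = S"
    unfolding S_def
  proof (rule measure_eqI_PiM_infinite[symmetric, OF refl], unfold S_def[symmetric])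
    fix A and J :: "nat list set"
    assume J: "finite J" and A: "\<And>v. v \<in> J \<Longrightarrow> A v \<in> sets D"
    \<comment> \<open>The cylinder over \<open>J\<close> splits into a constraint on the root and,
      for the finitely many first letters in \<open>I0\<close>, a cylinder \<open>C i\<close> over
      the tails \<open>Jw i\<close>.\<close>
    define A0 where "A0 = (if [] \<in> J then A [] else space D)"
    define Jw where "Jw i = {w. i # w \<in> J}" for i
    define I0 where "I0 = {i. Jw i \<noteq> {}}"
    have Jw: "finite (Jw i)" for i
      unfolding Jw_def using finite_vimageI[OF J, of "Cons i"] by (simp add: vimage_def)
    have "I0 \<subseteq> hd ` J"
    proof
      fix i assume "i \<in> I0"
      then obtain w where "i # w \<in> J" by (auto simp: I0_def Jw_def)
      from imageI[OF this, of hd] show "i \<in> hd ` J" by simp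
    qed
    then have I0: "finite I0" using J by (rule finite_subset[OF _ finite_imageI])
    define C where "C i = prod_emb UNIV (\<lambda>_. D) (Jw i) (\<Pi>\<^sub>E w\<in>Jw i. A (i # w))" for i
    have C: "C i \<in> sets S" for i
      unfolding C_def S_def by (intro sets_PiM_I Jw) (auto simp: Jw_def intro: A)
    have A0: "A0 \<in> sets D" using A by (auto simp: A0_def)
    have X: "prod_emb UNIV (\<lambda>_. D) J (Pi\<^sub>E J A) \<in> sets S"
      unfolding S_def using A J by (intro sets_PiM_I) auto
    have eq: "?j -` prod_emb UNIV (\<lambda>_. D) J (Pi\<^sub>E J A) \<inter> space (D \<Otimes>\<^sub>M ?F)
        = A0 \<times> prod_emb UNIV (\<lambda>_. S) I0 (Pi\<^sub>E I0 C)" (is "?L = ?R")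
    proof (intro set_eqI iffI)
      fix z assume z: "z \<in> ?L"
      obtain x f where xf: "z = (x, f)" by (cases z)
      have x: "x \<in> space D" and f: "f \<in> space ?F" using z by (auto simp: xf space_pair_measure)
      have mem: "(case v of [] \<Rightarrow> x | i # w \<Rightarrow> f i w) \<in> A v" if "v \<in> J" for v
        using z that by (auto simp: xf prod_emb_iff PiE_iff)
      have "x \<in> A0" using mem[of "[]"] x by (auto simp: A0_def)
      moreover have "f i w \<in> A (i # w)" if "w \<in> Jw i" for i w
        using mem[of "i # w"] that by (simp add: Jw_def)
      then have "f i \<in> C i" for i
        using f by (simp add: C_def prod_emb_iff PiE_iff space_PiM S_def)
      ultimately show "z \<in> ?R"
        using f by (auto simp: xf prod_emb_iff space_PiM PiE_iff)
    next
      fix z assume z: "z \<in> ?R"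
      obtain x f where xf: "z = (x, f)" by (cases z)
      have x: "x \<in> A0" and f: "f \<in> space ?F" "\<And>i. i \<in> I0 \<Longrightarrow> f i \<in> C i"
        using z by (auto simp: xf prod_emb_iff space_PiM PiE_iff)
      have "x \<in> space D" using x A0 sets.sets_into_space by blast
      have "(case v of [] \<Rightarrow> x | i # w \<Rightarrow> f i w) \<in> A v" if v: "v \<in> J" for v
      proof (cases v)
        case Nil
        then show ?thesis using x v by (simp add: A0_def)
      next
        case (Cons i w)
        then have w: "w \<in> Jw i" "i \<in> I0" using v by (auto simp: Jw_def I0_def)
        from f(2)[OF w(2)] w(1) show ?thesis by (auto simp: Cons C_def prod_emb_iff PiE_iff)
      qed
      moreover have "?j z \<in> space S"
        using measurable_space[OF meas, of z] \<open>x \<in> space D\<close> f(1) by (simp add: xf space_pair_measure)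
      ultimately show "z \<in> ?L"
        using \<open>x \<in> space D\<close> f(1) by (auto simp: xf prod_emb_iff PiE_iff S_def space_PiM space_pair_measure)
    qed
    have "emeasure (distr (D \<Otimes>\<^sub>M ?F) S ?j) (prod_emb UNIV (\<lambda>_. D) J (Pi\<^sub>E J A))
        = emeasure (D \<Otimes>\<^sub>M ?F) (A0 \<times> prod_emb UNIV (\<lambda>_. S) I0 (Pi\<^sub>E I0 C))"
      by (subst emeasure_distr[OF meas X]) (simp only: eq)
    also have "\<dots> = emeasure D A0 * emeasure ?F (prod_emb UNIV (\<lambda>_. S) I0 (Pi\<^sub>E I0 C))"
      by (intro F.emeasure_pair_measure_Times A0 sets_PiM_I I0) (auto intro: C)
    also have "emeasure ?F (prod_emb UNIV (\<lambda>_. S) I0 (Pi\<^sub>E I0 C)) = (\<Prod>i\<in>I0. emeasure S (C i))"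
      by (intro emeasure_PiM_emb S I0 C) auto
    also have "\<dots> = (\<Prod>i\<in>I0. \<Prod>w\<in>Jw i. emeasure D (A (i # w)))"
      unfolding C_def S_def by (intro prod.cong refl emeasure_PiM_emb D Jw) (auto simp: Jw_def intro: A)
    also have "\<dots> = (\<Prod>(i, w)\<in>Sigma I0 Jw. emeasure D (A (i # w)))"
      by (intro prod.Sigma I0 ballI Jw)
    also have "\<dots> = (\<Prod>v\<in>J - {[]}. emeasure D (A v))"
    proof (rule prod.reindex_bij_witness[of _ "\<lambda>v. (hd v, tl v)" "\<lambda>(i, w). i # w"])
      fix v assume "v \<in> J - {[]}"
      then have "hd v # tl v \<in> J" by simp
      then show "(hd v, tl v) \<in> Sigma I0 Jw" by (auto simp: I0_def Jw_def simp del: list.collapse)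
    qed (auto simp: Jw_def)
    also have "emeasure D A0 * (\<Prod>v\<in>J - {[]}. emeasure D (A v)) = (\<Prod>v\<in>J. emeasure D (A v))"
      by (cases "[] \<in> J") (simp_all add: A0_def prod.remove[OF J, of "[]"] D.emeasure_space_1)
    also have "\<dots> = emeasure S (prod_emb UNIV (\<lambda>_. D) J (Pi\<^sub>E J A))"
      unfolding S_def by (intro emeasure_PiM_emb[symmetric] D J A) auto
    finally show "emeasure S (prod_emb UNIV (\<lambda>_. D) J (Pi\<^sub>E J A))
        = emeasure (distr (D \<Otimes>\<^sub>M ?F) S ?j) (prod_emb UNIV (\<lambda>_. D) J (Pi\<^sub>E J A))" ..
  qed (auto simp: S.finite_measure_axioms)
qed

context offspring_law
begin

abbreviation label :: "(nat \<times> real) measure" where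
  "label \<equiv> measure_pmf Z \<Otimes>\<^sub>M unit_uniform"

abbreviation GW :: "sample measure" where
  "GW \<equiv> GW_space Z"

abbreviation forest :: "(nat \<Rightarrow> sample) measure" where
  "forest \<equiv> PiM UNIV (\<lambda>_. GW)"

lemma prob_space_label: "prob_space label"
proof -
  interpret U: prob_space unit_uniform by (rule prob_space_unit_uniform)
  interpret pair_prob_space "measure_pmf Z" unit_uniform ..
  show ?thesis by unfold_locales
qed

sublocale GW: prob_space GW
  unfolding GW_space_def by (intro prob_space_PiM prob_space_label)

sublocale forest: prob_space forest
  by (intro prob_space_PiM GW.prob_space_axioms)

sublocale U: prob_space unit_uniform
  by (rule prob_space_unit_uniform)

lemma space_GW [simp]: "space GW = UNIV"
  by (simp add: GW_space_def space_PiM space_pair_measure)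

lemma space_forest [simp]: "space forest = UNIV"
  by (simp add: space_PiM)

lemma measurable_coordinate [measurable]: "(\<lambda>\<omega>. \<omega> v) \<in> measurable GW label"
  unfolding GW_space_def by (rule measurable_component_singleton) simp

lemma measurable_tree [measurable]: "(\<lambda>f. f i) \<in> measurable forest GW"
  by (rule measurable_component_singleton) simp

lemma measurable_weight [measurable]: "(\<lambda>\<omega>. weight \<omega> v) \<in> borel_measurable GW"
  unfolding weight_def
  by (rule measurable_compose[OF measurable_coordinate])
     (rule measurable_compose[OF measurable_snd], simp add: measurable_def)

lemma measurable_offspring [measurable]: "(\<lambda>\<omega>. offspring \<omega> v) \<in> measurable GW (count_space UNIV)"
  unfolding offspring_def
  by (rule measurable_compose[OF measurable_coordinate])
     (rule measurable_compose[OF measurable_fst], simp)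

text \<open>Prefixing with \<open>v\<close> is injective on words, so the subsample at every vertex
  of the full tree has the law of the whole.\<close>

lemma measurable_subsample [measurable]: "(\<lambda>\<omega>. subsample \<omega> v) \<in> measurable GW GW"
  and distr_subsample: "distr GW GW (\<lambda>\<omega>. subsample \<omega> v) = GW"
proof -
  have eq: "(\<lambda>\<omega>. subsample \<omega> v) = (\<lambda>\<omega>. \<lambda>w\<in>UNIV. \<omega> (v @ w))" by (simp add: subsample_def restrict_def)
  show "(\<lambda>\<omega>. subsample \<omega> v) \<in> measurable GW GW"
    unfolding eq by (subst (2) GW_space_def) (intro measurable_restrict measurable_coordinate)
  show "distr GW GW (\<lambda>\<omega>. subsample \<omega> v) = GW"
    unfolding eq GW_space_def
    using distr_PiM_reindex[of UNIV "\<lambda>_. label" "\<lambda>w. v @ w" UNIV] prob_space_label by (simp add: inj_def)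
qed

lemma measurable_child [measurable]: "(\<lambda>\<omega>. child \<omega> i) \<in> measurable GW GW"
  unfolding child_eq_subsample by measurable

lemma measurable_node:
  "(\<lambda>((d, u), f). node d u f) \<in> measurable (label \<Otimes>\<^sub>M forest) GW"
  and distr_node: "distr (label \<Otimes>\<^sub>M forest) GW (\<lambda>((d, u), f). node d u f) = GW"
proof -
  have eq: "(\<lambda>((d, u), f). node d u f) = (\<lambda>(x, f) v. case v of [] \<Rightarrow> x | i # w \<Rightarrow> f i w)"
    by (auto simp: node_def fun_eq_iff)
  show "(\<lambda>((d, u), f). node d u f) \<in> measurable (label \<Otimes>\<^sub>M forest) GW"
    unfolding eq using distr_list_node(2)[OF prob_space_label] by (simp add: GW_space_def)
  show "distr (label \<Otimes>\<^sub>M forest) GW (\<lambda>((d, u), f). node d u f) = GW"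
    unfolding eq using distr_list_node(1)[OF prob_space_label] by (simp add: GW_space_def)
qed

lemma measurable_node' [measurable]: "(\<lambda>(u, f). node d u f) \<in> measurable (borel \<Otimes>\<^sub>M forest) GW"
proof -
  have "(\<lambda>(u, f). ((d, u), f)) \<in> measurable (borel \<Otimes>\<^sub>M forest) (label \<Otimes>\<^sub>M forest)"
    by measurable
  from measurable_compose[OF this measurable_node] show ?thesis by (simp add: case_prod_beta)
qed

lemma nn_integral_GW:
  assumes [measurable]: "\<Phi> \<in> borel_measurable GW"
  shows "(\<integral>\<^sup>+\<omega>. \<Phi> \<omega> \<partial>GW) = (\<integral>\<^sup>+d. \<integral>\<^sup>+u. \<integral>\<^sup>+f. \<Phi> (node d u f) \<partial>forest \<partial>unit_uniform \<partial>measure_pmf Z)"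
proof -
  have m: "(\<lambda>z. \<Phi> ((\<lambda>((d, u), f). node d u f) z)) \<in> borel_measurable (label \<Otimes>\<^sub>M forest)"
    by (rule measurable_compose[OF measurable_node assms])
  have "(\<integral>\<^sup>+\<omega>. \<Phi> \<omega> \<partial>GW) = (\<integral>\<^sup>+z. \<Phi> ((\<lambda>((d, u), f). node d u f) z) \<partial>(label \<Otimes>\<^sub>M forest))"
    by (subst distr_node[symmetric]) (rule nn_integral_distr[OF measurable_node], simp)
  also have "\<dots> = (\<integral>\<^sup>+x. \<integral>\<^sup>+f. \<Phi> (case_prod node x f) \<partial>forest \<partial>label)"
    by (subst forest.nn_integral_fst[symmetric, OF m]) simp
  also have "\<dots> = (\<integral>\<^sup>+d. \<integral>\<^sup>+u. \<integral>\<^sup>+f. \<Phi> (node d u f) \<partial>forest \<partial>unit_uniform \<partial>measure_pmf Z)"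
    using forest.borel_measurable_nn_integral_fst[OF m]
    by (subst U.nn_integral_fst[symmetric]) simp_all
  finally show ?thesis .
qed

lemma measurable_pivot_upto [measurable]: "pivot_upto n \<in> borel_measurable GW"
proof (induction n)
  case (Suc n)
  note [measurable] = Suc
  have "(\<lambda>\<omega>. Min ((\<lambda>i. max (weight (child \<omega> i) []) (pivot_upto n (child \<omega> i))) ` {..<d})) \<in> borel_measurable GW" for d
    by (intro borel_measurable_Min) auto
  from measurable_compose_countable[OF this measurable_offspring] show ?case by simp
qed simp

lemma measurable_root_pivot [measurable]: "root_pivot \<in> borel_measurable GW"
  unfolding root_pivot_def[abs_def] by measurable

lemma measurable_entry [measurable]: "entry \<in> borel_measurable GW"
  unfolding entry_def[abs_def] by measurable

lemma measurable_best [measurable]: "best \<in> measurable GW (count_space UNIV)"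
proof -
  have 1: "Measurable.pred GW (\<lambda>\<omega>. i < offspring \<omega> [])" for i
    by (rule measurable_compose[OF measurable_offspring]) simp
  have 2: "Measurable.pred GW (\<lambda>\<omega>. entry (child \<omega> i) = root_pivot \<omega>)" for i
    unfolding pred_def by (rule borel_measurable_eq) measurable
  show ?thesis unfolding best_def[abs_def] using 1 2 by (intro measurable_Least pred_intros_logic)
qed

lemma measurable_advance [measurable]: "advance \<in> measurable GW GW"
  unfolding advance_def[abs_def] by (rule measurable_compose_countable) measurable

lemma measurable_advance_pow [measurable]: "(\<lambda>\<omega>. (advance ^^ n) \<omega>) \<in> measurable GW GW"
  by (induction n) (auto intro: measurable_compose[OF _ measurable_advance])

lemma AE_regular: "AE \<omega> in GW. regular \<omega>"
proof -
  interpret pair_prob_space "measure_pmf Z" unit_uniform ..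
  interpret L: product_prob_space "\<lambda>_::vertex. label" UNIV
    by unfold_locales (rule prob_space.emeasure_space_1[OF prob_space_label])
  have label: "AE x in label. 1 \<le> fst x \<and> 0 \<le> snd x \<and> snd x \<le> 1"
  proof (rule AE_pair_measure)
    have *: "AE u in unit_uniform. 1 \<le> fst (d, u) \<and> 0 \<le> snd (d, u) \<and> snd (d, u) \<le> 1" if "1 \<le> d" for d :: nat
      using AE_unit_uniform that by (auto elim: eventually_mono)
    show "AE d in measure_pmf Z. AE u in unit_uniform. 1 \<le> fst (d, u) \<and> 0 \<le> snd (d, u) \<and> snd (d, u) \<le> 1"
      by (rule eventually_mono[OF AE_pos]) (rule *)
  qed measurable
  have "AE \<omega> in GW. 1 \<le> fst (\<omega> v) \<and> 0 \<le> snd (\<omega> v) \<and> snd (\<omega> v) \<le> 1" for v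
    unfolding GW_space_def by (intro L.AE_component UNIV_I label)
  then show ?thesis
    unfolding regular_def offspring_def weight_def by (subst AE_all_countable) simp
qed

lemma AE_forest_regular: "AE f in forest. \<forall>i. regular (f i)"
proof -
  interpret L: product_prob_space "\<lambda>_::nat. GW" UNIV ..
  show ?thesis unfolding AE_all_countable using AE_regular by (intro allI L.AE_component) auto
qed

text \<open>No functional of the subtrees of the children sees the weight of the root, so it is
  independent of that weight.\<close>

lemma nn_integral_root_weight:
  assumes [measurable]: "(\<lambda>(u, \<omega>). \<Phi> u \<omega>) \<in> borel_measurable (borel \<Otimes>\<^sub>M GW)"
    and inv: "\<And>u d u1 u2 f. \<Phi> u (node d u1 f) = \<Phi> u (node d u2 f)"
  shows "(\<integral>\<^sup>+\<omega>. \<Phi> (weight \<omega> []) \<omega> \<partial>GW) = (\<integral>\<^sup>+\<omega>. \<integral>\<^sup>+u. \<Phi> u \<omega> \<partial>unit_uniform \<partial>GW)"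
proof -
  interpret UF: pair_sigma_finite unit_uniform forest ..
  have 1: "(\<integral>\<^sup>+\<omega>. \<Phi> (weight \<omega> []) \<omega> \<partial>GW)
      = (\<integral>\<^sup>+d. \<integral>\<^sup>+u. \<integral>\<^sup>+f. \<Phi> u (node d u f) \<partial>forest \<partial>unit_uniform \<partial>measure_pmf Z)"
    by (subst nn_integral_GW) auto
  have [measurable]: "(\<lambda>(u, f). \<Phi> u (node d 0 f)) \<in> borel_measurable (unit_uniform \<Otimes>\<^sub>M forest)" for d
  proof -
    have "(\<lambda>(u, f). \<Phi> u (node d 0 f)) \<in> borel_measurable (borel \<Otimes>\<^sub>M forest)" by measurable
    then show ?thesis by (simp cong: measurable_cong_sets sets_pair_measure_cong)
  qed
  have m: "(\<lambda>\<omega>. \<integral>\<^sup>+u. \<Phi> u \<omega> \<partial>unit_uniform) \<in> borel_measurable GW"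
  proof -
    have "(\<lambda>(\<omega>, u). \<Phi> u \<omega>) \<in> borel_measurable (GW \<Otimes>\<^sub>M borel)" by measurable
    then have "(\<lambda>(\<omega>, u). \<Phi> u \<omega>) \<in> borel_measurable (GW \<Otimes>\<^sub>M unit_uniform)"
      by (simp cong: measurable_cong_sets sets_pair_measure_cong)
    from U.borel_measurable_nn_integral_fst[OF this] show ?thesis by simp
  qed
  \<comment> \<open>By \<open>inv\<close> the root weight can be frozen at 0, after which the
    integral over that weight has total mass 1.\<close>
  have "(\<integral>\<^sup>+\<omega>. \<integral>\<^sup>+u. \<Phi> u \<omega> \<partial>unit_uniform \<partial>GW)
      = (\<integral>\<^sup>+d. \<integral>\<^sup>+u'. \<integral>\<^sup>+f. \<integral>\<^sup>+u. \<Phi> u (node d 0 f) \<partial>unit_uniform \<partial>forest \<partial>unit_uniform \<partial>measure_pmf Z)"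
    by (subst nn_integral_GW[OF m]) (intro nn_integral_cong inv)
  also have "\<dots> = (\<integral>\<^sup>+d. \<integral>\<^sup>+f. \<integral>\<^sup>+u. \<Phi> u (node d 0 f) \<partial>unit_uniform \<partial>forest \<partial>measure_pmf Z)"
    by (simp add: U.emeasure_space_1)
  also have "\<dots> = (\<integral>\<^sup>+d. \<integral>\<^sup>+u. \<integral>\<^sup>+f. \<Phi> u (node d 0 f) \<partial>forest \<partial>unit_uniform \<partial>measure_pmf Z)"
    by (intro nn_integral_cong UF.Fubini') measurable
  also have "\<dots> = (\<integral>\<^sup>+\<omega>. \<Phi> (weight \<omega> []) \<omega> \<partial>GW)"
    unfolding 1 by (intro nn_integral_cong inv)
  finally show ?thesis ..
qed

section \<open>The law of the pivot at the root\<close>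

lemma sets_Collect_GW: "Measurable.pred GW Q \<Longrightarrow> {\<omega>. Q \<omega>} \<in> sets GW"
  by (simp add: pred_def)

lemma prob_forest_all:
  assumes "J \<subseteq> K" "finite J" "\<And>j. j \<in> J \<Longrightarrow> {\<omega>. Q j \<omega>} \<in> sets GW"
  shows "emeasure (PiM K (\<lambda>_. GW)) {X \<in> space (PiM K (\<lambda>_. GW)). \<forall>j\<in>J. Q j (X j)} = (\<Prod>j\<in>J. emeasure GW {\<omega>. Q j \<omega>})"
proof -
  have "{X \<in> space (PiM K (\<lambda>_. GW)). \<forall>j\<in>J. Q j (X j)} = prod_emb K (\<lambda>_. GW) J (\<Pi>\<^sub>E j\<in>J. {\<omega>. Q j \<omega>})"
    using assms(1) by (auto simp: prod_emb_iff space_PiM PiE_iff)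
  then show ?thesis
    using emeasure_PiM_emb[of K "\<lambda>_. GW" J "\<lambda>j. {\<omega>. Q j \<omega>}"] assms GW.prob_space_axioms by simp
qed

lemma nn_integral_expect:
  assumes "\<And>d. 0 \<le> f d" "integrable (measure_pmf Z) f"
  shows "(\<integral>\<^sup>+d. ennreal (f d) \<partial>measure_pmf Z) = ennreal (expect f)"
  using assms by (intro nn_integral_eq_integral) auto

lemma pivot_upto_node: "pivot_upto n (node d u1 f) = pivot_upto n (node d u2 f)"
  by (cases n) auto

lemma root_pivot_node: "root_pivot (node d u1 f) = root_pivot (node d u2 f)"
  unfolding root_pivot_def by (subst pivot_upto_node[of _ d u1 f u2]) (rule refl)

lemma prob_max_weight:
  assumes [measurable]: "A \<in> borel_measurable GW"
    and A: "\<And>d u1 u2 f. A (node d u1 f) = A (node d u2 f)" and x: "0 \<le> x" "x \<le> 1"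
  shows "GW.prob {\<omega>. max (weight \<omega> []) (A \<omega>) \<le> x} = x * GW.prob {\<omega>. A \<omega> \<le> x}"
proof -
  have [measurable]: "{\<omega>. A \<omega> \<le> x} \<in> sets GW" by (rule sets_Collect_GW) measurable
  have [measurable]: "{\<omega>. max (weight \<omega> []) (A \<omega>) \<le> x} \<in> sets GW" by (rule sets_Collect_GW) measurable
  have u: "(\<integral>\<^sup>+u. indicator {..x} u \<partial>unit_uniform) = ennreal x"
    using measure_unit_uniform_atMost[OF x] by (simp add: U.emeasure_eq_measure)
  have "emeasure GW {\<omega>. max (weight \<omega> []) (A \<omega>) \<le> x}
      = (\<integral>\<^sup>+\<omega>. indicator {..x} (weight \<omega> []) * indicator {..x} (A \<omega>) \<partial>GW)"
  proof -
    have "emeasure GW {\<omega>. max (weight \<omega> []) (A \<omega>) \<le> x}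
        = (\<integral>\<^sup>+\<omega>. indicator {\<omega>. max (weight \<omega> []) (A \<omega>) \<le> x} \<omega> \<partial>GW)"
      by (rule nn_integral_indicator[symmetric]) measurable
    also have "\<dots> = (\<integral>\<^sup>+\<omega>. indicator {..x} (weight \<omega> []) * indicator {..x} (A \<omega>) \<partial>GW)"
      by (intro nn_integral_cong) (simp add: indicator_def)
    finally show ?thesis .
  qed
  also have "\<dots> = (\<integral>\<^sup>+\<omega>. \<integral>\<^sup>+u. indicator {..x} u * indicator {..x} (A \<omega>) \<partial>unit_uniform \<partial>GW)"
  proof (rule nn_integral_root_weight[of "\<lambda>u \<omega>. indicator {..x} u * indicator {..x} (A \<omega>)"])
    show "(\<lambda>(u, \<omega>). indicator {..x} u * indicator {..x} (A \<omega>) :: ennreal) \<in> borel_measurable (borel \<Otimes>\<^sub>M GW)"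
      by measurable
    show "indicator {..x} u * indicator {..x} (A (node d u1 f))
        = (indicator {..x} u * indicator {..x} (A (node d u2 f)) :: ennreal)" for u d u1 u2 f
      by (simp only: A[of d u1 f u2])
  qed
  also have "\<dots> = (\<integral>\<^sup>+\<omega>. ennreal x * indicator {\<omega>. A \<omega> \<le> x} \<omega> \<partial>GW)"
    by (intro nn_integral_cong) (subst nn_integral_multc, auto simp: u indicator_def)
  also have "\<dots> = ennreal x * emeasure GW {\<omega>. A \<omega> \<le> x}"
    by (subst nn_integral_cmult) auto
  finally show ?thesis
    using x by (simp add: GW.emeasure_eq_measure flip: ennreal_mult)
qed

text \<open>The minimum exceeds \<open>x\<close> exactly when all children do, which has probability
  \<open>(1 - p) ^ d\<close> given \<open>d\<close>; averaging gives
  \<open>1 - \<psi> p\<close>.\<close>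

lemma prob_Min_children:
  fixes A B :: "sample \<Rightarrow> real"
  assumes [measurable]: "A \<in> borel_measurable GW" "B \<in> borel_measurable GW"
    and B: "\<And>d u f. d \<ge> 1 \<Longrightarrow> B (node d u f) = Min ((\<lambda>i. A (f i)) ` {..<d})"
  shows "GW.prob {\<omega>. B \<omega> \<le> x} = \<psi> (GW.prob {\<omega>. A \<omega> \<le> x})"
proof -
  define p where "p = GW.prob {\<omega>. A \<omega> \<le> x}"
  have p: "0 \<le> p" "p \<le> 1" by (auto simp: p_def)
  have le: "{\<omega>. A \<omega> \<le> x} \<in> sets GW" "{\<omega>. B \<omega> \<le> x} \<in> sets GW"
    by (rule sets_Collect_GW, measurable)+
  have gt: "{\<omega>. A \<omega> > x} \<in> sets GW" "{\<omega>. B \<omega> > x} \<in> sets GW"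
    by (rule sets_Collect_GW, measurable)+
  have c: "GW.prob {\<omega>. C \<omega> > x} = 1 - GW.prob {\<omega>. C \<omega> \<le> x}" if "{\<omega>. C \<omega> \<le> x} \<in> sets GW" for C
  proof -
    have "space GW - {\<omega>. C \<omega> \<le> x} = {\<omega>. C \<omega> > x}" by auto
    then show ?thesis using GW.prob_compl[OF that] by simp
  qed
  have "emeasure GW {\<omega>. B \<omega> > x} = (\<integral>\<^sup>+\<omega>. indicator {\<omega>. B \<omega> > x} \<omega> \<partial>GW)"
    using gt by simp
  also have "\<dots> = (\<integral>\<^sup>+d. \<integral>\<^sup>+u. \<integral>\<^sup>+f. indicator {\<omega>. B \<omega> > x} (node d u f) \<partial>forest \<partial>unit_uniform \<partial>measure_pmf Z)"
    using gt by (intro nn_integral_GW) simp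
  also have "\<dots> = (\<integral>\<^sup>+d. ennreal ((1 - p) ^ d) \<partial>measure_pmf Z)"
  proof (rule nn_integral_cong_AE, rule eventually_mono[OF AE_pos])
    fix d :: nat assume d: "1 \<le> d"
    have "indicator {\<omega>. B \<omega> > x} (node d u f) = (indicator {f. \<forall>i\<in>{..<d}. A (f i) > x} f :: ennreal)" for u f
    proof -
      have "0 \<in> {..<d}" using d by simp
      then have "{..<d} \<noteq> {}" by blast
      then show ?thesis unfolding indicator_def by (simp add: B[OF d] Min_gr_iff)
    qed
    moreover have "emeasure forest {f. \<forall>i\<in>{..<d}. A (f i) > x} = ennreal ((1 - p) ^ d)"
      using prob_forest_all[of "{..<d}" UNIV "\<lambda>_ \<omega>. A \<omega> > x"] gt c[OF le(1)] p
      by (simp add: GW.emeasure_eq_measure ennreal_power p_def)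
    moreover have "{f. \<forall>i\<in>{..<d}. A (f i) > x} \<in> sets forest"
    proof -
      have "{f \<in> space forest. \<forall>i\<in>{..<d}. A (f i) > x} \<in> sets forest" by measurable
      then show ?thesis by simp
    qed
    ultimately show "(\<integral>\<^sup>+u. \<integral>\<^sup>+f. indicator {\<omega>. B \<omega> > x} (node d u f) \<partial>forest \<partial>unit_uniform) = ennreal ((1 - p) ^ d)"
      by (simp add: U.emeasure_space_1)
  qed
  also have "\<dots> = ennreal (expect (\<lambda>d. (1 - p) ^ d))"
    using p by (intro nn_integral_expect integrable_square_bound[of _ 0 1]) (auto simp: power_le_one)
  finally have "GW.prob {\<omega>. B \<omega> > x} = expect (\<lambda>d. (1 - p) ^ d)"
    using p by (simp add: GW.emeasure_eq_measure integral_nonneg_AE)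
  moreover have "\<psi> p = 1 - expect (\<lambda>d. (1 - p) ^ d)"
    unfolding \<psi>_def using p
    by (subst Bochner_Integration.integral_diff) (auto intro!: integrable_square_bound[of _ 0 1] simp: power_le_one)
  ultimately show ?thesis using c[OF le(2)] by (simp add: p_def)
qed

definition pivot_cdf :: "real \<Rightarrow> real" where
  "pivot_cdf x = GW.prob {\<omega>. root_pivot \<omega> \<le> x}"

definition entry_cdf :: "real \<Rightarrow> real" where
  "entry_cdf x = GW.prob {\<omega>. entry \<omega> \<le> x}"

lemma sets_pivot_le [measurable]:
  "{\<omega>. root_pivot \<omega> \<le> x} \<in> sets GW" "{\<omega>. entry \<omega> \<le> x} \<in> sets GW" "{\<omega>. pivot_upto n \<omega> \<le> x} \<in> sets GW"
  by (rule sets_Collect_GW, measurable)+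

lemma prob_pivot_upto_Suc:
  assumes "0 \<le> x" "x \<le> 1"
  shows "GW.prob {\<omega>. pivot_upto (Suc n) \<omega> \<le> x} = \<psi> (x * GW.prob {\<omega>. pivot_upto n \<omega> \<le> x})"
  using prob_Min_children[of "\<lambda>\<omega>. max (weight \<omega> []) (pivot_upto n \<omega>)" "pivot_upto (Suc n)" x]
    prob_max_weight[OF measurable_pivot_upto pivot_upto_node assms, of n] by simp

lemma prob_pivot_upto_tendsto: "(\<lambda>n. GW.prob {\<omega>. pivot_upto n \<omega> \<le> x}) \<longlonglongrightarrow> pivot_cdf x"
proof -
  \<comment> \<open>The events for a single depth decrease only on regular samples, so the
    conditions for all smaller depths are built in to get a monotone sequence everywhere.\<close>
  define E where "E n = {\<omega>. \<forall>m\<le>n. pivot_upto m \<omega> \<le> x}" for n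
  have E: "E n \<in> sets GW" for n
  proof -
    have "E n = (\<Inter>m\<in>{..n}. {\<omega>. pivot_upto m \<omega> \<le> x})" by (auto simp: E_def)
    then show ?thesis by (simp add: sets.finite_INT)
  qed
  have "(\<lambda>n. GW.prob (E n)) \<longlonglongrightarrow> GW.prob (\<Inter>n. E n)"
    by (rule GW.finite_Lim_measure_decseq) (use E in \<open>auto simp: decseq_def E_def\<close>)
  moreover have "GW.prob (E n) = GW.prob {\<omega>. pivot_upto n \<omega> \<le> x}" for n
  proof (rule GW.finite_measure_eq_AE)
    show "AE \<omega> in GW. (\<omega> \<in> E n) = (\<omega> \<in> {\<omega>. pivot_upto n \<omega> \<le> x})"
      using AE_regular by eventually_elim (auto simp: E_def intro: order_trans[OF pivot_upto_mono])
  qed (use E in auto)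
  moreover have "GW.prob (\<Inter>n. E n) = pivot_cdf x"
    unfolding pivot_cdf_def
  proof (rule GW.finite_measure_eq_AE)
    show "AE \<omega> in GW. (\<omega> \<in> (\<Inter>n. E n)) = (\<omega> \<in> {\<omega>. root_pivot \<omega> \<le> x})"
      using AE_regular by eventually_elim (auto simp: E_def root_pivot_le_iff)
  qed (use E in auto)
  ultimately show ?thesis by simp
qed

lemma entry_cdf_eq: "0 \<le> x \<Longrightarrow> x \<le> 1 \<Longrightarrow> entry_cdf x = x * pivot_cdf x"
  unfolding entry_cdf_def pivot_cdf_def entry_def
  by (rule prob_max_weight[OF measurable_root_pivot root_pivot_node])

lemma pivot_cdf_bounds: "0 \<le> pivot_cdf x" "pivot_cdf x \<le> 1"
  by (auto simp: pivot_cdf_def)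

lemma pivot_cdf_mono: "x \<le> y \<Longrightarrow> pivot_cdf x \<le> pivot_cdf y"
  unfolding pivot_cdf_def by (intro GW.finite_measure_mono) auto

lemma pivot_cdf_fixpoint:
  assumes "0 \<le> x" "x \<le> 1"
  shows "pivot_cdf x = \<psi> (x * pivot_cdf x)"
proof -
  have r: "x * p \<in> {0..1}" if "0 \<le> p" "p \<le> 1" for p
    using assms that by (auto simp: mult_le_one)
  have "(\<lambda>n. \<psi> (x * GW.prob {\<omega>. pivot_upto n \<omega> \<le> x})) \<longlonglongrightarrow> \<psi> (x * pivot_cdf x)"
    by (rule continuous_on_tendsto_compose[OF continuous_\<psi>])
       (auto intro!: tendsto_intros prob_pivot_upto_tendsto r[unfolded atLeastAtMost_iff, THEN conjunct1]
          r[unfolded atLeastAtMost_iff, THEN conjunct2] pivot_cdf_bounds always_eventually)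
  then have "(\<lambda>n. GW.prob {\<omega>. pivot_upto (Suc n) \<omega> \<le> x}) \<longlonglongrightarrow> \<psi> (x * pivot_cdf x)"
    by (simp only: prob_pivot_upto_Suc[OF assms])
  from LIMSEQ_unique[OF LIMSEQ_Suc[OF prob_pivot_upto_tendsto] this] show ?thesis .
qed

lemma b_bounds: "0 < y \<Longrightarrow> y \<le> 1 \<Longrightarrow> 0 < b y \<and> b y \<le> 1"
  using b_gt[of y] b_mono[of y 1] \<mu>_gt_1 by (auto intro: less_trans[of 0 "1 / \<mu>"])

text \<open>The equation \<open>p = \<psi> (x * p)\<close> is also solved by 0, so it does not
  determine the distribution function by itself. The probabilities for truncated depth start at 1
  and never fall below the fixed point \<open>y\<close>, which keeps the limit positive; among
  positive values the solution is unique because \<open>t / \<psi> t\<close> is strictly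
  increasing.\<close>

lemma pivot_cdf_b:
  assumes y: "0 < y" "y \<le> 1"
  shows "pivot_cdf (b y) = y"
proof -
  have b: "0 \<le> b y" "b y \<le> 1" using b_bounds[OF y] by auto
  have bt: "b y * y = \<theta> y" using y by (simp add: b_def)
  have "GW.prob {\<omega>. pivot_upto n \<omega> \<le> b y} \<ge> y" for n
  proof (induction n)
    case 0
    have "{\<omega>. pivot_upto 0 \<omega> \<le> b y} = space GW" using b by simp
    then show ?case using y by (simp only: GW.prob_space)
  next
    case (Suc n)
    have "\<psi> (\<theta> y) \<le> \<psi> (b y * GW.prob {\<omega>. pivot_upto n \<omega> \<le> b y})"
    proof (subst \<psi>_le_iff)
      show "b y * GW.prob {\<omega>. pivot_upto n \<omega> \<le> b y} \<in> {0..1}" using b by (auto simp: mult_le_one)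
      show "\<theta> y \<le> b y * GW.prob {\<omega>. pivot_upto n \<omega> \<le> b y}"
        using Suc b by (simp flip: bt add: mult_left_mono)
    qed (rule \<theta>_range)
    then show ?case using y prob_pivot_upto_Suc[OF b] by simp
  qed
  then have ge: "pivot_cdf (b y) \<ge> y" by (intro LIMSEQ_le_const[OF prob_pivot_upto_tendsto]) auto
  define t where "t = b y * pivot_cdf (b y)"
  have fp: "pivot_cdf (b y) = \<psi> t" unfolding t_def by (rule pivot_cdf_fixpoint[OF b])
  have t: "\<theta> y \<le> t" "t \<le> 1"
    unfolding t_def using ge b pivot_cdf_bounds by (auto simp flip: bt simp: mult_left_mono mult_le_one)
  have pos: "\<theta> y > 0" by (rule \<theta>_pos[OF y])
  \<comment> \<open>Both sides are \<open>b y\<close>.\<close>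
  have eq: "t / \<psi> t = \<theta> y / \<psi> (\<theta> y)"
    using fp \<psi>_pos[of t] t pos y by (simp add: t_def b_def)
  have "\<not> \<theta> y < t"
  proof
    assume "\<theta> y < t"
    from Q_less[OF pos this t(2)] show False using eq by simp
  qed
  with t(1) have "t = \<theta> y" by (simp add: not_less order_antisym)
  then show ?thesis using fp y by simp
qed

lemma entry_cdf_b: "0 < y \<Longrightarrow> y \<le> 1 \<Longrightarrow> entry_cdf (b y) = \<theta> y"
  using entry_cdf_eq[of "b y"] b_bounds[of y] pivot_cdf_b[of y] by (simp add: b_def)

definition level :: "sample \<Rightarrow> real" where
  "level \<omega> = pivot_cdf (root_pivot \<omega>)"

lemma measurable_pivot_cdf [measurable]: "pivot_cdf \<in> borel_measurable borel"
  by (intro borel_measurable_mono monoI pivot_cdf_mono)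

lemma measurable_entry_cdf [measurable]: "entry_cdf \<in> borel_measurable borel"
  unfolding entry_cdf_def by (intro borel_measurable_mono monoI GW.finite_measure_mono) auto

lemma measurable_level [measurable]: "level \<in> borel_measurable GW"
  unfolding level_def[abs_def] by measurable

text \<open>The event that the pivot lies below all quantiles \<open>b (1 / (n + 1))\<close> has
  probability at most \<open>1 / (n + 1)\<close> for every \<open>n\<close>. Outside this null event
  the level is positive, and the fixed-point equation can be solved for the pivot.\<close>

lemma AE_level: "AE \<omega> in GW. 0 < level \<omega> \<and> level \<omega> \<le> 1 \<and> root_pivot \<omega> = b (level \<omega>)"
proof -
  define N where "N = {\<omega>. \<forall>n. root_pivot \<omega> \<le> b (1 / real (Suc n))}"
  have N: "N \<in> sets GW"
  proof -
    have "N = (\<Inter>n. {\<omega>. root_pivot \<omega> \<le> b (1 / real (Suc n))})" by (auto simp: N_def)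
    then show ?thesis by simp
  qed
  have "GW.prob N \<le> 1 / real (Suc n)" for n
  proof -
    have "GW.prob N \<le> pivot_cdf (b (1 / real (Suc n)))"
      unfolding pivot_cdf_def by (intro GW.finite_measure_mono) (auto simp: N_def)
    then show ?thesis by (simp add: pivot_cdf_b)
  qed
  then have "GW.prob N \<le> 0"
    by (intro LIMSEQ_le_const[OF LIMSEQ_Suc[OF lim_inverse_n']]) auto
  then have "GW.prob N = 0" by (simp add: measure_le_0_iff)
  then have "AE \<omega> in GW. \<omega> \<notin> N" using N by (simp add: GW.prob_eq_0)
  then show ?thesis using AE_regular
  proof eventually_elim
    case (elim \<omega>)
    then obtain n where n: "root_pivot \<omega> > b (1 / real (Suc n))" by (auto simp: N_def not_le)
    have "pivot_cdf (b (1 / real (Suc n))) \<le> level \<omega>"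
      unfolding level_def using n by (intro pivot_cdf_mono) simp
    then have "1 / real (Suc n) \<le> level \<omega>" by (simp add: pivot_cdf_b)
    moreover have "0 < 1 / real (Suc n)" by simp
    ultimately have pos: "0 < level \<omega>" by linarith
    have x: "0 \<le> root_pivot \<omega>" "root_pivot \<omega> \<le> 1" using root_pivot_bounds[OF elim(2)] by auto
    have le: "level \<omega> \<le> 1" unfolding level_def by (rule pivot_cdf_bounds)
    have "\<theta> (level \<omega>) = \<theta> (\<psi> (root_pivot \<omega> * level \<omega>))"
      unfolding level_def using pivot_cdf_fixpoint[OF x] by simp
    also have "\<dots> = root_pivot \<omega> * level \<omega>"
      using x pos le by (intro \<theta>_\<psi>) (auto simp: mult_le_one)
    finally have "root_pivot \<omega> = b (level \<omega>)" using pos by (simp add: b_def)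
    then show ?case using pos le by simp
  qed
qed

lemma distr_level: "distr GW borel level = unit_uniform" (is "?L = _")
proof (rule cdf_unique')
  interpret L: prob_space ?L by (rule GW.prob_space_distr) simp
  show "finite_borel_measure ?L" "finite_borel_measure unit_uniform"
    by (auto simp: finite_borel_measure_def finite_borel_measure_axioms_def L.finite_measure_axioms U.finite_measure_axioms)
  show "cdf ?L = cdf unit_uniform"
  proof
    fix y :: real
    have cdf: "cdf ?L y = GW.prob {\<omega>. level \<omega> \<le> y}"
      unfolding cdf_def by (subst measure_distr) (auto simp: vimage_def)
    have [measurable]: "{\<omega>. level \<omega> \<le> y} \<in> sets GW" by (rule sets_Collect_GW) measurable
    consider "y \<le> 0" | "0 < y" "y \<le> 1" | "y > 1" by linarith
    then show "cdf ?L y = cdf unit_uniform y"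
    proof cases
      case 1
      have "GW.prob {\<omega>. level \<omega> \<le> y} = GW.prob {}"
        by (rule GW.finite_measure_eq_AE) (use AE_level 1 in \<open>auto elim!: eventually_mono\<close>)
      moreover have "measure unit_uniform {..y} \<le> measure unit_uniform {..0}"
        using 1 by (intro U.finite_measure_mono) auto
      then have "measure unit_uniform {..y} = 0"
        using measure_unit_uniform_atMost[of 0] measure_nonneg[of unit_uniform "{..y}"] by linarith
      ultimately show ?thesis unfolding cdf unfolding cdf_def by simp
    next
      case 2
      have "GW.prob {\<omega>. level \<omega> \<le> y} = pivot_cdf (b y)"
        unfolding pivot_cdf_def
      proof (rule GW.finite_measure_eq_AE)
        show "AE \<omega> in GW. (\<omega> \<in> {\<omega>. level \<omega> \<le> y}) = (\<omega> \<in> {\<omega>. root_pivot \<omega> \<le> b y})"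
          using AE_level
        proof eventually_elim
          case (elim \<omega>)
          then show ?case using b_mono[of "level \<omega>" y] b_less[of y "level \<omega>"] 2 by (auto simp: not_le[symmetric])
        qed
      qed auto
      then show ?thesis
        unfolding cdf using 2 by (simp add: pivot_cdf_b cdf_def measure_unit_uniform_atMost)
    next
      case 3
      have "AE \<omega> in GW. \<omega> \<in> {\<omega>. level \<omega> \<le> y}"
        using AE_level by eventually_elim (use 3 in auto)
      then have "GW.prob {\<omega>. level \<omega> \<le> y} = 1" by (subst GW.prob_eq_1) auto
      moreover have "measure unit_uniform {..1} \<le> measure unit_uniform {..y}"
        using 3 by (intro U.finite_measure_mono) auto
      then have "measure unit_uniform {..y} = 1"
        using measure_unit_uniform_atMost[of 1] U.prob_le_1[of "{..y}"] by linarith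
      ultimately show ?thesis unfolding cdf unfolding cdf_def by simp
    qed
  qed
qed

lemma nn_integral_level:
  assumes "F \<in> borel_measurable borel"
  shows "(\<integral>\<^sup>+\<omega>. F (level \<omega>) \<partial>GW) = (\<integral>\<^sup>+y. F y \<partial>unit_uniform)"
  using assms by (subst distr_level[symmetric], subst nn_integral_distr) auto

lemma sets_entry_eq [measurable]: "{\<omega>. entry \<omega> = x} \<in> sets GW"
  by (rule sets_Collect_GW) (unfold pred_def, rule borel_measurable_eq, measurable)

text \<open>Neither the pivot nor the weight has atoms, hence neither has their maximum. For this
  reason ties between children, and the difference between strict and weak comparisons, are
  negligible.\<close>

lemma prob_entry_eq: "emeasure GW {\<omega>. entry \<omega> = x} = 0"
proof -
  have "AE \<omega> in GW. root_pivot \<omega> \<noteq> x"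
  proof -
    have "AE y in unit_uniform. y \<noteq> c" for c :: real
      by (intro AE_uniform_measureI eventually_mono[OF AE_lborel_singleton[of c]]) auto
    from this[of "pivot_cdf x"] have "AE y in distr GW borel level. y \<noteq> pivot_cdf x" by (simp only: distr_level)
    then have "AE \<omega> in GW. level \<omega> \<noteq> pivot_cdf x" by (subst (asm) AE_distr_iff) auto
    then show ?thesis by eventually_elim (auto simp: level_def)
  qed
  moreover have "AE \<omega> in GW. weight \<omega> [] \<noteq> x"
  proof -
    have "(\<integral>\<^sup>+\<omega>. indicator {x} (weight \<omega> []) \<partial>GW) = (\<integral>\<^sup>+\<omega>. \<integral>\<^sup>+u. indicator {x} u \<partial>unit_uniform \<partial>GW)"
      by (rule nn_integral_root_weight[of "\<lambda>u _. indicator {x} u"]) auto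
    also have "\<dots> = 0" by (simp add: emeasure_lborel_countable)
    finally have "AE \<omega> in GW. indicator {x} (weight \<omega> []) = (0::ennreal)"
      by (subst (asm) nn_integral_0_iff_AE) auto
    then show ?thesis by eventually_elim (auto simp: indicator_def)
  qed
  ultimately have "AE \<omega> in GW. entry \<omega> \<noteq> x"
    by eventually_elim (auto simp: entry_def max_def)
  then show ?thesis by (subst (asm) AE_iff_measurable[OF _ refl]) auto
qed

lemma prob_entry_gt:
  "emeasure GW {\<omega>. entry \<omega> > x} = ennreal (1 - entry_cdf x)"
  "emeasure GW {\<omega>. entry \<omega> \<ge> x} = ennreal (1 - entry_cdf x)"
proof -
  have "{\<omega>. entry \<omega> > x} = space GW - {\<omega>. entry \<omega> \<le> x}" by auto
  then show 1: "emeasure GW {\<omega>. entry \<omega> > x} = ennreal (1 - entry_cdf x)"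
    using GW.prob_compl[of "{\<omega>. entry \<omega> \<le> x}"] by (simp add: GW.emeasure_eq_measure entry_cdf_def)
  have "{\<omega>. entry \<omega> \<ge> x} = {\<omega>. entry \<omega> > x} \<union> {\<omega>. entry \<omega> = x}" by auto
  moreover have "{\<omega>. entry \<omega> > x} \<in> sets GW"
    using \<open>{\<omega>. entry \<omega> > x} = space GW - {\<omega>. entry \<omega> \<le> x}\<close> by (metis sets.compl_sets sets_pivot_le(2))
  ultimately show "emeasure GW {\<omega>. entry \<omega> \<ge> x} = ennreal (1 - entry_cdf x)"
    using 1 by (subst \<open>{\<omega>. entry \<omega> \<ge> x} = _\<close>, subst emeasure_Un_null_set)
       (auto simp: null_sets_def prob_entry_eq)
qed

section \<open>The pivots along the backbone form a Markov chain\<close>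

lemma nn_integral_forest_split:
  assumes [measurable]: "\<Phi> \<in> borel_measurable forest"
  shows "(\<integral>\<^sup>+f. \<Phi> f \<partial>forest) = (\<integral>\<^sup>+\<omega>. \<integral>\<^sup>+X. \<Phi> (X(i := \<omega>)) \<partial>PiM (UNIV - {i}) (\<lambda>_. GW) \<partial>GW)"
proof -
  let ?K = "PiM (UNIV - {i}) (\<lambda>_. GW)"
  interpret K: prob_space ?K by (intro prob_space_PiM GW.prob_space_axioms)
  have eq: "distr (GW \<Otimes>\<^sub>M ?K) forest (\<lambda>(x, X). X(i := x)) = forest"
    using distr_pair_PiM_eq_PiM[of "UNIV - {i}" "\<lambda>_. GW" i] GW.prob_space_axioms by (simp add: insert_absorb)
  have meas: "(\<lambda>(x, X). X(i := x)) \<in> measurable (GW \<Otimes>\<^sub>M ?K) forest"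
    using measurable_add_dim[of i "UNIV - {i}" "\<lambda>_. GW"]
    by (simp add: case_prod_beta measurable_pair_swap_iff[of _ GW ?K] insert_absorb)
  have "(\<integral>\<^sup>+f. \<Phi> f \<partial>forest) = (\<integral>\<^sup>+z. \<Phi> ((\<lambda>(x, X). X(i := x)) z) \<partial>(GW \<Otimes>\<^sub>M ?K))"
    by (subst (1) eq[symmetric]) (rule nn_integral_distr[OF meas], simp)
  also have "\<dots> = (\<integral>\<^sup>+\<omega>. \<integral>\<^sup>+X. \<Phi> (X(i := \<omega>)) \<partial>?K \<partial>GW)"
    by (subst K.nn_integral_fst[symmetric]) (use measurable_compose[OF meas assms] in simp_all)
  finally show ?thesis .
qed

section \<open>Almost sure absence of ties\<close>

lemma AE_forest_entries_neq:
  assumes "i \<noteq> j"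
  shows "AE f in forest. entry (f i) \<noteq> entry (f j)"
proof -
  let ?K = "PiM (UNIV - {i}) (\<lambda>_. GW)"
  have S: "{f. entry (f i) = entry (f j)} \<in> sets forest"
  proof -
    have "{f \<in> space forest. entry (f i) = entry (f j)} \<in> sets forest"
      by (rule borel_measurable_eq) measurable
    then show ?thesis by simp
  qed
  have "emeasure forest {f. entry (f i) = entry (f j)}
      = (\<integral>\<^sup>+f. indicator {f. entry (f i) = entry (f j)} f \<partial>forest)"
    using S by simp
  also have "\<dots> = (\<integral>\<^sup>+\<omega>. \<integral>\<^sup>+X. indicator {f. entry (f i) = entry (f j)} (X(i := \<omega>)) \<partial>?K \<partial>GW)"
    using S by (intro nn_integral_forest_split) simp
  also have "\<dots> = (\<integral>\<^sup>+\<omega>. 0 \<partial>GW)"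
  proof (rule nn_integral_cong)
    fix \<omega>
    have m: "{X \<in> space ?K. \<forall>k\<in>{j}. entry (X k) = entry \<omega>} \<in> sets ?K"
    proof -
      have "(\<lambda>X. entry (X j)) \<in> borel_measurable ?K"
      proof (rule measurable_compose[OF _ measurable_entry])
        show "(\<lambda>X. X j) \<in> measurable ?K GW" by (rule measurable_component_singleton) (use assms in simp)
      qed
      then have "{X \<in> space ?K. entry (X j) = entry \<omega>} \<in> sets ?K" by (intro borel_measurable_eq) auto
      then show ?thesis by simp
    qed
    have "(\<integral>\<^sup>+X. indicator {f. entry (f i) = entry (f j)} (X(i := \<omega>)) \<partial>?K)
        = (\<integral>\<^sup>+X. indicator {X \<in> space ?K. \<forall>k\<in>{j}. entry (X k) = entry \<omega>} X \<partial>?K)"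
      using assms by (intro nn_integral_cong) (auto simp: indicator_def)
    also have "\<dots> = emeasure ?K {X \<in> space ?K. \<forall>k\<in>{j}. entry (X k) = entry \<omega>}"
      using m by (rule nn_integral_indicator)
    also have "\<dots> = 0"
      using prob_forest_all[of "{j}" "UNIV - {i}" "\<lambda>_ \<omega>'. entry \<omega>' = entry \<omega>"] assms
      by (simp add: prob_entry_eq)
    finally show "(\<integral>\<^sup>+X. indicator {f. entry (f i) = entry (f j)} (X(i := \<omega>)) \<partial>?K) = 0" .
  qed
  finally have "emeasure forest {f. entry (f i) = entry (f j)} = 0" by simp
  then show ?thesis using S by (intro AE_I[of _ _ "{f. entry (f i) = entry (f j)}"]) auto
qed

lemma AE_child_entries_neq:
  assumes "i \<noteq> j"
  shows "AE \<omega> in GW. entry (child \<omega> i) \<noteq> entry (child \<omega> j)"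
proof -
  have S: "{\<omega>. entry (child \<omega> i) = entry (child \<omega> j)} \<in> sets GW"
    by (rule sets_Collect_GW) (unfold pred_def, rule borel_measurable_eq, measurable)
  have "emeasure GW {\<omega>. entry (child \<omega> i) = entry (child \<omega> j)}
      = (\<integral>\<^sup>+\<omega>. indicator {\<omega>. entry (child \<omega> i) = entry (child \<omega> j)} \<omega> \<partial>GW)"
    using S by simp
  also have "\<dots> = (\<integral>\<^sup>+d. \<integral>\<^sup>+u. \<integral>\<^sup>+f. indicator {\<omega>. entry (child \<omega> i) = entry (child \<omega> j)} (node d u f)
      \<partial>forest \<partial>unit_uniform \<partial>measure_pmf Z)"
    using S by (intro nn_integral_GW) simp
  also have "\<dots> = 0"
  proof -
    have "(\<integral>\<^sup>+f. indicator {\<omega>. entry (child \<omega> i) = entry (child \<omega> j)} (node d u f) \<partial>forest) = (\<integral>\<^sup>+f. 0 \<partial>forest)" for d u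
      by (rule nn_integral_cong_AE) (use AE_forest_entries_neq[OF assms] in \<open>auto elim!: eventually_mono\<close>)
    then show ?thesis by simp
  qed
  finally show ?thesis
    using S by (intro AE_I[of _ _ "{\<omega>. entry (child \<omega> i) = entry (child \<omega> j)}"]) auto
qed

lemma AE_distinct_entries: "AE \<omega> in GW. distinct_entries \<omega>"
proof -
  have "AE \<omega> in GW. entry (subsample \<omega> (v @ [i])) \<noteq> entry (subsample \<omega> (v @ [j]))" if "i \<noteq> j" for v i j
  proof -
    have "AE \<omega> in distr GW GW (\<lambda>\<omega>. subsample \<omega> v). entry (child \<omega> i) \<noteq> entry (child \<omega> j)"
      unfolding distr_subsample by (rule AE_child_entries_neq[OF that])
    from AE_distrD[OF measurable_subsample this] show ?thesis by simp
  qed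
  then have "AE \<omega> in GW. \<forall>v i j. i \<noteq> j \<longrightarrow> entry (subsample \<omega> (v @ [i])) \<noteq> entry (subsample \<omega> (v @ [j]))"
    unfolding AE_all_countable by simp
  then show ?thesis by eventually_elim (auto simp: distinct_entries_def)
qed

lemma AE_pivot_backbone: "AE \<omega> in GW. \<forall>n. pivot \<omega> (backbone \<omega> n) = root_pivot ((advance ^^ n) \<omega>)"
  using AE_regular AE_distinct_entries by eventually_elim (simp add: pivot_backbone)

text \<open>Given the subtree at \<open>i\<close>, each of the other \<open>d - 1\<close>
  independent subtrees must have a larger entry. Strict and weak comparisons have equal probability,
  so the position \<open>i\<close> drops out of the result.\<close>

lemma nn_integral_best_child:
  assumes [measurable]: "F \<in> borel_measurable GW" and "i < d"
  defines "S \<equiv> {f. \<forall>j<d. (j < i \<longrightarrow> entry (f i) < entry (f j)) \<and> (i < j \<longrightarrow> entry (f i) \<le> entry (f j))}"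
  shows "S \<in> sets forest"
    and "(\<integral>\<^sup>+f. F (f i) * indicator S f \<partial>forest) = (\<integral>\<^sup>+\<omega>. F \<omega> * ennreal ((1 - entry_cdf (entry \<omega>)) ^ (d - 1)) \<partial>GW)"
proof -
  let ?K = "PiM (UNIV - {i}) (\<lambda>_. GW)"
  have "Measurable.pred forest (\<lambda>f. (j < i \<longrightarrow> entry (f i) < entry (f j)) \<and> (i < j \<longrightarrow> entry (f i) \<le> entry (f j)))" for j
  proof -
    have lt: "Measurable.pred forest (\<lambda>f. entry (f i) < entry (f j))" by measurable
    have le: "Measurable.pred forest (\<lambda>f. entry (f i) \<le> entry (f j))"
      unfolding pred_def by (rule borel_measurable_le) measurable
    consider "j < i" "\<not> i < j" | "i < j" "\<not> j < i" | "\<not> i < j" "\<not> j < i" by linarith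
    then show ?thesis by cases (simp_all only: simp_thms lt le pred_intros_logic measurable_const space_count_space UNIV_I)
  qed
  then have "{f \<in> space forest. \<forall>j\<in>{..<d}. (j < i \<longrightarrow> entry (f i) < entry (f j)) \<and> (i < j \<longrightarrow> entry (f i) \<le> entry (f j))} \<in> sets forest"
    unfolding pred_def by (intro sets.sets_Collect_finite_All finite_lessThan)
  then show S: "S \<in> sets forest" by (simp only: S_def space_forest UNIV_I simp_thms Ball_def lessThan_iff)
  note [measurable] = this
  have "(\<integral>\<^sup>+f. F (f i) * indicator S f \<partial>forest)
      = (\<integral>\<^sup>+\<omega>. \<integral>\<^sup>+X. F ((X(i := \<omega>)) i) * indicator S (X(i := \<omega>)) \<partial>?K \<partial>GW)"
    by (rule nn_integral_forest_split) measurable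
  also have "\<dots> = (\<integral>\<^sup>+\<omega>. F \<omega> * ennreal ((1 - entry_cdf (entry \<omega>)) ^ (d - 1)) \<partial>GW)"
  proof (rule nn_integral_cong)
    fix \<omega>
    define Q where "Q j \<omega>' = (if j < i then entry \<omega> < entry \<omega>' else entry \<omega> \<le> entry \<omega>')" for j \<omega>'
    define J where "J = {..<d} - {i}"
    have Q: "{\<omega>'. Q j \<omega>'} \<in> sets GW" for j
      by (rule sets_Collect_GW) (unfold Q_def, measurable)
    have Qp: "emeasure GW {\<omega>'. Q j \<omega>'} = ennreal (1 - entry_cdf (entry \<omega>))" for j
      by (cases "j < i") (simp_all add: Q_def prob_entry_gt)
    have ind: "indicator S (X(i := \<omega>)) = (indicator {X \<in> space ?K. \<forall>j\<in>J. Q j (X j)} X :: ennreal)"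
      if "X \<in> space ?K" for X
    proof -
      have "X(i := \<omega>) \<in> S \<longleftrightarrow> (\<forall>j\<in>J. Q j (X j))"
        unfolding S_def J_def Q_def by (auto simp: not_less le_less)
      then show ?thesis using that by (simp add: indicator_def)
    qed
    have m: "{X \<in> space ?K. \<forall>j\<in>J. Q j (X j)} \<in> sets ?K"
    proof -
      have "{X \<in> space ?K. \<forall>j\<in>J. Q j (X j)} = prod_emb (UNIV - {i}) (\<lambda>_. GW) J (\<Pi>\<^sub>E j\<in>J. {\<omega>. Q j \<omega>})"
        by (auto simp: prod_emb_iff space_PiM PiE_iff J_def)
      then show ?thesis using Q by (auto simp: J_def intro!: sets_PiM_I)
    qed
    have "(\<integral>\<^sup>+X. F ((X(i := \<omega>)) i) * indicator S (X(i := \<omega>)) \<partial>?K)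
        = (\<integral>\<^sup>+X. F \<omega> * indicator {X \<in> space ?K. \<forall>j\<in>J. Q j (X j)} X \<partial>?K)"
      by (intro nn_integral_cong) (simp add: ind)
    also have "\<dots> = F \<omega> * emeasure ?K {X \<in> space ?K. \<forall>j\<in>J. Q j (X j)}"
      using m by (rule nn_integral_cmult_indicator)
    also have "emeasure ?K {X \<in> space ?K. \<forall>j\<in>J. Q j (X j)} = (\<Prod>j\<in>J. ennreal (1 - entry_cdf (entry \<omega>)))"
      by (subst prob_forest_all) (auto simp: J_def Q Qp)
    also have "\<dots> = ennreal ((1 - entry_cdf (entry \<omega>)) ^ (d - 1))"
      using assms(2) by (simp add: J_def entry_cdf_def flip: ennreal_power)
    finally show "(\<integral>\<^sup>+X. F ((X(i := \<omega>)) i) * indicator S (X(i := \<omega>)) \<partial>?K)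
        = F \<omega> * ennreal ((1 - entry_cdf (entry \<omega>)) ^ (d - 1))" .
  qed
  finally show "(\<integral>\<^sup>+f. F (f i) * indicator S f \<partial>forest) = (\<integral>\<^sup>+\<omega>. F \<omega> * ennreal ((1 - entry_cdf (entry \<omega>)) ^ (d - 1)) \<partial>GW)" .
qed

lemma entry_cdf_bounds: "0 \<le> entry_cdf x" "entry_cdf x \<le> 1"
  by (auto simp: entry_cdf_def)

text \<open>The factor \<open>\<psi>'\<close> is the size bias: it sums, over the choice of the best child, the probability
  that all other children have a larger entry level.\<close>

lemma nn_integral_advance:
  assumes [measurable]: "(\<lambda>(x, \<omega>). \<Phi> x \<omega>) \<in> borel_measurable (borel \<Otimes>\<^sub>M GW)"
  shows "(\<integral>\<^sup>+\<omega>. \<Phi> (root_pivot \<omega>) (advance \<omega>) \<partial>GW)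
    = (\<integral>\<^sup>+\<omega>. \<Phi> (entry \<omega>) \<omega> * ennreal (\<psi>' (entry_cdf (entry \<omega>))) \<partial>GW)"
proof -
  define F where "F \<omega> = \<Phi> (entry \<omega>) \<omega>" for \<omega>
  define p where "p \<omega> = 1 - entry_cdf (entry \<omega>)" for \<omega>
  have p: "0 \<le> p \<omega>" "p \<omega> \<le> 1" for \<omega> using entry_cdf_bounds[of "entry \<omega>"] by (auto simp: p_def)
  have F [measurable]: "F \<in> borel_measurable GW" unfolding F_def[abs_def] by measurable
  have p_meas [measurable]: "p \<in> borel_measurable GW" unfolding p_def[abs_def] by measurable
  define S where "S d i = {f. \<forall>j<d. (j < i \<longrightarrow> entry (f i) < entry (f j)) \<and> (i < j \<longrightarrow> entry (f i) \<le> entry (f j))}" for d i :: nat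
  have S: "S d i \<in> sets forest" if "i < d" for d i
    using nn_integral_best_child(1)[OF F that] by (simp add: S_def)
  have "(\<integral>\<^sup>+\<omega>. \<Phi> (root_pivot \<omega>) (advance \<omega>) \<partial>GW)
      = (\<integral>\<^sup>+d. \<integral>\<^sup>+u. \<integral>\<^sup>+f. \<Phi> (root_pivot (node d u f)) (advance (node d u f)) \<partial>forest \<partial>unit_uniform \<partial>measure_pmf Z)"
    by (rule nn_integral_GW) measurable
  also have "\<dots> = (\<integral>\<^sup>+d. \<integral>\<^sup>+\<omega>. F \<omega> * ennreal (real d * p \<omega> ^ (d - 1)) \<partial>GW \<partial>measure_pmf Z)"
  proof (rule nn_integral_cong_AE, rule eventually_mono[OF AE_pos])
    fix d :: nat assume d: "1 \<le> d"
    have "(\<integral>\<^sup>+f. \<Phi> (root_pivot (node d u f)) (advance (node d u f)) \<partial>forest)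
        = (\<integral>\<^sup>+\<omega>. F \<omega> * ennreal (real d * p \<omega> ^ (d - 1)) \<partial>GW)" if u: "0 < u \<and> u < 1" for u
    proof -
      \<comment> \<open>On a regular forest exactly one of the events \<open>S d i\<close> occurs,
        the one of the best child.\<close>
      have "(\<integral>\<^sup>+f. \<Phi> (root_pivot (node d u f)) (advance (node d u f)) \<partial>forest)
          = (\<integral>\<^sup>+f. (\<Sum>i<d. F (f i) * indicator (S d i) f) \<partial>forest)"
      proof (rule nn_integral_cong_AE, rule eventually_mono[OF AE_forest_regular])
        fix f :: "nat \<Rightarrow> sample" assume f: "\<forall>i. regular (f i)"
        have reg: "regular (node d u f)" using d u f by (intro regular_node) auto
        define i where "i = best (node d u f)"
        have i: "i < d" "entry (f i) = root_pivot (node d u f)" "advance (node d u f) = f i"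
          using best_works[OF reg] by (simp_all add: i_def advance_def)
        have S_iff: "f \<in> S d j \<longleftrightarrow> j = i" if "j < d" for j
          using best_eq_iff[OF reg, of j] that by (auto simp: S_def i_def)
        have "(\<Sum>j<d. F (f j) * indicator (S d j) f) = (\<Sum>j<d. if j = i then F (f j) else 0)"
          by (intro sum.cong refl) (simp add: S_iff indicator_def)
        also have "\<dots> = F (f i)" using i by simp
        finally show "\<Phi> (root_pivot (node d u f)) (advance (node d u f)) = (\<Sum>i<d. F (f i) * indicator (S d i) f)"
          using i by (simp add: F_def)
      qed
      also have "\<dots> = (\<Sum>i<d. \<integral>\<^sup>+f. F (f i) * indicator (S d i) f \<partial>forest)"
      proof (rule nn_integral_sum)
        fix i assume "i \<in> {..<d}"
        then have [measurable]: "S d i \<in> sets forest" using S by simp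
        show "(\<lambda>f. F (f i) * indicator (S d i) f) \<in> borel_measurable forest" by measurable
      qed
      also have "\<dots> = (\<Sum>i<d. \<integral>\<^sup>+\<omega>. F \<omega> * ennreal (p \<omega> ^ (d - 1)) \<partial>GW)"
        using nn_integral_best_child(2)[OF F] by (intro sum.cong refl) (simp add: S_def p_def)
      also have "\<dots> = (\<integral>\<^sup>+\<omega>. (\<Sum>i<d. F \<omega> * ennreal (p \<omega> ^ (d - 1))) \<partial>GW)"
        by (rule nn_integral_sum[symmetric]) measurable
      also have "\<dots> = (\<integral>\<^sup>+\<omega>. F \<omega> * ennreal (real d * p \<omega> ^ (d - 1)) \<partial>GW)"
        using p by (intro nn_integral_cong) (simp add: ennreal_mult ennreal_of_nat_eq_real_of_nat mult_ac)
      finally show ?thesis .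
    qed
    then have "AE u in unit_uniform. (\<integral>\<^sup>+f. \<Phi> (root_pivot (node d u f)) (advance (node d u f)) \<partial>forest)
        = (\<integral>\<^sup>+\<omega>. F \<omega> * ennreal (real d * p \<omega> ^ (d - 1)) \<partial>GW)"
      using AE_unit_uniform by (rule eventually_mono[rotated])
    then have "(\<integral>\<^sup>+u. \<integral>\<^sup>+f. \<Phi> (root_pivot (node d u f)) (advance (node d u f)) \<partial>forest \<partial>unit_uniform)
        = (\<integral>\<^sup>+u. (\<integral>\<^sup>+\<omega>. F \<omega> * ennreal (real d * p \<omega> ^ (d - 1)) \<partial>GW) \<partial>unit_uniform)"
      by (rule nn_integral_cong_AE)
    then show "(\<integral>\<^sup>+u. \<integral>\<^sup>+f. \<Phi> (root_pivot (node d u f)) (advance (node d u f)) \<partial>forest \<partial>unit_uniform)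
        = (\<integral>\<^sup>+\<omega>. F \<omega> * ennreal (real d * p \<omega> ^ (d - 1)) \<partial>GW)"
      using U.emeasure_space_1 by simp
  qed
  also have "\<dots> = (\<integral>\<^sup>+\<omega>. \<integral>\<^sup>+d. F \<omega> * ennreal (real d * p \<omega> ^ (d - 1)) \<partial>measure_pmf Z \<partial>GW)"
  proof -
    interpret pair_sigma_finite "measure_pmf Z" GW ..
    have "(\<lambda>(d, \<omega>). F \<omega> * ennreal (real d * p \<omega> ^ (d - 1))) \<in> borel_measurable (count_space UNIV \<Otimes>\<^sub>M GW)"
    proof (rule measurable_pair_measure_countable1)
      show "(\<lambda>\<omega>. case (d, \<omega>) of (d, \<omega>) \<Rightarrow> F \<omega> * ennreal (real d * p \<omega> ^ (d - 1))) \<in> borel_measurable GW" for d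
        unfolding prod.case by measurable
    qed simp
    then have "(\<lambda>(d, \<omega>). F \<omega> * ennreal (real d * p \<omega> ^ (d - 1))) \<in> borel_measurable (measure_pmf Z \<Otimes>\<^sub>M GW)"
      by (simp cong: measurable_cong_sets sets_pair_measure_cong)
    from Fubini'[OF this] show ?thesis by simp
  qed
  also have "\<dots> = (\<integral>\<^sup>+\<omega>. F \<omega> * ennreal (\<psi>' (entry_cdf (entry \<omega>))) \<partial>GW)"
  proof (rule nn_integral_cong)
    fix \<omega>
    have "(\<integral>\<^sup>+d. F \<omega> * ennreal (real d * p \<omega> ^ (d - 1)) \<partial>measure_pmf Z)
        = F \<omega> * (\<integral>\<^sup>+d. ennreal (real d * p \<omega> ^ (d - 1)) \<partial>measure_pmf Z)"
      by (rule nn_integral_cmult) simp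
    also have "(\<integral>\<^sup>+d. ennreal (real d * p \<omega> ^ (d - 1)) \<partial>measure_pmf Z) = ennreal (\<psi>' (entry_cdf (entry \<omega>)))"
      unfolding \<psi>'_def p_def using p[of \<omega>, unfolded p_def] entry_cdf_bounds[of "entry \<omega>"]
      by (intro nn_integral_expect integrable_\<psi>') auto
    finally show "(\<integral>\<^sup>+d. F \<omega> * ennreal (real d * p \<omega> ^ (d - 1)) \<partial>measure_pmf Z)
        = F \<omega> * ennreal (\<psi>' (entry_cdf (entry \<omega>)))" .
  qed
  finally show ?thesis by (simp add: F_def)
qed

lemma measurable_kernel_map [measurable]:
  "(\<lambda>(y, u). kernel_map y u) \<in> borel_measurable (borel \<Otimes>\<^sub>M borel)"
  unfolding kernel_map_def by measurable

lemma nn_integral_kernel_map: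
  assumes [measurable]: "w \<in> borel_measurable borel" and v: "0 < v" "v \<le> 1"
  shows "(\<integral>\<^sup>+u. w (kernel_map v u) \<partial>unit_uniform)
    = ennreal (1 - r v) * w v + ennreal (r v / v) * (\<integral>\<^sup>+y. w y * indicator {0..v} y \<partial>lborel)"
proof -
  have r: "0 < r v" "r v \<le> 1" using r_bounds[OF v] by auto
  have [measurable]: "kernel_map v \<in> borel_measurable borel" unfolding kernel_map_def[abs_def] by measurable
  have "(\<integral>\<^sup>+u. w (kernel_map v u) \<partial>unit_uniform) = (\<integral>\<^sup>+u. w (kernel_map v u) * indicator {0..1} u \<partial>lborel)"
    by (rule nn_integral_unit_uniform) measurable
  also have "\<dots> = (\<integral>\<^sup>+u. w v * indicator {r v..1} u + w (v / r v * u) * indicator {0..r v} u \<partial>lborel)"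
    by (rule nn_integral_cong_AE, rule eventually_mono[OF AE_lborel_singleton[of "r v"]])
       (use r in \<open>auto simp: kernel_map_def indicator_def mult.commute\<close>)
  also have "\<dots> = (\<integral>\<^sup>+u. w v * indicator {r v..1} u \<partial>lborel) + (\<integral>\<^sup>+u. w (v / r v * u) * indicator {0..r v} u \<partial>lborel)"
    by (rule nn_integral_add) measurable
  also have "(\<integral>\<^sup>+u. w v * indicator {r v..1} u \<partial>lborel) = ennreal (1 - r v) * w v"
    using r by (subst nn_integral_cmult_indicator) (auto simp: mult.commute)
  also have "(\<integral>\<^sup>+u. w (v / r v * u) * indicator {0..r v} u \<partial>lborel)
      = ennreal (r v / v) * (\<integral>\<^sup>+y. w y * indicator {0..v} y \<partial>lborel)"
  proof -
    have "(\<integral>\<^sup>+y. w y * indicator {0..v} y \<partial>lborel)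
        = ennreal \<bar>v / r v\<bar> * (\<integral>\<^sup>+u. w (0 + v / r v * u) * indicator {0..v} (0 + v / r v * u) \<partial>lborel)"
      using r v by (intro nn_integral_real_affine) auto
    also have "(\<integral>\<^sup>+u. w (0 + v / r v * u) * indicator {0..v} (0 + v / r v * u) \<partial>lborel)
        = (\<integral>\<^sup>+u. w (v / r v * u) * indicator {0..r v} u \<partial>lborel)"
    proof (rule nn_integral_cong)
      fix u :: real
      have "0 + v / r v * u \<in> {0..v} \<longleftrightarrow> u \<in> {0..r v}"
        using r v by (auto simp: field_simps zero_le_mult_iff)
      then show "w (0 + v / r v * u) * indicator {0..v} (0 + v / r v * u) = w (v / r v * u) * indicator {0..r v} u"
        by (simp add: indicator_def)
    qed
    finally have "ennreal (r v / v) * (\<integral>\<^sup>+y. w y * indicator {0..v} y \<partial>lborel)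
        = (ennreal (r v / v) * ennreal \<bar>v / r v\<bar>) * (\<integral>\<^sup>+u. w (v / r v * u) * indicator {0..r v} u \<partial>lborel)"
      by (simp only: mult.assoc)
    moreover have "ennreal (r v / v) * ennreal \<bar>v / r v\<bar> = 1"
      using r v by (simp flip: ennreal_mult)
    ultimately show ?thesis by simp
  qed
  finally show ?thesis .
qed

lemma measurable_\<psi>'_entry_cdf [measurable]: "(\<lambda>x. \<psi>' (entry_cdf x)) \<in> borel_measurable borel"
proof -
  have "continuous_on UNIV (\<lambda>s. \<psi>' (max 0 (min 1 s)))"
    by (rule continuous_on_compose2[OF continuous_\<psi>']) (auto intro!: continuous_intros)
  then have [measurable]: "(\<lambda>s. \<psi>' (max 0 (min 1 s))) \<in> borel_measurable borel"
    by (rule borel_measurable_continuous_onI)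
  have "(\<lambda>x. \<psi>' (max 0 (min 1 (entry_cdf x)))) \<in> borel_measurable borel"
    by (rule measurable_compose[OF measurable_entry_cdf]) measurable
  then show ?thesis using entry_cdf_bounds by (simp add: max_absorb2 min_absorb2)
qed

text \<open>Two substitutions, \<open>u = x / \<psi> x\<close> and then \<open>v = \<psi> x\<close>.
  At corresponding points \<open>pivot_cdf u = v\<close> and \<open>entry_cdf u = x\<close>, the
  derivative of the first substitution is \<open>r v / v\<close>, and the bias
  \<open>\<psi>' x\<close> is absorbed as the derivative of the second.\<close>

lemma nn_integral_change_of_level:
  assumes [measurable]: "f \<in> borel_measurable borel" and y: "0 < y" "y < 1"
  shows "(\<integral>\<^sup>+u. f (pivot_cdf u) * ennreal (\<psi>' (entry_cdf u)) * indicator {b y..1} u \<partial>lborel)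
    = (\<integral>\<^sup>+v. f v * ennreal (r v / v) * indicator {y..1} v \<partial>lborel)"
proof -
  define s where "s = \<theta> y"
  have s: "0 < s" "s < 1" "\<psi> s = y"
    using \<theta>_pos[of y] \<theta>_le_iff[of 1 y] y \<theta>_\<psi>[of 1] by (auto simp: s_def)
  have dq: "(\<psi> x - x * \<psi>' x) / (\<psi> x)\<^sup>2 = r (\<psi> x) / \<psi> x" if "s \<le> x" "x \<le> 1" for x
    using that s \<psi>_pos[of x] by (simp add: r_def power2_eq_square field_simps)
  have ivl: "{s..1} \<subseteq> {0..1}" "{s..1} \<subseteq> {0..2}" using s by auto
  have cont: "continuous_on {s..1} \<psi>" "continuous_on {s..1} \<psi>'"
    by (rule continuous_on_subset[OF continuous_\<psi> ivl(1)], rule continuous_on_subset[OF continuous_\<psi>' ivl(2)])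
  have pos: "\<psi> x \<noteq> 0" if "x \<in> {s..1}" for x using that s \<psi>_pos[of x] by auto
  have "(\<integral>\<^sup>+u. f (pivot_cdf u) * ennreal (\<psi>' (entry_cdf u)) * indicator {b y..1} u \<partial>lborel)
      = (\<integral>\<^sup>+u. f (pivot_cdf u) * ennreal (\<psi>' (entry_cdf u)) * indicator {s / \<psi> s..1 / \<psi> 1} u \<partial>lborel)"
    using s by (simp add: b_def s_def)
  also have "\<dots> = (\<integral>\<^sup>+x. f (pivot_cdf (x / \<psi> x)) * ennreal (\<psi>' (entry_cdf (x / \<psi> x)))
      * ennreal ((\<psi> x - x * \<psi>' x) / (\<psi> x)\<^sup>2) * indicator {s..1} x \<partial>lborel)"
  proof (rule nn_integral_substitution_aux[of "\<lambda>u. f (pivot_cdf u) * ennreal (\<psi>' (entry_cdf u))" s 1 "\<lambda>x. x / \<psi> x"])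
    show "(\<lambda>u. f (pivot_cdf u) * ennreal (\<psi>' (entry_cdf u))) \<in> borel_measurable borel" by measurable
    show "((\<lambda>x. x / \<psi> x) has_real_derivative (\<psi> x - x * \<psi>' x) / (\<psi> x)\<^sup>2) (at x)" if "x \<in> {s..1}" for x
      using that s by (intro Q_deriv) auto
    show "continuous_on {s..1} (\<lambda>x. (\<psi> x - x * \<psi>' x) / (\<psi> x)\<^sup>2)"
      using pos by (intro continuous_intros cont) auto
    show "(\<psi> x - x * \<psi>' x) / (\<psi> x)\<^sup>2 \<ge> 0" if "x \<in> {s..1}" for x
      using rems[of x] rem_ge_p2(2)[of x] p2_pos that s by simp
  qed (use s in auto)
  also have "\<dots> = (\<integral>\<^sup>+x. f (\<psi> x) * ennreal (r (\<psi> x) / \<psi> x) * ennreal (\<psi>' x) * indicator {s..1} x \<partial>lborel)"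
  proof (rule nn_integral_cong)
    fix x :: real
    show "f (pivot_cdf (x / \<psi> x)) * ennreal (\<psi>' (entry_cdf (x / \<psi> x)))
        * ennreal ((\<psi> x - x * \<psi>' x) / (\<psi> x)\<^sup>2) * indicator {s..1} x
        = f (\<psi> x) * ennreal (r (\<psi> x) / \<psi> x) * ennreal (\<psi>' x) * indicator {s..1} x"
    proof (cases "x \<in> {s..1}")
      case True
      then have x: "0 < x" "x \<le> 1" "s \<le> x" using s by auto
      have e: "x / \<psi> x = b (\<psi> x)" using x by (simp add: b_def)
      have yx: "0 < \<psi> x" "\<psi> x \<le> 1" using \<psi>_pos[of x] \<psi>_range[of x] x by auto
      have "pivot_cdf (x / \<psi> x) = \<psi> x" "entry_cdf (x / \<psi> x) = x"
        unfolding e using pivot_cdf_b[OF yx] entry_cdf_b[OF yx] x by auto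
      then show ?thesis using dq[OF x(3,2)] by (simp add: mult_ac)
    qed simp
  qed
  also have "\<dots> = (\<integral>\<^sup>+v. f v * ennreal (r v / v) * indicator {\<psi> s..\<psi> 1} v \<partial>lborel)"
  proof (rule nn_integral_substitution_aux[symmetric, of "\<lambda>v. f v * ennreal (r v / v)" s 1 \<psi> \<psi>'])
    show "(\<psi> has_real_derivative \<psi>' x) (at x)" if "x \<in> {s..1}" for x
      using that s by (intro \<psi>_deriv) auto
    show "\<psi>' x \<ge> 0" if "x \<in> {s..1}" for x using that s by (intro \<psi>'_nonneg) auto
  qed (use s cont in auto)
  finally show ?thesis using s by simp
qed

text \<open>Both sides are the joint law of the levels of a backbone vertex and its successor,
  tested with \<open>f\<close> and \<open>w\<close>. On the left the successor comes first, with
  level \<open>y\<close>, weight \<open>u\<close> and the bias \<open>\<psi>'\<close>. The level is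
  kept if \<open>u \<le> b y\<close>, which has weight
  \<open>b y * \<psi>' (\<theta> y) = 1 - r y\<close>; for larger \<open>u\<close> the level
  \<open>v\<close> of the predecessor has density \<open>r v / v\<close> above \<open>y\<close>. For
  fixed \<open>v\<close> these are the probability of staying and the density of a jump to a uniform
  point of \<open>[0, v]\<close>.\<close>

lemma nn_integral_two_levels:
  assumes [measurable]: "f \<in> borel_measurable borel" "w \<in> borel_measurable borel"
  shows "(\<integral>\<^sup>+y. w y * (\<integral>\<^sup>+u. f (pivot_cdf (max u (b y))) * ennreal (\<psi>' (entry_cdf (max u (b y)))) \<partial>unit_uniform) \<partial>unit_uniform)
    = (\<integral>\<^sup>+v. f v * (\<integral>\<^sup>+u. w (kernel_map v u) \<partial>unit_uniform) \<partial>unit_uniform)"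
proof -
  define h where "h u = f (pivot_cdf u) * ennreal (\<psi>' (entry_cdf u))" for u
  have [measurable]: "h \<in> borel_measurable borel" unfolding h_def[abs_def] by measurable
  define c where "c v = f v * ennreal (r v / v)" for v
  have [measurable]: "c \<in> borel_measurable borel" unfolding c_def[abs_def] by measurable
  have 1: "(\<integral>\<^sup>+u. h (max u (b y)) \<partial>unit_uniform)
      = ennreal (1 - r y) * f y + (\<integral>\<^sup>+v. c v * indicator {y..1} v \<partial>lborel)" if y: "0 < y" "y < 1" for y
  proof -
    have by1: "0 < b y" "b y \<le> 1" using b_bounds[of y] y by auto
    have "(\<integral>\<^sup>+u. h (max u (b y)) \<partial>unit_uniform) = (\<integral>\<^sup>+u. h (max u (b y)) * indicator {0..1} u \<partial>lborel)"
      by (rule nn_integral_unit_uniform) measurable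
    also have "\<dots> = (\<integral>\<^sup>+u. h (b y) * indicator {0..b y} u + h u * indicator {b y..1} u \<partial>lborel)"
      by (rule nn_integral_cong_AE, rule eventually_mono[OF AE_lborel_singleton[of "b y"]])
         (use by1 in \<open>auto simp: indicator_def max_def\<close>)
    also have "\<dots> = (\<integral>\<^sup>+u. h (b y) * indicator {0..b y} u \<partial>lborel) + (\<integral>\<^sup>+u. h u * indicator {b y..1} u \<partial>lborel)"
      by (rule nn_integral_add) measurable
    also have "(\<integral>\<^sup>+u. h (b y) * indicator {0..b y} u \<partial>lborel) = h (b y) * ennreal (b y)"
      using by1 by (subst nn_integral_cmult_indicator) auto
    also have "h (b y) * ennreal (b y) = ennreal (1 - r y) * f y"
    proof -
      have "h (b y) = f y * ennreal (\<psi>' (\<theta> y))"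
        unfolding h_def using y by (simp add: pivot_cdf_b entry_cdf_b)
      moreover have "\<psi>' (\<theta> y) * b y = 1 - r y" by (simp add: r_def b_def)
      moreover have "0 \<le> \<psi>' (\<theta> y)" using \<psi>'_nonneg \<theta>_range[of y] by auto
      ultimately show ?thesis using by1 by (simp add: mult_ac flip: ennreal_mult)
    qed
    also have "(\<integral>\<^sup>+u. h u * indicator {b y..1} u \<partial>lborel) = (\<integral>\<^sup>+v. c v * indicator {y..1} v \<partial>lborel)"
      unfolding h_def c_def by (rule nn_integral_change_of_level) (use y in auto)
    finally show ?thesis .
  qed
  have ev: "AE y in unit_uniform. 0 < y \<and> y < 1" by (rule AE_unit_uniform)
  have "(\<integral>\<^sup>+y. w y * (\<integral>\<^sup>+u. h (max u (b y)) \<partial>unit_uniform) \<partial>unit_uniform)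
      = (\<integral>\<^sup>+y. w y * (ennreal (1 - r y) * f y + (\<integral>\<^sup>+v. c v * indicator {y..1} v \<partial>lborel)) \<partial>unit_uniform)"
    by (rule nn_integral_cong_AE, rule eventually_mono[OF ev]) (simp add: 1)
  also have "\<dots> = (\<integral>\<^sup>+y. w y * ennreal (1 - r y) * f y * indicator {0..1} y
      + (\<integral>\<^sup>+v. w y * c v * indicator {y..1} v * indicator {0..1} y \<partial>lborel) \<partial>lborel)"
  proof -
    have [measurable]: "(\<lambda>y. \<integral>\<^sup>+v. c v * indicator {y..1} v \<partial>lborel) \<in> borel_measurable borel"
    proof (rule lborel.borel_measurable_nn_integral)
      have "(\<lambda>(y, v). c v * (if y \<le> v \<and> v \<le> 1 then 1 else 0)) \<in> borel_measurable (borel \<Otimes>\<^sub>M lborel)"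
        by measurable
      then show "(\<lambda>(y, v). c v * indicator {y..1} v) \<in> borel_measurable (borel \<Otimes>\<^sub>M lborel)"
        by (simp add: indicator_def)
    qed
    show ?thesis
      by (subst nn_integral_unit_uniform)
         (measurable, auto intro!: nn_integral_cong simp: indicator_def distrib_left mult.assoc nn_integral_cmult)
  qed
  also have "\<dots> = (\<integral>\<^sup>+y. w y * ennreal (1 - r y) * f y * indicator {0..1} y \<partial>lborel)
      + (\<integral>\<^sup>+y. \<integral>\<^sup>+v. w y * c v * indicator {y..1} v * indicator {0..1} y \<partial>lborel \<partial>lborel)"
  proof (rule nn_integral_add)
    show "(\<lambda>y. w y * ennreal (1 - r y) * f y * indicator {0..1} y) \<in> borel_measurable lborel" by measurable
    have "(\<lambda>(y, v). w y * c v * (if y \<le> v \<and> v \<le> 1 then 1 else 0) * indicator {0..1} y) \<in> borel_measurable (borel \<Otimes>\<^sub>M borel)"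
      by measurable
    then have "(\<lambda>(y, v). w y * c v * indicator {y..1} v * indicator {0..1} y) \<in> borel_measurable (lborel \<Otimes>\<^sub>M lborel)"
      by (simp add: indicator_def cong: measurable_cong_sets sets_pair_measure_cong)
    then show "(\<lambda>y. \<integral>\<^sup>+v. w y * c v * indicator {y..1} v * indicator {0..1} y \<partial>lborel) \<in> borel_measurable lborel"
      by (rule lborel.borel_measurable_nn_integral)
  qed
  also have "(\<integral>\<^sup>+y. \<integral>\<^sup>+v. w y * c v * indicator {y..1} v * indicator {0..1} y \<partial>lborel \<partial>lborel)
      = (\<integral>\<^sup>+v. \<integral>\<^sup>+y. w y * c v * indicator {y..1} v * indicator {0..1} y \<partial>lborel \<partial>lborel)"
  proof -
    have "(\<lambda>(v, y). w y * c v * (if y \<le> v \<and> v \<le> 1 then 1 else 0) * indicator {0..1} y) \<in> borel_measurable (borel \<Otimes>\<^sub>M borel)"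
      by measurable
    then have "(\<lambda>(v, y). w y * c v * indicator {y..1} v * indicator {0..1} y) \<in> borel_measurable (lborel \<Otimes>\<^sub>M lborel)"
      by (simp add: indicator_def cong: measurable_cong_sets sets_pair_measure_cong)
    then show ?thesis by (rule lborel_pair.Fubini')
  qed
  also have "\<dots> = (\<integral>\<^sup>+v. c v * (\<integral>\<^sup>+y. w y * indicator {0..v} y \<partial>lborel) * indicator {0..1} v \<partial>lborel)"
  proof (rule nn_integral_cong)
    fix v :: real
    have "(\<integral>\<^sup>+y. w y * c v * indicator {y..1} v * indicator {0..1} y \<partial>lborel)
        = (\<integral>\<^sup>+y. (c v * indicator {0..1} v) * (w y * indicator {0..v} y) \<partial>lborel)"
      by (intro nn_integral_cong) (auto simp: indicator_def mult_ac)
    also have "\<dots> = (c v * indicator {0..1} v) * (\<integral>\<^sup>+y. w y * indicator {0..v} y \<partial>lborel)"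
      by (rule nn_integral_cmult) measurable
    finally show "(\<integral>\<^sup>+y. w y * c v * indicator {y..1} v * indicator {0..1} y \<partial>lborel)
        = c v * (\<integral>\<^sup>+y. w y * indicator {0..v} y \<partial>lborel) * indicator {0..1} v" by (simp add: mult_ac)
  qed
  also have "(\<integral>\<^sup>+y. w y * ennreal (1 - r y) * f y * indicator {0..1} y \<partial>lborel)
      + (\<integral>\<^sup>+v. c v * (\<integral>\<^sup>+y. w y * indicator {0..v} y \<partial>lborel) * indicator {0..1} v \<partial>lborel)
      = (\<integral>\<^sup>+v. f v * (ennreal (1 - r v) * w v + ennreal (r v / v) * (\<integral>\<^sup>+y. w y * indicator {0..v} y \<partial>lborel)) \<partial>unit_uniform)"
  proof -
    have [measurable]: "(\<lambda>v. \<integral>\<^sup>+y. w y * indicator {0..v} y \<partial>lborel) \<in> borel_measurable borel"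
    proof (rule lborel.borel_measurable_nn_integral)
      have "(\<lambda>(v, y). w y * (if 0 \<le> y \<and> y \<le> v then 1 else 0)) \<in> borel_measurable (borel \<Otimes>\<^sub>M lborel)"
        by measurable
      then show "(\<lambda>(v, y). w y * indicator {0..v} y) \<in> borel_measurable (borel \<Otimes>\<^sub>M lborel)"
        by (simp add: indicator_def)
    qed
    show ?thesis
      by (subst nn_integral_unit_uniform, measurable, subst nn_integral_add[symmetric], measurable)
         (auto intro!: nn_integral_cong simp: indicator_def distrib_left mult_ac c_def)
  qed
  also have "\<dots> = (\<integral>\<^sup>+v. f v * (\<integral>\<^sup>+u. w (kernel_map v u) \<partial>unit_uniform) \<partial>unit_uniform)"
    by (rule nn_integral_cong_AE, rule eventually_mono[OF ev]) (simp add: nn_integral_kernel_map)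
  finally show ?thesis by (simp only: h_def)
qed

section \<open>Finite-dimensional laws of the driven chain and of the levels\<close>

abbreviation uniform_seq :: "(nat \<Rightarrow> real) measure" where
  "uniform_seq \<equiv> PiM UNIV (\<lambda>_. unit_uniform)"

sublocale useq: sequence_space unit_uniform ..

text \<open>The expectation of the product of the \<open>g i\<close> along the Markov chain started
  at \<open>y\<close>, unfolded by the Markov property. With indicators for the \<open>g i\<close>
  such products give all cylinder probabilities.\<close>

fun chain_moment :: "nat \<Rightarrow> (nat \<Rightarrow> real \<Rightarrow> ennreal) \<Rightarrow> real \<Rightarrow> ennreal" where
  "chain_moment 0 g y = g 0 y"
| "chain_moment (Suc n) g y = g 0 y * (\<integral>\<^sup>+v. chain_moment n (\<lambda>i. g (Suc i)) (kernel_map y v) \<partial>unit_uniform)"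

lemma measurable_unit_uniform_pair:
  "f \<in> measurable (N \<Otimes>\<^sub>M borel) K \<Longrightarrow> f \<in> measurable (N \<Otimes>\<^sub>M unit_uniform) K"
  by (simp cong: measurable_cong_sets sets_pair_measure_cong)

lemma measurable_kernel_moment:
  assumes [measurable]: "w \<in> borel_measurable borel"
  shows "(\<lambda>y. \<integral>\<^sup>+v. w (kernel_map y v) \<partial>unit_uniform) \<in> borel_measurable borel"
proof (rule U.borel_measurable_nn_integral)
  have "(\<lambda>z. w (case z of (y, v) \<Rightarrow> kernel_map y v)) \<in> borel_measurable (borel \<Otimes>\<^sub>M borel)"
    by (rule measurable_compose[OF measurable_kernel_map]) simp
  then show "(\<lambda>(y, v). w (kernel_map y v)) \<in> borel_measurable (borel \<Otimes>\<^sub>M unit_uniform)"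
    by (intro measurable_unit_uniform_pair) (simp add: case_prod_beta)
qed

lemma measurable_chain_moment:
  "(\<And>i. g i \<in> borel_measurable borel) \<Longrightarrow> chain_moment n g \<in> borel_measurable borel"
proof (induction n arbitrary: g)
  case (Suc n)
  have "(\<lambda>y. \<integral>\<^sup>+v. chain_moment n (\<lambda>i. g (Suc i)) (kernel_map y v) \<partial>unit_uniform) \<in> borel_measurable borel"
    by (intro measurable_kernel_moment Suc)
  then have "(\<lambda>y. g 0 y * (\<integral>\<^sup>+v. chain_moment n (\<lambda>i. g (Suc i)) (kernel_map y v) \<partial>unit_uniform)) \<in> borel_measurable borel"
    by (intro borel_measurable_times_ennreal Suc.prems)
  then show ?case by simp
next
  case 0
  have "chain_moment 0 g = g 0" by (rule ext) simp
  then show ?case using 0 by simp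
qed

lemma measurable_coordinate_useq [measurable]: "(\<lambda>u. u i) \<in> borel_measurable uniform_seq"
proof -
  have "(\<lambda>u. u i) \<in> measurable uniform_seq unit_uniform" by (rule measurable_component_singleton) simp
  then show ?thesis by (simp cong: measurable_cong_sets)
qed

lemma measurable_kernel_map_compose:
  assumes "f \<in> borel_measurable N" "g \<in> borel_measurable N"
  shows "(\<lambda>x. kernel_map (f x) (g x)) \<in> borel_measurable N"
  using measurable_compose[OF measurable_Pair[OF assms] measurable_kernel_map] by simp

lemma measurable_chain: "(\<lambda>u. chain y u n) \<in> borel_measurable uniform_seq"
  by (induction n) (auto simp: chain_Suc simp del: chain.simps(2) intro!: measurable_kernel_map_compose measurable_coordinate_useq)

lemma measurable_driven_chain: "(\<lambda>u. driven_chain u n) \<in> borel_measurable uniform_seq"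
  by (induction n) (auto simp: driven_chain_simps intro!: measurable_kernel_map_compose measurable_coordinate_useq)

lemma nn_integral_useq:
  assumes [measurable]: "F \<in> borel_measurable uniform_seq"
  shows "(\<integral>\<^sup>+u. F u \<partial>uniform_seq) = (\<integral>\<^sup>+v. \<integral>\<^sup>+u. F (case_nat v u) \<partial>uniform_seq \<partial>unit_uniform)"
proof -
  have m: "(\<lambda>(v, u). case_nat v u) \<in> measurable (unit_uniform \<Otimes>\<^sub>M uniform_seq) uniform_seq" by measurable
  have "(\<integral>\<^sup>+u. F u \<partial>uniform_seq) = (\<integral>\<^sup>+z. F ((\<lambda>(v, u). case_nat v u) z) \<partial>(unit_uniform \<Otimes>\<^sub>M uniform_seq))"
    by (subst (1) useq.PiM_iter[symmetric]) (rule nn_integral_distr[OF m], simp)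
  also have "\<dots> = (\<integral>\<^sup>+v. \<integral>\<^sup>+u. F (case_nat v u) \<partial>uniform_seq \<partial>unit_uniform)"
    by (subst useq.nn_integral_fst[symmetric]) (use measurable_compose[OF m assms] in simp_all)
  finally show ?thesis .
qed

lemma nn_integral_chain:
  assumes "\<And>i. g i \<in> borel_measurable borel"
  shows "(\<integral>\<^sup>+u. (\<Prod>i\<le>n. g i (chain y u i)) \<partial>uniform_seq) = chain_moment n g y"
  using assms
proof (induction n arbitrary: y g)
  case 0
  then show ?case by (simp add: useq.emeasure_space_1)
next
  case (Suc n)
  note [measurable] = Suc.prems
  have m: "(\<lambda>u. \<Prod>i\<le>k. h i (chain y u i)) \<in> borel_measurable uniform_seq"
    if "\<And>i. h i \<in> borel_measurable borel" for h :: "nat \<Rightarrow> real \<Rightarrow> ennreal" and y k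
    by (intro borel_measurable_prod_ennreal measurable_compose[OF measurable_chain that])
  have "(\<integral>\<^sup>+u. (\<Prod>i\<le>Suc n. g i (chain y u i)) \<partial>uniform_seq)
      = (\<integral>\<^sup>+v. \<integral>\<^sup>+u. (\<Prod>i\<le>Suc n. g i (chain y (case_nat v u) i)) \<partial>uniform_seq \<partial>unit_uniform)"
    by (rule nn_integral_useq) (rule m, rule Suc.prems)
  also have "\<dots> = (\<integral>\<^sup>+v. \<integral>\<^sup>+u. g 0 y * (\<Prod>i\<le>n. g (Suc i) (chain (kernel_map y v) u i)) \<partial>uniform_seq \<partial>unit_uniform)"
    by (simp add: prod.atMost_Suc_shift del: prod.atMost_Suc)
  also have "\<dots> = (\<integral>\<^sup>+v. g 0 y * chain_moment n (\<lambda>i. g (Suc i)) (kernel_map y v) \<partial>unit_uniform)"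
  proof (rule nn_integral_cong)
    fix v
    have "(\<integral>\<^sup>+u. g 0 y * (\<Prod>i\<le>n. g (Suc i) (chain (kernel_map y v) u i)) \<partial>uniform_seq)
        = g 0 y * (\<integral>\<^sup>+u. (\<Prod>i\<le>n. g (Suc i) (chain (kernel_map y v) u i)) \<partial>uniform_seq)"
      by (rule nn_integral_cmult) (rule m[of "\<lambda>i. g (Suc i)"], rule Suc.prems)
    then show "(\<integral>\<^sup>+u. g 0 y * (\<Prod>i\<le>n. g (Suc i) (chain (kernel_map y v) u i)) \<partial>uniform_seq)
        = g 0 y * chain_moment n (\<lambda>i. g (Suc i)) (kernel_map y v)"
      using Suc.IH[of "\<lambda>i. g (Suc i)" "kernel_map y v"] Suc.prems by simp
  qed
  also have "\<dots> = chain_moment (Suc n) g y"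
  proof -
    have "(\<lambda>v. chain_moment n (\<lambda>i. g (Suc i)) (kernel_map y v)) \<in> borel_measurable borel"
      by (rule measurable_compose[OF _ measurable_chain_moment])
         (auto intro!: measurable_kernel_map_compose Suc.prems)
    then have "(\<lambda>v. chain_moment n (\<lambda>i. g (Suc i)) (kernel_map y v)) \<in> borel_measurable unit_uniform"
      by (simp cong: measurable_cong_sets)
    then show ?thesis by (simp add: nn_integral_cmult)
  qed
  finally show ?case .
qed

lemma nn_integral_driven_chain:
  assumes "\<And>i. g i \<in> borel_measurable borel"
  shows "(\<integral>\<^sup>+u. (\<Prod>i\<le>n. g i (driven_chain u i)) \<partial>uniform_seq) = (\<integral>\<^sup>+y. chain_moment n g y \<partial>unit_uniform)"
proof -
  have "(\<lambda>u. \<Prod>i\<le>n. g i (driven_chain u i)) \<in> borel_measurable uniform_seq"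
    by (intro borel_measurable_prod_ennreal measurable_compose[OF measurable_driven_chain assms])
  from nn_integral_useq[OF this] show ?thesis
    by (simp add: driven_chain_def nn_integral_chain[OF assms])
qed

lemma best_node: "best (node d u1 f) = best (node d u2 f)"
  unfolding best_def by (simp add: root_pivot_node[of d u1 f u2])

lemma level_node: "level ((advance ^^ i) (node d u1 f)) = level ((advance ^^ i) (node d u2 f))"
proof (cases i)
  case 0
  then show ?thesis by (simp add: level_def root_pivot_node[of d u1 f u2])
next
  case (Suc j)
  have "advance (node d u1 f) = advance (node d u2 f)" by (simp add: advance_def best_node[of d u1 f u2])
  then show ?thesis by (simp only: Suc funpow_Suc_right comp_def)
qed

text \<open>A factor that depends only on the starting point can be merged with the first test
  function and taken out again; the induction for the levels uses this.\<close>

lemma chain_moment_mult: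
  "chain_moment n (\<lambda>i. if i = 0 then (\<lambda>y. h y * g 0 y) else g i) y = h y * chain_moment n g y"
  by (cases n) (simp_all add: mult.assoc)

text \<open>Induction on the number of steps, moving the root to the next backbone vertex. By
  \<open>nn_integral_advance\<close> the subtree there becomes a fresh tree with a bias; integrating
  out its root weight leaves a function \<open>J\<close> of its level only, which is merged with the
  next test function before the induction hypothesis applies.\<close>

lemma nn_integral_levels:
  assumes "\<And>i. g i \<in> borel_measurable borel"
  shows "(\<integral>\<^sup>+\<omega>. (\<Prod>i\<le>n. g i (level ((advance ^^ i) \<omega>))) \<partial>GW) = (\<integral>\<^sup>+y. chain_moment n g y \<partial>unit_uniform)"
  using assms
proof (induction n arbitrary: g)
  case 0
  then show ?case by (simp add: nn_integral_level)
next
  case (Suc n)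
  note g [measurable] = Suc.prems
  define T where "T \<omega> = (\<Prod>i\<le>n. g (Suc i) (level ((advance ^^ i) \<omega>)))" for \<omega>
  have level_i [measurable]: "(\<lambda>\<omega>. level ((advance ^^ i) \<omega>)) \<in> borel_measurable GW" for i
    by (rule measurable_compose[OF measurable_advance_pow measurable_level])
  have T [measurable]: "T \<in> borel_measurable GW"
    unfolding T_def[abs_def] by (intro borel_measurable_prod_ennreal measurable_compose[OF level_i g])
  define h where "h x = g 0 (pivot_cdf x) * ennreal (\<psi>' (entry_cdf x))" for x
  have h [measurable]: "h \<in> borel_measurable borel" unfolding h_def[abs_def] by measurable
  define J where "J y = (\<integral>\<^sup>+u. h (max u (b y)) \<partial>unit_uniform)" for y
  have J [measurable]: "J \<in> borel_measurable borel"
    unfolding J_def[abs_def]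
    by (intro U.borel_measurable_nn_integral measurable_unit_uniform_pair) measurable
  have "(\<integral>\<^sup>+\<omega>. (\<Prod>i\<le>Suc n. g i (level ((advance ^^ i) \<omega>))) \<partial>GW)
      = (\<integral>\<^sup>+\<omega>. g 0 (pivot_cdf (root_pivot \<omega>)) * T (advance \<omega>) \<partial>GW)"
    by (simp add: prod.atMost_Suc_shift level_def T_def funpow_Suc_right del: prod.atMost_Suc funpow.simps)
  also have "\<dots> = (\<integral>\<^sup>+\<omega>. g 0 (pivot_cdf (entry \<omega>)) * T \<omega> * ennreal (\<psi>' (entry_cdf (entry \<omega>))) \<partial>GW)"
    by (rule nn_integral_advance[of "\<lambda>x \<omega>. g 0 (pivot_cdf x) * T \<omega>"]) measurable
  also have "\<dots> = (\<integral>\<^sup>+\<omega>. h (max (weight \<omega> []) (root_pivot \<omega>)) * T \<omega> \<partial>GW)"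
    by (simp add: h_def entry_def mult_ac)
  also have "\<dots> = (\<integral>\<^sup>+\<omega>. \<integral>\<^sup>+u. h (max u (root_pivot \<omega>)) * T \<omega> \<partial>unit_uniform \<partial>GW)"
  proof (rule nn_integral_root_weight[of "\<lambda>u \<omega>. h (max u (root_pivot \<omega>)) * T \<omega>"])
    show "(\<lambda>(u, \<omega>). h (max u (root_pivot \<omega>)) * T \<omega>) \<in> borel_measurable (borel \<Otimes>\<^sub>M GW)" by measurable
    show "h (max u (root_pivot (node d u1 f))) * T (node d u1 f) = h (max u (root_pivot (node d u2 f))) * T (node d u2 f)"
      for u d u1 u2 f
      unfolding T_def by (simp only: root_pivot_node[of d u1 f u2] level_node[of _ d u1 f u2])
  qed
  also have "\<dots> = (\<integral>\<^sup>+\<omega>. J (level \<omega>) * T \<omega> \<partial>GW)"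
  proof (rule nn_integral_cong_AE, rule eventually_mono[OF AE_level])
    fix \<omega> assume "0 < level \<omega> \<and> level \<omega> \<le> 1 \<and> root_pivot \<omega> = b (level \<omega>)"
    then have e: "root_pivot \<omega> = b (level \<omega>)" by simp
    have "(\<lambda>u. h (max u (b (level \<omega>)))) \<in> borel_measurable borel" by measurable
    then have "(\<lambda>u. h (max u (b (level \<omega>)))) \<in> borel_measurable unit_uniform" by (simp cong: measurable_cong_sets)
    then show "(\<integral>\<^sup>+u. h (max u (root_pivot \<omega>)) * T \<omega> \<partial>unit_uniform) = J (level \<omega>) * T \<omega>"
      unfolding e J_def by (rule nn_integral_multc)
  qed
  also have "\<dots> = (\<integral>\<^sup>+\<omega>. (\<Prod>i\<le>n. (if i = 0 then (\<lambda>y. J y * g (Suc 0) y) else g (Suc i)) (level ((advance ^^ i) \<omega>))) \<partial>GW)"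
  proof (rule nn_integral_cong)
    fix \<omega>
    have "{..n} = insert 0 {1..n}" by auto
    then show "J (level \<omega>) * T \<omega> = (\<Prod>i\<le>n. (if i = 0 then (\<lambda>y. J y * g (Suc 0) y) else g (Suc i)) (level ((advance ^^ i) \<omega>)))"
      unfolding T_def by (simp add: mult.assoc)
  qed
  also have "\<dots> = (\<integral>\<^sup>+y. chain_moment n (\<lambda>i. if i = 0 then (\<lambda>y. J y * g (Suc 0) y) else g (Suc i)) y \<partial>unit_uniform)"
    by (rule Suc.IH) simp
  also have "\<dots> = (\<integral>\<^sup>+y. chain_moment n (\<lambda>i. g (Suc i)) y * J y \<partial>unit_uniform)"
    using chain_moment_mult[of n J "\<lambda>i. g (Suc i)"] by (simp add: mult.commute)
  also have "\<dots> = (\<integral>\<^sup>+v. g 0 v * (\<integral>\<^sup>+u. chain_moment n (\<lambda>i. g (Suc i)) (kernel_map v u) \<partial>unit_uniform) \<partial>unit_uniform)"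
    unfolding J_def h_def by (rule nn_integral_two_levels) (simp_all add: g measurable_chain_moment)
  finally show ?case by simp
qed

lemma distr_levels:
  "distr GW (PiM UNIV (\<lambda>_. borel)) (\<lambda>\<omega> n. level ((advance ^^ n) \<omega>))
    = distr uniform_seq (PiM UNIV (\<lambda>_. borel)) driven_chain" (is "?L = ?R")
  and measurable_levels: "(\<lambda>\<omega> n. level ((advance ^^ n) \<omega>)) \<in> measurable GW (PiM UNIV (\<lambda>_. borel))"
  and measurable_driven_chain_seq: "driven_chain \<in> measurable uniform_seq (PiM UNIV (\<lambda>_. borel))"
proof -
  show m1: "(\<lambda>\<omega> n. level ((advance ^^ n) \<omega>)) \<in> measurable GW (PiM UNIV (\<lambda>_. borel))"
    by (rule measurable_PiM_single'[of UNIV "\<lambda>n \<omega>. level ((advance ^^ n) \<omega>)"])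
       (auto intro: measurable_compose[OF measurable_advance_pow measurable_level])
  show m2: "driven_chain \<in> measurable uniform_seq (PiM UNIV (\<lambda>_. borel))"
    by (rule measurable_PiM_single'[of UNIV "\<lambda>n u. driven_chain u n", simplified])
       (auto intro: measurable_driven_chain)
  interpret L: prob_space ?L by (rule GW.prob_space_distr[OF m1])
  show "?L = ?R"
  proof (rule measure_eqI_PiM_infinite)
    fix A and J :: "nat set"
    assume J: "finite J" and A: "\<And>i. i \<in> J \<Longrightarrow> A i \<in> sets (borel :: real measure)"
    \<comment> \<open>Indices outside \<open>J\<close> get the constant test function 1, so that the
      product can run over an initial segment.\<close>
    define g where "g i = (if i \<in> J then indicator (A i) else (\<lambda>_. 1) :: real \<Rightarrow> ennreal)" for i
    have g: "g i \<in> borel_measurable borel" for i using A by (auto simp: g_def)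
    define n where "n = Max (insert 0 J)"
    have n: "J \<subseteq> {..n}" using J by (auto simp: n_def)
    let ?E = "prod_emb UNIV (\<lambda>_. borel) J (Pi\<^sub>E J A)"
    have E: "?E \<in> sets (PiM UNIV (\<lambda>_. borel))" using J A by (intro sets_PiM_I) auto
    have ind: "indicator ?E x = (\<Prod>i\<le>n. g i (x i))" for x :: "nat \<Rightarrow> real"
    proof -
      have "(\<Prod>i\<le>n. g i (x i)) = (\<Prod>i\<in>J. g i (x i))"
        using n by (intro prod.mono_neutral_right) (auto simp: g_def)
      also have "\<dots> = (\<Prod>i\<in>J. indicator (A i) (x i))"
        by (intro prod.cong refl) (simp add: g_def)
      also have "\<dots> = indicator ?E x"
      proof (cases "\<forall>i\<in>J. x i \<in> A i")
        case True
        then show ?thesis by (auto simp: prod_emb_iff PiE_iff)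
      next
        case False
        then obtain i where "i \<in> J" "x i \<notin> A i" by auto
        then have "(\<Prod>i\<in>J. indicator (A i) (x i)) = (0::ennreal)"
          using J by (intro prod_zero bexI[of _ i]) simp_all
        moreover have "x \<notin> ?E" using \<open>i \<in> J\<close> \<open>x i \<notin> A i\<close> by (auto simp: prod_emb_iff PiE_iff)
        ultimately show ?thesis by simp
      qed
      finally show ?thesis ..
    qed
    have "emeasure ?L ?E = (\<integral>\<^sup>+\<omega>. indicator ?E (\<lambda>n. level ((advance ^^ n) \<omega>)) \<partial>GW)"
    proof -
      have "emeasure ?L ?E = (\<integral>\<^sup>+x. indicator ?E x \<partial>?L)" using E by simp
      also have "\<dots> = (\<integral>\<^sup>+\<omega>. indicator ?E (\<lambda>n. level ((advance ^^ n) \<omega>)) \<partial>GW)"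
        by (rule nn_integral_distr[OF m1]) (use E in simp)
      finally show ?thesis .
    qed
    also have "\<dots> = (\<integral>\<^sup>+u. indicator ?E (driven_chain u) \<partial>uniform_seq)"
      unfolding ind by (simp only: nn_integral_levels[OF g] nn_integral_driven_chain[OF g])
    also have "\<dots> = emeasure ?R ?E"
    proof -
      have "emeasure ?R ?E = (\<integral>\<^sup>+x. indicator ?E x \<partial>?R)" using E by simp
      also have "\<dots> = (\<integral>\<^sup>+u. indicator ?E (driven_chain u) \<partial>uniform_seq)"
        by (rule nn_integral_distr[OF m2]) (use E in simp)
      finally show ?thesis by simp
    qed
    finally show "emeasure ?L ?E = emeasure ?R ?E" .
  qed (simp_all add: L.finite_measure_axioms)
qed

end

section \<open>The lower envelope of a locally finite configuration\<close>

text \<open>Local finiteness together with points arbitrarily close to the axis on its right makes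
  the minimum over \<open>[0, t]\<close> exist for all \<open>t > 0\<close>. Points in all grid
  strips make \<open>lowest\<close> a genuine minimum there. The strip with \<open>i = 0\<close>
  lies to the left of the axis; its lowest point supplies the starting value of the chain.\<close>

definition good_config :: "(real \<times> real) set \<Rightarrow> bool" where
  "good_config S \<longleftrightarrow>
     (\<forall>p\<in>S. snd p > 0) \<and>
     (\<forall>m::nat. finite (S \<inter> {- real m..real m} \<times> {0<..real m})) \<and>
     (\<forall>j::nat. \<exists>p\<in>S. 0 < fst p \<and> fst p \<le> 1 / real (Suc j)) \<and>
     (\<forall>p\<in>S. fst p \<noteq> 0) \<and>
     (\<forall>k i. \<exists>p\<in>S. (real i - 1) / real (Suc k) < fst p \<and> fst p \<le> real i / real (Suc k))"

definition lowest :: "(real \<times> real) set \<Rightarrow> real \<Rightarrow> real \<Rightarrow> real" where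
  "lowest S a b = Inf {y. \<exists>x. a < x \<and> x \<le> b \<and> (x, y) \<in> S}"

text \<open>On this scale the height of the lowest point in a strip of width \<open>1 / k\<close> is uniform.\<close>

definition strip_uniform :: "(real \<times> real) set \<Rightarrow> nat \<Rightarrow> nat \<Rightarrow> real" where
  "strip_uniform S k i = 1 - exp (- (lowest S ((real i - 1) / real k) (real i / real k) / real k))"

text \<open>Multiplied by \<open>k\<close>, the uniform variable of a strip never exceeds the height
  of the lowest point and falls short of it by a term of order \<open>1 / k\<close>.\<close>

lemma one_minus_exp_bounds:
  fixes z :: real
  assumes "z \<ge> 0"
  shows "1 - exp (- z) \<le> z" "z - z\<^sup>2 / 2 \<le> 1 - exp (- z)"
proof -
  show "1 - exp (- z) \<le> z" using exp_ge_add_one_self[of "- z"] by simp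
  define h where "h t = 1 - exp (- t) - t + t\<^sup>2 / 2" for t :: real
  have "h 0 \<le> h z"
  proof (rule DERIV_nonneg_imp_nondecreasing[OF assms])
    fix x :: real assume "0 \<le> x" "x \<le> z"
    have "(h has_real_derivative (exp (- x) - 1 + x)) (at x)"
      unfolding h_def by (auto intro!: derivative_eq_intros)
    moreover have "exp (- x) - 1 + x \<ge> 0" using exp_ge_add_one_self[of "- x"] by simp
    ultimately show "\<exists>y. (h has_real_derivative y) (at x) \<and> y \<ge> 0" by blast
  qed
  then show "z - z\<^sup>2 / 2 \<le> 1 - exp (- z)" by (simp add: h_def)
qed

context
  fixes S :: "(real \<times> real) set"
  assumes good: "good_config S"
begin

lemma good_configD:
  "\<forall>p\<in>S. snd p > 0"
  "finite (S \<inter> {- real m..real m} \<times> {0<..real m})"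
  "\<exists>p\<in>S. 0 < fst p \<and> fst p \<le> 1 / real (Suc j)"
  "\<forall>p\<in>S. fst p \<noteq> 0"
  "\<exists>p\<in>S. (real i - 1) / real (Suc k) < fst p \<and> fst p \<le> real i / real (Suc k)"
  using good unfolding good_config_def by blast+

lemma config_pos: "(x, y) \<in> S \<Longrightarrow> y > 0"
  using good_configD(1) by force

lemma config_nonzero: "(0, y) \<notin> S"
  using good_configD(4) by force

lemma config_finite: "finite (S \<inter> {a..b} \<times> {..c})"
proof -
  obtain m :: nat where m: "real m \<ge> max (max (- a) b) c" using real_arch_simple by blast
  have "S \<inter> {a..b} \<times> {..c} \<subseteq> S \<inter> {- real m..real m} \<times> {0<..real m}"
    using m config_pos by auto
  then show ?thesis by (rule finite_subset[OF _ good_configD(2)])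
qed

text \<open>Only points up to the height \<open>y0\<close> of the given one compete, and these are
  finitely many.\<close>

lemma config_lowest_point:
  assumes "(x0, y0) \<in> S" "x0 \<in> I" "I \<subseteq> {a..b}"
  obtains x y where "(x, y) \<in> S" "x \<in> I" "\<And>x' y'. (x', y') \<in> S \<Longrightarrow> x' \<in> I \<Longrightarrow> y \<le> y'"
proof -
  define F where "F = snd ` (S \<inter> I \<times> {..y0})"
  have "S \<inter> I \<times> {..y0} \<subseteq> S \<inter> {a..b} \<times> {..y0}" using assms by auto
  then have fin: "finite F" unfolding F_def by (intro finite_imageI finite_subset[OF _ config_finite])
  have ne: "y0 \<in> F" using assms by (force simp: F_def)
  then have "Min F \<in> F" using fin by (intro Min_in) auto
  then obtain x where x: "(x, Min F) \<in> S" "x \<in> I" by (auto simp: F_def)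
  have "Min F \<le> y'" if "(x', y') \<in> S" "x' \<in> I" for x' y'
  proof (cases "y' \<le> y0")
    case True
    then have "y' \<in> F" using that by (force simp: F_def)
    then show ?thesis using fin by simp
  next
    case False
    then show ?thesis using Min_le[OF fin ne] by simp
  qed
  then show thesis using that x by blast
qed

lemma lower_envelope_point:
  assumes "t > 0"
  obtains x where "(x, lower_envelope S t) \<in> S" "0 < x" "x \<le> t"
    "\<And>x' y'. (x', y') \<in> S \<Longrightarrow> 0 \<le> x' \<Longrightarrow> x' \<le> t \<Longrightarrow> lower_envelope S t \<le> y'"
proof -
  obtain j :: nat where j: "1 / real (Suc j) < t" using assms reals_Archimedean by (auto simp: inverse_eq_divide)
  obtain p where "p \<in> S" "0 < fst p" "fst p \<le> 1 / real (Suc j)"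
    using good_configD(3) by blast
  then have p: "(fst p, snd p) \<in> S" "fst p \<in> {0..t}" using j by auto
  obtain x y where xy: "(x, y) \<in> S" "x \<in> {0..t}" "\<And>x' y'. (x', y') \<in> S \<Longrightarrow> x' \<in> {0..t} \<Longrightarrow> y \<le> y'"
    using config_lowest_point[OF p(1,2) order_refl] by blast
  have eq: "lower_envelope S t = y"
    unfolding lower_envelope_def by (rule Least_equality) (use xy config_pos in auto)
  have "x \<noteq> 0" using xy(1) config_nonzero by auto
  then show thesis using that[of x] xy eq by auto
qed

lemma lower_envelope_pos: "t > 0 \<Longrightarrow> lower_envelope S t > 0"
  by (erule lower_envelope_point) (rule config_pos)

lemma lower_envelope_le: "t > 0 \<Longrightarrow> (x, y) \<in> S \<Longrightarrow> 0 \<le> x \<Longrightarrow> x \<le> t \<Longrightarrow> lower_envelope S t \<le> y"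
  by (erule lower_envelope_point)

lemma lower_envelope_antimono:
  assumes "0 < s" "s \<le> t"
  shows "lower_envelope S t \<le> lower_envelope S s"
proof -
  obtain x where "(x, lower_envelope S s) \<in> S" "0 < x" "x \<le> s"
    using lower_envelope_point[OF assms(1)] .
  then show ?thesis using assms by (intro lower_envelope_le[of t x]) auto
qed

section \<open>Lowest points of the strips and the variables they define\<close>

lemma lowest_point:
  assumes "(x0, y0) \<in> S" "a < x0" "x0 \<le> b"
  shows "\<exists>x. a < x \<and> x \<le> b \<and> (x, lowest S a b) \<in> S"
    and "\<And>x y. (x, y) \<in> S \<Longrightarrow> a < x \<Longrightarrow> x \<le> b \<Longrightarrow> lowest S a b \<le> y"
proof -
  obtain x y where xy: "(x, y) \<in> S" "x \<in> {a<..b}" "\<And>x' y'. (x', y') \<in> S \<Longrightarrow> x' \<in> {a<..b} \<Longrightarrow> y \<le> y'"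
  proof (rule config_lowest_point)
    show "x0 \<in> {a<..b}" "{a<..b} \<subseteq> {a..b}" using assms by auto
  qed (use assms in auto)
  have "lowest S a b = y"
    unfolding lowest_def by (rule cInf_eq_minimum) (use xy in auto)
  then show "\<exists>x. a < x \<and> x \<le> b \<and> (x, lowest S a b) \<in> S"
    "\<And>x y. (x, y) \<in> S \<Longrightarrow> a < x \<Longrightarrow> x \<le> b \<Longrightarrow> lowest S a b \<le> y"
    using xy by auto
qed

lemma strip_point:
  assumes "k \<ge> 1"
  obtains x y where "(x, y) \<in> S" "(real i - 1) / real k < x" "x \<le> real i / real k"
proof -
  obtain k' where "k = Suc k'" using assms by (cases k) auto
  moreover obtain p where "p \<in> S" "(real i - 1) / real (Suc k') < fst p" "fst p \<le> real i / real (Suc k')"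
    using good_configD(5) by blast
  ultimately show thesis using that[of "fst p" "snd p"] by simp
qed

lemma strip_uniform_bounds:
  assumes "k \<ge> 1"
  shows "0 < strip_uniform S k i" "strip_uniform S k i < 1"
proof -
  obtain x0 y0 where p: "(x0, y0) \<in> S" "(real i - 1) / real k < x0" "x0 \<le> real i / real k"
    by (rule strip_point[OF assms])
  have "lowest S ((real i - 1) / real k) (real i / real k) > 0"
    using lowest_point(1)[OF p] config_pos by blast
  then show "0 < strip_uniform S k i" "strip_uniform S k i < 1"
    using assms by (auto simp: strip_uniform_def)
qed

lemma strip_uniform_ge:
  assumes k: "k \<ge> 1" and y: "\<And>x y'. (x, y') \<in> S \<Longrightarrow> (real i - 1) / real k < x \<Longrightarrow> x \<le> real i / real k \<Longrightarrow> y \<le> y'"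
  shows "1 - exp (- (y / real k)) \<le> strip_uniform S k i"
proof -
  obtain x0 y0 where p: "(x0, y0) \<in> S" "(real i - 1) / real k < x0" "x0 \<le> real i / real k"
    by (rule strip_point[OF k])
  have "y \<le> lowest S ((real i - 1) / real k) (real i / real k)"
    using lowest_point(1)[OF p] y by blast
  then show ?thesis using k by (auto simp: strip_uniform_def divide_right_mono)
qed

lemma strip_uniform_le:
  assumes k: "k \<ge> 1" and p: "(x, y) \<in> S" "(real i - 1) / real k < x" "x \<le> real i / real k"
  shows "strip_uniform S k i \<le> 1 - exp (- (y / real k))" "strip_uniform S k i \<le> y / real k"
proof -
  have "lowest S ((real i - 1) / real k) (real i / real k) \<le> y"
    using lowest_point(2)[OF p p] .
  then show le: "strip_uniform S k i \<le> 1 - exp (- (y / real k))"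
    using k by (auto simp: strip_uniform_def divide_right_mono)
  have "0 \<le> y / real k" using config_pos[OF p(1)] by simp
  from one_minus_exp_bounds(1)[OF this] le show "strip_uniform S k i \<le> y / real k" by simp
qed

lemma strip_index:
  assumes "k \<ge> 1" "x > 0"
  defines "i \<equiv> nat \<lceil>real k * x\<rceil>"
  shows "i \<ge> 1" "(real i - 1) / real k < x" "x \<le> real i / real k" "\<And>n. x \<le> real n / real k \<Longrightarrow> i \<le> n"
proof -
  have pos: "real k * x > 0" using assms by simp
  then have c: "\<lceil>real k * x\<rceil> \<ge> 1" by linarith
  then show "i \<ge> 1" unfolding i_def using nat_mono[OF c] by (simp only: nat_one_as_int[symmetric])
  have ri: "real i = of_int \<lceil>real k * x\<rceil>" unfolding i_def using c by simp
  have "of_int \<lceil>real k * x\<rceil> - 1 < real k * x" "real k * x \<le> of_int \<lceil>real k * x\<rceil>" by linarith+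
  then show "(real i - 1) / real k < x" "x \<le> real i / real k"
    using assms(1) unfolding ri by (simp_all add: field_simps)
  fix n :: nat assume "x \<le> real n / real k"
  then have "real k * x \<le> real n" using assms(1) by (simp add: field_simps)
  then have "\<lceil>real k * x\<rceil> \<le> int n" by (intro ceiling_le) simp
  then show "i \<le> n" by (simp only: i_def nat_le_iff)
qed

text \<open>Near the axis there are finitely many points of height at most \<open>B\<close>, and
  none of them is on the axis. Both sides are cleared because the strip with index 0 lies on the
  left.\<close>

lemma config_gap:
  assumes e: "e > (0::real)"
  obtains \<delta> where "\<delta> > 0" "\<delta> < e" "\<And>x y. (x, y) \<in> S \<Longrightarrow> - \<delta> \<le> x \<Longrightarrow> x \<le> \<delta> \<Longrightarrow> y > B"
proof -
  define F where "F = insert e ((\<lambda>p. \<bar>fst p\<bar>) ` (S \<inter> {- e..e} \<times> {..B}))"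
  have fin: "finite F" unfolding F_def using config_finite by simp
  have pos: "\<forall>a\<in>F. a > 0" using e config_nonzero by (auto simp: F_def)
  define \<delta> where "\<delta> = Min F / 2"
  have M: "Min F > 0" "Min F \<le> e" using fin pos by (auto simp: F_def)
  show thesis
  proof (rule that[of \<delta>])
    show "\<delta> > 0" "\<delta> < e" using M by (auto simp: \<delta>_def)
    fix x y assume p: "(x, y) \<in> S" "- \<delta> \<le> x" "x \<le> \<delta>"
    show "y > B"
    proof (rule ccontr)
      assume "\<not> y > B"
      moreover have "x \<in> {- e..e}" using p M by (auto simp: \<delta>_def)
      ultimately have "\<bar>x\<bar> \<in> F" using p(1) by (force simp: F_def)
      then have "Min F \<le> \<bar>x\<bar>" using fin by simp
      then show False using p M by (auto simp: \<delta>_def)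
    qed
  qed
qed

end

section \<open>Convergence to the lower envelope\<close>

text \<open>The identity minus a contraction is strictly increasing, and its growth at a linear rate
  makes it onto by the intermediate value theorem.\<close>

lemma time_change_diff:
  assumes lip: "\<And>s t. \<bar>p s - p t\<bar> \<le> c * \<bar>s - t\<bar>" and c: "0 \<le> c" "c < 1" and a: "p a = 0"
  shows "time_change a (\<lambda>t. t - p t)"
proof -
  have mono: "s - p s < t - p t" if "s < t" for s t
  proof -
    have "p t - p s \<le> c * (t - s)" using lip[of t s] that by simp
    also have "\<dots> < 1 * (t - s)" using that c by (intro mult_strict_right_mono) auto
    finally show ?thesis by simp
  qed
  have "c-lipschitz_on UNIV p"
    by (rule lipschitz_onI) (use lip c in \<open>simp_all add: dist_real_def\<close>)
  then have cont: "continuous_on UNIV p" by (rule lipschitz_on_continuous_on)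
  have "(\<lambda>t. t - p t) ` {a..} = {a..}"
  proof (intro equalityI subsetI)
    fix s assume "s \<in> (\<lambda>t. t - p t) ` {a..}"
    then obtain t where "s = t - p t" "t \<ge> a" by auto
    then show "s \<in> {a..}" using mono[of a t] a by (cases "t = a") auto
  next
    fix s assume "s \<in> {a..}"
    then have s: "s \<ge> a" by simp
    \<comment> \<open>Since \<open>t - p t \<ge> a + (1 - c) * (t - a)\<close> for
      \<open>t \<ge> a\<close>, the map has reached \<open>s\<close> at this time.\<close>
    define T where "T = a + (s - a) / (1 - c)"
    have T: "T \<ge> a" unfolding T_def using s c by simp
    have "p T \<le> c * (T - a)" using lip[of T a] a T by simp
    then have "T - p T \<ge> a + (1 - c) * (T - a)" by (simp add: algebra_simps)
    then have "s \<le> T - p T" using c by (simp add: T_def)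
    moreover have "a - p a \<le> s" using a s by simp
    moreover have "continuous_on {a..T} (\<lambda>t. t - p t)"
      by (intro continuous_intros continuous_on_subset[OF cont]) auto
    ultimately have "\<exists>x\<ge>a. x \<le> T \<and> x - p x = s" using T by (intro IVT') auto
    then show "s \<in> (\<lambda>t. t - p t) ` {a..}" by auto
  qed
  then show ?thesis using mono by (simp add: time_change_def strict_mono_on_def)
qed

definition bump :: "real \<Rightarrow> real \<Rightarrow> real \<Rightarrow> real" where
  "bump w x t = max 0 (1 - \<bar>t - x\<bar> / w)"

lemma bump_lipschitz:
  assumes "w > 0"
  shows "\<bar>bump w x s - bump w x t\<bar> \<le> \<bar>s - t\<bar> / w"
proof -
  have "\<bar>bump w x s - bump w x t\<bar> \<le> \<bar>\<bar>s - x\<bar> / w - \<bar>t - x\<bar> / w\<bar>"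
  proof -
    have "\<bar>max 0 (1 - A) - max 0 (1 - B)\<bar> \<le> \<bar>A - B\<bar>" for A B :: real by (simp add: max_def abs_if)
    then show ?thesis unfolding bump_def .
  qed
  also have "\<dots> = \<bar>\<bar>s - x\<bar> - \<bar>t - x\<bar>\<bar> / w"
    using assms by (simp add: diff_divide_distrib[symmetric] abs_divide)
  also have "\<dots> \<le> \<bar>s - t\<bar> / w" using assms by (intro divide_right_mono) auto
  finally show ?thesis .
qed

lemma bump_simps: "w > 0 \<Longrightarrow> bump w x x = 1" "w > 0 \<Longrightarrow> \<bar>t - x\<bar> \<ge> w \<Longrightarrow> bump w x t = 0"
  "0 \<le> bump w x t" "w > 0 \<Longrightarrow> bump w x t \<le> 1"
  by (auto simp: bump_def)

text \<open>Moves finitely many jump times to the grid by small tents with disjoint peaks.\<close>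

lemma grid_time_change:
  assumes "finite J" "\<And>x. x \<in> J \<Longrightarrow> x > a" "\<delta> > 0"
  shows "eventually (\<lambda>k. \<exists>\<tau>. time_change a \<tau> \<and> (\<forall>t. \<bar>\<tau> t - t\<bar> < \<delta> \<and> \<tau> t \<le> t) \<and>
    (\<forall>x\<in>J. \<tau> x = (of_int \<lceil>real k * x\<rceil> - 1) / real k)) sequentially"
proof -
  \<comment> \<open>The minimum \<open>w\<close> separates the points of \<open>J\<close> from each
    other and from \<open>a\<close>, so a tent of half-width \<open>w\<close> vanishes at all of
    these except its own centre; the 1 covers empty \<open>J\<close>.\<close>
  define D where "D = insert 1 ((\<lambda>x. x - a) ` J \<union> (\<lambda>(x, y). \<bar>x - y\<bar>) ` (J \<times> J - Id))"
  define w where "w = Min D"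
  have D: "finite D" "D \<noteq> {}" using assms(1) by (auto simp: D_def)
  have "\<forall>e\<in>D. e > 0" using assms(2) by (force simp: D_def)
  then have w: "w > 0" using Min_in[OF D] by (auto simp: w_def)
  have wa: "x - a \<ge> w" if "x \<in> J" for x
    unfolding w_def by (rule Min_le) (use D that in \<open>auto simp: D_def\<close>)
  have wJ: "\<bar>x - y\<bar> \<ge> w" if "x \<in> J" "y \<in> J" "x \<noteq> y" for x y
    unfolding w_def by (rule Min_le) (use D that in \<open>force simp: D_def\<close>)+
  have lim: "(\<lambda>k. real (card J) / w / real k) \<longlonglongrightarrow> 0" "(\<lambda>k. real (card J) / real k) \<longlonglongrightarrow> 0"
    by (rule lim_const_over_n)+
  have "eventually (\<lambda>k. real (card J) / w / real k < 1) sequentially"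
    "eventually (\<lambda>k. real (card J) / real k < \<delta>) sequentially"
    using order_tendstoD(2)[OF lim(1), of 1] order_tendstoD(2)[OF lim(2) assms(3)] by auto
  then show ?thesis using eventually_ge_at_top[of 1]
  proof eventually_elim
    case (elim k)
    \<comment> \<open>The displacement to the left end of the strip that contains \<open>x\<close>:
      there a grid path switches to the index \<open>\<lceil>k * x\<rceil>\<close> of that
      strip.\<close>
    define d where "d x = x - (of_int \<lceil>real k * x\<rceil> - 1) / real k" for x
    have d: "0 \<le> d x" "d x \<le> 1 / real k" for x
    proof -
      have "of_int \<lceil>real k * x\<rceil> - 1 \<le> real k * x" "real k * x \<le> of_int \<lceil>real k * x\<rceil>" by linarith+
      then show "0 \<le> d x" "d x \<le> 1 / real k" using elim(3) by (auto simp: d_def field_simps)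
    qed
    define p where "p t = (\<Sum>x\<in>J. d x * bump w x t)" for t
    define c where "c = real (card J) / w / real k"
    have lip: "\<bar>p s - p t\<bar> \<le> c * \<bar>s - t\<bar>" for s t
    proof -
      have "\<bar>p s - p t\<bar> = \<bar>\<Sum>x\<in>J. d x * (bump w x s - bump w x t)\<bar>"
        by (simp add: p_def sum_subtractf right_diff_distrib)
      also have "\<dots> \<le> (\<Sum>x\<in>J. \<bar>d x * (bump w x s - bump w x t)\<bar>)" by (rule sum_abs)
      also have "\<dots> \<le> (\<Sum>x\<in>J. 1 / real k * (\<bar>s - t\<bar> / w))"
        unfolding abs_mult by (intro sum_mono mult_mono bump_lipschitz w) (use d in auto)
      also have "\<dots> = c * \<bar>s - t\<bar>" by (simp add: c_def)
      finally show ?thesis .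
    qed
    have c: "0 \<le> c" "c < 1" using elim(1) w by (auto simp: c_def)
    have "bump w x a = 0" if "x \<in> J" for x
      using wa[OF that] by (intro bump_simps(2) w) simp
    then have pa: "p a = 0" unfolding p_def by (intro sum.neutral ballI) simp
    have p: "0 \<le> p t" "p t < \<delta>" for t
    proof -
      show "0 \<le> p t" unfolding p_def by (intro sum_nonneg mult_nonneg_nonneg d bump_simps)
      have "p t \<le> (\<Sum>x\<in>J. 1 / real k * 1)"
        unfolding p_def by (intro sum_mono mult_mono d bump_simps w) auto
      also have "\<dots> = real (card J) / real k" by simp
      finally show "p t < \<delta>" using elim(2) by simp
    qed
    have px: "p x = d x" if "x \<in> J" for x
    proof -
      have "p x = (\<Sum>y\<in>{x}. d y * bump w y x)" unfolding p_def
        by (rule sum.mono_neutral_right[OF assms(1)]) (use that wJ w in \<open>auto simp: bump_simps(2)\<close>)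
      then show ?thesis using w by (simp add: bump_simps(1))
    qed
    show ?case
    proof (intro exI conjI allI ballI)
      show "time_change a (\<lambda>t. t - p t)" by (rule time_change_diff[OF lip c pa])
      show "\<bar>(t - p t) - t\<bar> < \<delta>" "t - p t \<le> t" for t using p[of t] by auto
      show "x - p x = (of_int \<lceil>real k * x\<rceil> - 1) / real k" if "x \<in> J" for x
        by (simp add: px[OF that] d_def)
    qed
  qed
qed

text \<open>A finite superset of the jump times after \<open>a\<close>: a point above the envelope
  at \<open>a\<close> can never become the minimum later.\<close>

definition envelope_jumps :: "(real \<times> real) set \<Rightarrow> real \<Rightarrow> real \<Rightarrow> real set" where
  "envelope_jumps S a m = fst ` (S \<inter> {a<..m} \<times> {..lower_envelope S a})"

context
  fixes S :: "(real \<times> real) set" and a :: real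
  assumes good: "good_config S" and a: "a > 0"
begin

lemma finite_envelope_jumps: "finite (envelope_jumps S a m)"
proof -
  have "S \<inter> {a<..m} \<times> {..lower_envelope S a} \<subseteq> S \<inter> {a..m} \<times> {..lower_envelope S a}" by auto
  then show ?thesis unfolding envelope_jumps_def
    by (intro finite_imageI finite_subset[OF _ config_finite[OF good]])
qed

text \<open>The point that realises the minimum at one time lies either at or before
  \<open>a\<close> or over one of the candidates, so it is available at the other time as
  well.\<close>

lemma lower_envelope_eqI:
  assumes "a \<le> s" "s \<le> m" "a \<le> t" "t \<le> m" "\<And>x. x \<in> envelope_jumps S a m \<Longrightarrow> x \<le> s \<longleftrightarrow> x \<le> t"
  shows "lower_envelope S s = lower_envelope S t"
proof -
  have le: "lower_envelope S t' \<le> lower_envelope S s'"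
    if st: "a \<le> s'" "s' \<le> m" "a \<le> t'" "t' \<le> m" "\<And>x. x \<in> envelope_jumps S a m \<Longrightarrow> x \<le> s' \<Longrightarrow> x \<le> t'" for s' t'
  proof -
    have "0 < s'" using st a by simp
    then obtain x where x: "(x, lower_envelope S s') \<in> S" "0 < x" "x \<le> s'"
      using lower_envelope_point[OF good] by blast
    have "lower_envelope S s' \<le> lower_envelope S a"
      using lower_envelope_antimono[OF good a st(1)] .
    have "x \<le> t'"
    proof (cases "x \<le> a")
      case False
      then have "x \<in> envelope_jumps S a m"
        unfolding envelope_jumps_def using x st(2) \<open>lower_envelope S s' \<le> lower_envelope S a\<close>
        by (intro image_eqI[of _ _ "(x, lower_envelope S s')"]) auto
      then show ?thesis using st(5) x by blast
    qed (use st in simp)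
    then show ?thesis using x st a by (intro lower_envelope_le[OF good, of t' x]) auto
  qed
  show ?thesis by (rule antisym; rule le) (use assms in auto)
qed

lemma lower_envelope_cadlag: "restrict (lower_envelope S) {a..} \<in> cadlag_paths a"
  unfolding cadlag_paths_def
proof (intro CollectI conjI allI impI)
  fix t assume t: "a \<le> t"
  let ?L = "restrict (lower_envelope S) {a..}" and ?J = "envelope_jumps S a (t + 1)"
  have "eventually (\<lambda>s. \<forall>x\<in>?J. x \<le> s \<longleftrightarrow> x \<le> t) (at_right t)"
  proof (rule eventually_ball_finite[OF finite_envelope_jumps], intro ballI)
    fix x
    show "eventually (\<lambda>s. x \<le> s \<longleftrightarrow> x \<le> t) (at_right t)"
    proof (cases "x \<le> t")
      case True
      then show ?thesis by (auto intro: eventually_mono[OF eventually_at_right_less])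
    next
      case False
      then show ?thesis unfolding eventually_at_right_field by (intro exI[of _ x]) auto
    qed
  qed
  moreover have "eventually (\<lambda>s. s \<in> {t<..<t + 1}) (at_right t)"
    by (rule eventually_at_right_real) simp
  ultimately have "eventually (\<lambda>s. ?L s = ?L t) (at_right t)"
  proof eventually_elim
    case (elim s)
    then have "lower_envelope S s = lower_envelope S t"
      using t by (intro lower_envelope_eqI[of s "t + 1" t]) auto
    then show ?case using elim t by simp
  qed
  then show "continuous (at_right t) ?L"
    unfolding continuous_within by (rule tendsto_eventually)
next
  fix t assume t: "a < t"
  let ?L = "restrict (lower_envelope S) {a..}" and ?J = "envelope_jumps S a t"
  \<comment> \<open>From the left a candidate at \<open>t\<close> itself counts as not yet passed,
    hence the strict inequality.\<close>
  have "eventually (\<lambda>s. \<forall>x\<in>?J. x \<le> s \<longleftrightarrow> x < t) (at_left t)"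
  proof (rule eventually_ball_finite[OF finite_envelope_jumps], intro ballI)
    fix x
    show "eventually (\<lambda>s. x \<le> s \<longleftrightarrow> x < t) (at_left t)"
    proof (cases "x < t")
      case True
      then show ?thesis unfolding eventually_at_left_field by (intro exI[of _ x]) auto
    next
      case False
      then show ?thesis unfolding eventually_at_left_field by (intro exI[of _ "t - 1"]) auto
    qed
  qed
  moreover have "eventually (\<lambda>s. s \<in> {a<..<t}) (at_left t)"
    by (rule eventually_at_left_real) (rule t)
  ultimately have ev: "eventually (\<lambda>s. (\<forall>x\<in>?J. x \<le> s \<longleftrightarrow> x < t) \<and> s \<in> {a<..<t}) (at_left t)"
    by (rule eventually_conj)
  then obtain s0 where s0: "\<forall>x\<in>?J. x \<le> s0 \<longleftrightarrow> x < t" "s0 \<in> {a<..<t}"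
    using eventually_happens[OF ev] by auto
  have "eventually (\<lambda>s. ?L s = lower_envelope S s0) (at_left t)"
    using ev
  proof eventually_elim
    case (elim s)
    then have "lower_envelope S s = lower_envelope S s0"
      using s0 by (intro lower_envelope_eqI[of s t s0]) auto
    then show ?case using elim by simp
  qed
  then show "\<exists>l. (?L \<longlongrightarrow> l) (at_left t)" by (intro exI) (rule tendsto_eventually)
qed simp

end

context offspring_law
begin

text \<open>Comparing the chain with the running minimum of the uniform variables that drive it: once the
  chain is close to criticality both agree up to a factor \<open>q\<close>, and the earlier steps do not matter
  because low points of the configuration are not close to the vertical axis.\<close>

lemma driven_chain_near_envelope:
  assumes good: "good_config S" and a: "a > 0" and \<eta>: "\<eta> > 0"
  shows "eventually (\<lambda>k. \<forall>n. a \<le> real n / real k \<longrightarrow>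
    \<bar>real k * H (driven_chain (strip_uniform S k) n) - lower_envelope S (real n / real k)\<bar> < \<eta>) sequentially"
proof -
  define y where "y = lower_envelope S a"
  have y: "y > 0" unfolding y_def by (rule lower_envelope_pos[OF good a])
  \<comment> \<open>A factor \<open>q\<close> then costs at most \<open>\<eta> / 4\<close> at
    heights up to \<open>y\<close>.\<close>
  define q where "q = 1 + \<eta> / (4 * y)"
  have q: "q > 1" using \<eta> y by (simp add: q_def)
  have qy: "(q - 1) * y = \<eta> / 4" using y by (simp add: q_def)
  obtain y0 where y0: "0 < y0" "y0 \<le> 1"
    and ratio: "\<And>y z. 0 < y \<Longrightarrow> y \<le> y0 \<Longrightarrow> 0 < z \<Longrightarrow> z \<le> y0 \<Longrightarrow> H y / y \<le> q * (r z / z) \<and> r z / z \<le> q * (H y / y)"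
    using H_r_ratio[OF q] by blast
  define c where "c = p2 / \<mu>\<^sup>2 * y0"
  have c: "c > 0" using p2_pos \<mu>_gt_1 y0 by (simp add: c_def)
  \<comment> \<open>With no point of height at most \<open>B\<close> near the axis, an early jump
    leaves the rescaled excess at least \<open>c * B / 2 \<ge> y\<close>, which is not below the
    envelope at any time from \<open>a\<close> on.\<close>
  define B where "B = max y (2 * y / c)"
  have B: "B \<ge> y" "2 * y / c \<le> B" by (auto simp: B_def)
  then have B: "B \<ge> y" "c * B \<ge> 2 * y" "B > 0"
    using c y by (auto simp: pos_divide_le_eq mult.commute)
  have divq: "X / q \<le> X" if "X \<ge> 0" for X
  proof -
    have "X * 1 \<le> X * q" using that q by (intro mult_left_mono) auto
    then show ?thesis using q by (simp add: pos_divide_le_eq)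
  qed
  obtain \<delta> where \<delta>: "\<delta> > 0" "\<delta> < a" "\<And>x y. (x, y) \<in> S \<Longrightarrow> - \<delta> \<le> x \<Longrightarrow> x \<le> \<delta> \<Longrightarrow> y > B"
    using config_gap[OF good a, of B] by blast
  obtain j :: nat where j: "1 / real (Suc j) < \<delta> / 2"
    using reals_Archimedean[of "\<delta> / 2"] \<delta> by (auto simp: inverse_eq_divide)
  obtain x1 y1 where x1: "(x1, y1) \<in> S" "0 < x1" "x1 \<le> \<delta> / 2"
  proof -
    obtain p where "p \<in> S" "0 < fst p" "fst p \<le> 1 / real (Suc j)" using good_configD(3)[OF good] by blast
    then show thesis using that[of "fst p" "snd p"] j by simp
  qed
  have small: "eventually (\<lambda>k. C / real k < e) sequentially" if "e > 0" for C e :: real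
    using order_tendstoD(2)[OF lim_const_over_n that] .
  \<comment> \<open>In this order: the strips near the axis stay within \<open>\<delta>\<close> of
    it, the point \<open>(x1, y1)\<close> makes the chain enter the levels up to \<open>y0\<close>,
    the quadratic error is small, and \<open>1 - exp (- z) \<ge> z / 2\<close> holds at
    \<open>z = B / k\<close>.\<close>
  have "eventually (\<lambda>k. 1 / real k < \<delta> / 2 \<and> y1 / real k < c \<and> y\<^sup>2 / real k < \<eta> / 2 \<and> B / real k < 1 \<and> k \<ge> 1) sequentially"
    using \<delta> c \<eta> by (intro eventually_conj small eventually_ge_at_top) auto
  then show ?thesis
  proof eventually_elim
    case (elim k)
    then have k: "k \<ge> 1" "real k > 0" by auto
    define u where "u = strip_uniform S k"
    have u: "0 < u n" "u n < 1" for n using strip_uniform_bounds[OF good k(1)] by (auto simp: u_def)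
    define Y where "Y = driven_chain u"
    define i1 where "i1 = nat \<lceil>real k * x1\<rceil>"
    note i1 = strip_index[OF good k(1) x1(2), folded i1_def]
    have i1\<delta>: "real i1 / real k \<le> \<delta>"
      using i1(2) x1(3) elim k by (simp add: diff_divide_distrib)
    have Y1: "Y i1 \<le> y0"
    proof -
      obtain i where i: "i1 = Suc i" using i1(1) by (cases i1) auto
      have "u i1 \<le> y1 / real k"
        unfolding u_def by (rule strip_uniform_le(2)[OF good k(1) x1(1) i1(2,3)])
      then have "u (Suc i) < p2 / \<mu>\<^sup>2 * y0" using elim unfolding i c_def by simp
      then show ?thesis unfolding Y_def i by (rule driven_chain_enters[of u, OF u y0(1)])
    qed
    have Y_late: "Y i \<le> y0" if "i1 \<le> i" for i
      using driven_chain_antimono[of u, OF u that] Y1 unfolding Y_def by simp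
    show ?case
    proof (intro allI impI)
      fix n assume n: "a \<le> real n / real k"
      define l where "l = lower_envelope S (real n / real k)"
      have n0: "0 < real n / real k" using n a by simp
      obtain x where x: "(x, l) \<in> S" "0 < x" "x \<le> real n / real k"
        "\<And>x' y'. (x', y') \<in> S \<Longrightarrow> 0 \<le> x' \<Longrightarrow> x' \<le> real n / real k \<Longrightarrow> l \<le> y'"
        unfolding l_def using lower_envelope_point[OF good n0] by blast
      have l: "0 < l" "l \<le> y"
        unfolding l_def y_def by (rule lower_envelope_pos[OF good n0], rule lower_envelope_antimono[OF good a n])
      \<comment> \<open>The envelope is realised at some \<open>x > \<delta>\<close>. Its strip
        comes after strip \<open>i1\<close>, when the chain is already at or below
        \<open>y0\<close>.\<close>
      have upper: "real k * H (Y n) \<le> q * l"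
      proof -
        have "x > \<delta>" using \<delta>(3)[of x l] x l B \<delta>(1) by force
        define i where "i = nat \<lceil>real k * x\<rceil>"
        note i = strip_index[OF good k(1) x(2), folded i_def]
        have "i1 < i"
        proof (rule ccontr)
          assume "\<not> i1 < i"
          then have "real i / real k \<le> real i1 / real k" by (intro divide_right_mono) auto
          then show False using i(3) i1\<delta> \<open>x > \<delta>\<close> by simp
        qed
        then obtain i' where i': "i = Suc i'" "i1 \<le> i'" by (cases i) auto
        have "H (Y n) \<le> q * u (Suc i')"
          unfolding Y_def
          by (rule H_driven_chain_le[of u, OF u q y0 ratio])
             (use Y_late[OF i'(2)] i(4)[OF x(3)] i' in \<open>auto simp: Y_def\<close>)
        also have "\<dots> \<le> q * (l / real k)"
          using strip_uniform_le(2)[OF good k(1) x(1) i(2,3)] q i' by (intro mult_left_mono) (auto simp: u_def)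
        finally show ?thesis using k by (simp add: field_simps)
      qed
      have lower: "real k * H (Y n) \<ge> (l - l\<^sup>2 / (2 * real k)) / q"
      proof -
        have lk: "l - l\<^sup>2 / (2 * real k) \<le> real k * (1 - exp (- (l / real k)))"
        proof -
          have "l / real k - (l / real k)\<^sup>2 / 2 \<le> 1 - exp (- (l / real k))"
            using l k by (intro one_minus_exp_bounds) auto
          then have "real k * (l / real k - (l / real k)\<^sup>2 / 2) \<le> real k * (1 - exp (- (l / real k)))"
            using k by (intro mult_left_mono) auto
          moreover have "real k * (l / real k - (l / real k)\<^sup>2 / 2) = l - l\<^sup>2 / (2 * real k)"
            using k by (simp add: power2_eq_square field_simps)
          ultimately show ?thesis by simp
        qed
        have "0 \<le> l\<^sup>2 / (2 * real k)" by simp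
        then have sm: "(l - l\<^sup>2 / (2 * real k)) / q \<le> l"
        proof -
          have "(l - l\<^sup>2 / (2 * real k)) / q \<le> l / q" using q l k by (intro divide_right_mono) auto
          also have "\<dots> \<le> l" using l by (intro divq) simp
          finally show ?thesis .
        qed
        from H_driven_chain_ge[of u, OF u q y0 ratio, of n]
        obtain i where i: "i \<le> n" and cases: "H (Y n) \<ge> c * u i \<and> (i = 0 \<or> Y (i - 1) > y0) \<or>
            H (Y n) \<ge> u i / q \<and> i \<ge> 1 \<and> Y (i - 1) \<le> y0"
          unfolding Y_def c_def by blast
        \<comment> \<open>In the late case the strip lies inside \<open>[0, n / k]\<close>, so its
          points are not below \<open>l\<close>. In the early case the step is not after
          \<open>i1\<close>, and all points in its strip are above \<open>B\<close>; for
          \<open>i = 0\<close> this strip reaches down to \<open>- 1 / k\<close>.\<close>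
        from cases consider (late) "H (Y n) \<ge> u i / q" "i \<ge> 1"
          | (early) "H (Y n) \<ge> c * u i" "i = 0 \<or> Y (i - 1) > y0" by blast
        then show ?thesis
        proof cases
          case late
          note H = late(1) and i1 = late(2)
          have "1 - exp (- (l / real k)) \<le> u i"
            unfolding u_def
          proof (rule strip_uniform_ge[OF good k(1)])
            fix x' y' assume p: "(x', y') \<in> S" "(real i - 1) / real k < x'" "x' \<le> real i / real k"
            have "0 \<le> (real i - 1) / real k" using i1 k by simp
            moreover have "real i / real k \<le> real n / real k" using i by (intro divide_right_mono) auto
            ultimately show "l \<le> y'" using x(4)[OF p(1)] p by simp
          qed
          then have "real k * (1 - exp (- (l / real k))) \<le> real k * u i" using k by (intro mult_left_mono) auto
          then have "(l - l\<^sup>2 / (2 * real k)) / q \<le> real k * u i / q"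
            using lk q by (intro divide_right_mono) auto
          also have "\<dots> \<le> real k * H (Y n)" using mult_left_mono[OF H, of "real k"] by simp
          finally show ?thesis .
        next
          case early
          note H = early(1) and early = early(2)
          have "i \<le> i1"
          proof (rule ccontr)
            assume "\<not> i \<le> i1"
            then have "Y (i - 1) \<le> y0" by (intro Y_late) auto
            then show False using early \<open>\<not> i \<le> i1\<close> by auto
          qed
          have "1 - exp (- (B / real k)) \<le> u i"
            unfolding u_def
          proof (rule strip_uniform_ge[OF good k(1)])
            fix x' y' assume p: "(x', y') \<in> S" "(real i - 1) / real k < x'" "x' \<le> real i / real k"
            have "- (1 / real k) \<le> (real i - 1) / real k" using k by (simp add: field_simps)
            then have "- \<delta> \<le> x'" using p elim \<delta> by simp
            moreover have "real i / real k \<le> real i1 / real k" using \<open>i \<le> i1\<close> by (intro divide_right_mono) auto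
            then have "x' \<le> \<delta>" using p i1\<delta> by simp
            ultimately show "B \<le> y'" using \<delta>(3)[OF p(1)] by simp
          qed
          moreover have "B / real k / 2 \<le> 1 - exp (- (B / real k))"
          proof -
            have "B / real k - (B / real k)\<^sup>2 / 2 \<le> 1 - exp (- (B / real k))"
              using B k by (intro one_minus_exp_bounds) auto
            moreover have "(B / real k) * (B / real k) \<le> (B / real k) * 1"
              using elim B k by (intro mult_left_mono) auto
            then have "(B / real k)\<^sup>2 \<le> B / real k" by (simp only: power2_eq_square mult_1_right)
            ultimately show ?thesis by simp
          qed
          ultimately have "B / real k / 2 \<le> u i" by simp
          then have "c * (B / real k / 2) \<le> c * u i" using c by (intro mult_left_mono) auto
          then have "c * (B / real k / 2) \<le> H (Y n)" using H by simp
          then have "real k * (c * (B / real k / 2)) \<le> real k * H (Y n)" using k by (intro mult_left_mono) auto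
          then have "y \<le> real k * H (Y n)" using B(2) k by simp
          then show ?thesis using sm l by simp
        qed
      qed
      have "q * l - l \<le> (q - 1) * y"
        using q l mult_left_mono[of l y "q - 1"] by (simp add: algebra_simps)
      moreover have "l - (l - l\<^sup>2 / (2 * real k)) / q < \<eta>"
      proof -
        have "l - l / q \<le> (q - 1) * y"
        proof -
          have "l - l / q = (q - 1) * (l / q)" using q by (simp add: field_simps)
          also have "\<dots> \<le> (q - 1) * y" using divq[of l] l q by (intro mult_left_mono) auto
          finally show ?thesis .
        qed
        moreover have "l\<^sup>2 / (2 * real k) / q \<le> y\<^sup>2 / real k"
        proof -
          have "l\<^sup>2 / (2 * real k) / q \<le> l\<^sup>2 / (2 * real k)"
            using k by (intro divq) simp
          also have "\<dots> \<le> y\<^sup>2 / real k" using l k by (intro frac_le power_mono) auto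
          finally show ?thesis .
        qed
        moreover have "l - (l - l\<^sup>2 / (2 * real k)) / q = (l - l / q) + l\<^sup>2 / (2 * real k) / q"
          by (simp add: diff_divide_distrib)
        moreover have "y\<^sup>2 / real k < \<eta> / 2" using elim by blast
        ultimately show ?thesis using qy \<eta> by linarith
      qed
      ultimately show "\<bar>real k * H (driven_chain (strip_uniform S k) n) - lower_envelope S (real n / real k)\<bar> < \<eta>"
        using upper lower qy \<eta> unfolding l_def[symmetric] Y_def[symmetric] u_def[symmetric] by linarith
    qed
  qed
qed

text \<open>The chain follows a jump of the envelope only on the grid, so the time change first
  moves the candidate jumps there. At time \<open>\<tau> t\<close> the chain is close to the
  envelope at a grid time \<open>t'\<close>, and the envelope agrees at \<open>t'\<close> and
  \<open>t\<close> because no candidate jump separates them.\<close>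

lemma skorohod_tendsto_envelope:
  assumes good: "good_config S" and a: "a > 0"
  shows "skorohod_tendsto a (\<lambda>k. grid_path a k (\<lambda>n. real k * H (driven_chain (strip_uniform S k) n)))
    (restrict (lower_envelope S) {a..})"
  unfolding skorohod_tendsto_def
proof (intro conjI allI impI)
  show "restrict (lower_envelope S) {a..} \<in> cadlag_paths a" by (rule lower_envelope_cadlag[OF good a])
next
  fix m \<delta> :: real assume \<delta>: "\<delta> > 0"
  \<comment> \<open>The grid time \<open>t'\<close> can exceed \<open>m\<close> by up to
    \<open>1 / k\<close>, hence the window \<open>m + 1\<close>.\<close>
  define J where "J = envelope_jumps S a (m + 1)"
  have J: "finite J" "\<And>x. x \<in> J \<Longrightarrow> x > a"
    unfolding J_def by (rule finite_envelope_jumps[OF good a]) (auto simp: envelope_jumps_def)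
  have "eventually (\<lambda>k. \<exists>\<tau>. time_change a \<tau> \<and> (\<forall>t. \<bar>\<tau> t - t\<bar> < \<delta> \<and> \<tau> t \<le> t) \<and>
      (\<forall>x\<in>J. \<tau> x = (of_int \<lceil>real k * x\<rceil> - 1) / real k)) sequentially"
    using J \<delta> by (intro grid_time_change) auto
  then show "eventually (\<lambda>k. grid_path a k (\<lambda>n. real k * H (driven_chain (strip_uniform S k) n))
      \<in> skorohod_nbhd a (restrict (lower_envelope S) {a..}) m \<delta>) sequentially"
    using driven_chain_near_envelope[OF good a \<delta>] eventually_ge_at_top[of 1]
  proof eventually_elim
    case (elim k)
    then have k: "k \<ge> 1" "real k > 0" by auto
    obtain \<tau> where \<tau>: "time_change a \<tau>" "\<And>t. \<bar>\<tau> t - t\<bar> < \<delta>" "\<And>t. \<tau> t \<le> t"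
      "\<And>x. x \<in> J \<Longrightarrow> \<tau> x = (of_int \<lceil>real k * x\<rceil> - 1) / real k"
      using elim(1) by blast
    have mono: "strict_mono_on {a..} \<tau>" using \<tau>(1) by (simp add: time_change_def)
    define X where "X = grid_path a k (\<lambda>n. real k * H (driven_chain (strip_uniform S k) n))"
    have "\<bar>X (\<tau> t) - restrict (lower_envelope S) {a..} t\<bar> < \<delta>" if t: "t \<in> {a..m}" for t
    proof -
      have \<tau>t: "\<tau> t \<ge> a" by (rule time_change_ge[OF \<tau>(1)]) (use t in simp)
      define n where "n = nat \<lfloor>real k * \<tau> t\<rfloor> + 1"
      define t' where "t' = real n / real k"
      have "real k * \<tau> t \<ge> 0" using \<tau>t a by simp
      then have n: "real n = of_int \<lfloor>real k * \<tau> t\<rfloor> + 1" by (simp add: n_def)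
      have t': "a \<le> t'" "t' \<le> m + 1"
      proof -
        have fl: "real k * \<tau> t < of_int \<lfloor>real k * \<tau> t\<rfloor> + 1" "of_int \<lfloor>real k * \<tau> t\<rfloor> \<le> real k * \<tau> t" by linarith+
        then have "\<tau> t < t'" using k unfolding t'_def n by (simp add: pos_less_divide_eq mult.commute)
        then show "a \<le> t'" using \<tau>t by simp
        have "t' \<le> (real k * \<tau> t + 1) / real k"
          unfolding t'_def n using fl k by (intro divide_right_mono) auto
        also have "\<dots> = \<tau> t + 1 / real k" using k by (simp add: add_divide_distrib)
        also have "\<dots> \<le> m + 1" using \<tau>(3)[of t] t k by (intro add_mono) auto
        finally show "t' \<le> m + 1" .
      qed
      have "x \<le> t' \<longleftrightarrow> x \<le> t" if x: "x \<in> J" for x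
      proof -
        have "x \<le> t' \<longleftrightarrow> real k * x \<le> of_int (\<lfloor>real k * \<tau> t\<rfloor> + 1)"
          unfolding t'_def n using k by (simp add: pos_le_divide_eq mult.commute)
        also have "\<dots> \<longleftrightarrow> \<lceil>real k * x\<rceil> - 1 \<le> \<lfloor>real k * \<tau> t\<rfloor>"
          unfolding ceiling_le_iff[symmetric] by linarith
        also have "\<dots> \<longleftrightarrow> of_int \<lceil>real k * x\<rceil> - 1 \<le> real k * \<tau> t"
          by (subst le_floor_iff) simp
        also have "\<dots> \<longleftrightarrow> \<tau> x \<le> \<tau> t"
          unfolding \<tau>(4)[OF x] using k by (simp add: pos_divide_le_eq mult.commute)
        also have "\<dots> \<longleftrightarrow> x \<le> t"
          using strict_mono_on_less_eq[OF mono, of x t] J(2)[OF x] t by simp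
        finally show ?thesis .
      qed
      then have "lower_envelope S t' = lower_envelope S t"
        unfolding J_def using t t' by (intro lower_envelope_eqI[OF good a, of t' "m + 1" t]) auto
      moreover have "\<bar>real k * H (driven_chain (strip_uniform S k) n) - lower_envelope S t'\<bar> < \<delta>"
        using elim(2) t'(1) unfolding t'_def by blast
      moreover have "X (\<tau> t) = real k * H (driven_chain (strip_uniform S k) n)"
        using \<tau>t by (simp add: X_def grid_path_def n_def)
      ultimately show ?thesis using t by simp
    qed
    then show ?case
      unfolding skorohod_nbhd_def X_def[symmetric] using \<tau> grid_path_cadlag X_def by blast
  qed
qed

end

section \<open>Poisson point processes on the upper half-plane\<close>

text \<open>Half-lines form an intersection-stable generator; with \<open>UNIV\<close> added,
  coordinates without a constraint drop out and only the index set \<open>K\<close> remains.\<close>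

lemma (in prob_space) indep_vars_greaterThanI:
  fixes X :: "'i \<Rightarrow> 'a \<Rightarrow> real"
  assumes X: "\<And>i. X i \<in> borel_measurable M"
    and prob: "\<And>J c. finite J \<Longrightarrow> prob {\<omega> \<in> space M. \<forall>j\<in>J. c j < X j \<omega>} = (\<Prod>j\<in>J. g (c j))"
  shows "indep_vars (\<lambda>_. borel) X I"
proof -
  let ?E = "insert UNIV (range greaterThan) :: real set set"
  have sets: "sets (borel :: real measure) = sigma_sets UNIV ?E"
  proof -
    have "sets (borel :: real measure) = sigma_sets UNIV (range greaterThan)"
      by (subst borel_Ioi) simp
    also have "\<dots> = sigma_sets UNIV ?E"
      by (rule antisym; rule sigma_sets_mono) (auto intro: sigma_sets.Basic sigma_sets_top)
    finally show ?thesis .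
  qed
  have fin: "indep_vars (\<lambda>_. borel) X J" if J: "finite J" "J \<noteq> {}" for J
  proof (subst indep_vars_finite[where E = "\<lambda>_. ?E"])
    show "Int_stable ?E"
    proof -
      have "{a<..} \<inter> {b<..} = {max a b<..}" for a b :: real by auto
      then show ?thesis unfolding Int_stable_def by auto
    qed
    show "\<forall>A\<in>(\<Pi> i\<in>J. ?E). prob (\<Inter>j\<in>J. X j -` A j \<inter> space M) = (\<Prod>j\<in>J. prob (X j -` A j \<inter> space M))"
    proof
      fix A assume A: "A \<in> (\<Pi> i\<in>J. ?E)"
      define K where "K = {j \<in> J. A j \<noteq> UNIV}"
      have K: "finite K" "K \<subseteq> J" using J by (auto simp: K_def)
      have "\<forall>j\<in>K. \<exists>c. A j = {c<..}" using A by (auto simp: K_def)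
      then obtain c where c: "\<And>j. j \<in> K \<Longrightarrow> A j = {c j<..}" by metis
      have one: "prob (X j -` A j \<inter> space M) = g (c j)" if "j \<in> K" for j
      proof -
        have "X j -` A j \<inter> space M = {\<omega> \<in> space M. \<forall>i\<in>{j}. c i < X i \<omega>}" using c[OF that] by auto
        then show ?thesis using prob[of "{j}" c] by simp
      qed
      have "(\<Inter>j\<in>J. X j -` A j \<inter> space M) = {\<omega> \<in> space M. \<forall>j\<in>K. c j < X j \<omega>}"
      proof -
        have "X j \<omega> \<in> A j \<longleftrightarrow> (j \<in> K \<longrightarrow> c j < X j \<omega>)" if "j \<in> J" for j \<omega>
          using c[of j] that by (cases "j \<in> K") (auto simp: K_def)
        then show ?thesis using J K by blast
      qed
      then have "prob (\<Inter>j\<in>J. X j -` A j \<inter> space M) = (\<Prod>j\<in>K. g (c j))"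
        using prob[OF K(1), of c] by simp
      also have "\<dots> = (\<Prod>j\<in>K. prob (X j -` A j \<inter> space M))"
        by (intro prod.cong refl) (simp add: one)
      also have "\<dots> = (\<Prod>j\<in>J. prob (X j -` A j \<inter> space M))"
        by (rule prod.mono_neutral_left) (use J in \<open>auto simp: K_def prob_space\<close>)
      finally show "prob (\<Inter>j\<in>J. X j -` A j \<inter> space M) = (\<Prod>j\<in>J. prob (X j -` A j \<inter> space M))" .
    qed
  qed (use J X sets in auto)
  show ?thesis
    unfolding indep_vars_def2
  proof (intro conjI ballI X)
    show "indep_sets (\<lambda>i. {X i -` A \<inter> space M |A. A \<in> sets borel}) I"
      by (subst indep_sets_finite_index_sets) (use fin in \<open>auto simp: indep_vars_def2\<close>)
  qed
qed

lemma sets_upper_half_plane: "A \<in> sets borel \<Longrightarrow> A \<subseteq> {p. snd p > 0} \<Longrightarrow> A \<in> sets upper_half_plane"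
  and emeasure_upper_half_plane: "A \<subseteq> {p. snd p > 0} \<Longrightarrow> emeasure upper_half_plane A = emeasure lborel A"
proof -
  have "open {p :: real \<times> real. snd p > 0}" by (intro open_Collect_less continuous_intros)
  then have S: "{p :: real \<times> real. snd p > 0} \<in> sets borel" by simp
  show "A \<in> sets upper_half_plane" if "A \<in> sets borel" "A \<subseteq> {p. snd p > 0}"
    unfolding upper_half_plane_def using that S by (subst sets_restrict_space_iff) auto
  show "emeasure upper_half_plane A = emeasure lborel A" if "A \<subseteq> {p. snd p > 0}"
    unfolding upper_half_plane_def using that S by (subst emeasure_restrict_space) auto
qed

lemma emeasure_lborel_Times:
  fixes A B :: "real set"
  assumes "A \<in> sets borel" "B \<in> sets borel"
  shows "emeasure (lborel :: (real \<times> real) measure) (A \<times> B) = emeasure lborel A * emeasure lborel B"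
  using assms by (subst lborel_prod[symmetric]) (auto intro: lborel.emeasure_pair_measure_Times)

lemma sets_borel_Times: "(A :: real set) \<in> sets borel \<Longrightarrow> (B :: real set) \<in> sets borel \<Longrightarrow> A \<times> B \<in> sets borel"
  unfolding borel_prod[symmetric] by (rule pair_measureI)

locale poisson_half_plane =
  fixes M :: "'w measure" and P :: "'w \<Rightarrow> (real \<times> real) set"
  assumes ppp: "poisson_point_process M upper_half_plane P"
begin

sublocale prob_space M
  using ppp by (simp add: poisson_point_process_def)

lemma points_pos: "\<omega> \<in> space M \<Longrightarrow> p \<in> P \<omega> \<Longrightarrow> snd p > 0"
proof -
  assume \<omega>: "\<omega> \<in> space M" "p \<in> P \<omega>"
  have "P \<omega> \<subseteq> space upper_half_plane" using ppp \<omega>(1) by (simp add: poisson_point_process_def)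
  then show "snd p > 0" using \<omega>(2) by (auto simp: upper_half_plane_def space_restrict_space)
qed

lemma point_count_eq_0: "point_count P A \<omega> = 0 \<longleftrightarrow> P \<omega> \<inter> A = {}"
  unfolding point_count_def by (simp add: emeasure_count_space_eq_0)

lemma sets_void: "A \<in> sets upper_half_plane \<Longrightarrow> {\<omega> \<in> space M. P \<omega> \<inter> A = {}} \<in> sets M"
proof -
  assume "A \<in> sets upper_half_plane"
  then have [measurable]: "point_count P A \<in> borel_measurable M" using ppp by (simp add: poisson_point_process_def)
  have "{\<omega> \<in> space M. point_count P A \<omega> = 0} \<in> sets M" by measurable
  then show ?thesis by (simp only: point_count_eq_0)
qed

lemma prob_void:
  assumes "A \<in> sets upper_half_plane" "emeasure upper_half_plane A < \<infinity>"
  shows "prob {\<omega> \<in> space M. P \<omega> \<inter> A = {}} = exp (- measure upper_half_plane A)"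
proof -
  have "prob {\<omega> \<in> space M. point_count P A \<omega> = of_nat 0}
      = measure upper_half_plane A ^ 0 / fact 0 * exp (- measure upper_half_plane A)"
    using ppp assms unfolding poisson_point_process_def by blast
  then show ?thesis by (simp add: point_count_eq_0)
qed

text \<open>The Poisson probabilities of the finite counts sum to 1, which leaves nothing for
  infinite ones.\<close>

lemma AE_finite_points:
  assumes "A \<in> sets upper_half_plane" "emeasure upper_half_plane A < \<infinity>"
  shows "AE \<omega> in M. finite (P \<omega> \<inter> A)"
proof -
  let ?l = "measure upper_half_plane A"
  define E where "E n = {\<omega> \<in> space M. point_count P A \<omega> = of_nat n}" for n
  have [measurable]: "point_count P A \<in> borel_measurable M" using ppp assms by (simp add: poisson_point_process_def)
  have E: "E n \<in> sets M" for n unfolding E_def by measurable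
  have "(\<lambda>n. prob (E n)) sums prob (\<Union>n. E n)"
    by (rule finite_measure_UNION) (use E in \<open>auto simp: disjoint_family_on_def E_def\<close>)
  moreover have "prob (E n) = ?l ^ n / fact n * exp (- ?l)" for n
    using ppp assms unfolding poisson_point_process_def E_def by blast
  then have "(\<lambda>n. prob (E n)) sums (exp ?l * exp (- ?l))"
    using sums_mult2[OF exp_converges[of ?l], of "exp (- ?l)"] by (simp add: divide_inverse mult.commute)
  ultimately have "prob (\<Union>n. E n) = 1"
    using sums_unique2 by (fastforce simp flip: exp_add)
  then have "AE \<omega> in M. \<omega> \<in> (\<Union>n. E n)" using E by (subst (asm) prob_eq_1) auto
  then show ?thesis
  proof eventually_elim
    case (elim \<omega>)
    then obtain n where n: "emeasure (count_space UNIV) (P \<omega> \<inter> A) = of_nat n" by (auto simp: E_def point_count_def)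
    show ?case
    proof (rule ccontr)
      assume "infinite (P \<omega> \<inter> A)"
      then have "emeasure (count_space UNIV) (P \<omega> \<inter> A) = \<infinity>" by (intro emeasure_count_space_infinite) auto
      then show False using n by (metis ennreal_of_nat_neq_top infinity_ennreal_def)
    qed
  qed
qed

lemma prob_void_box:
  assumes "a \<le> b" "0 \<le> y"
  shows "prob {\<omega> \<in> space M. P \<omega> \<inter> {a<..b} \<times> {0<..y} = {}} = exp (- ((b - a) * y))"
    and "{a<..b} \<times> {0<..y} \<in> sets upper_half_plane"
proof -
  have sub: "{a<..b} \<times> {0<..y} \<subseteq> {p. snd p > 0}" by auto
  show S: "{a<..b} \<times> {0<..y} \<in> sets upper_half_plane"
    by (intro sets_upper_half_plane sets_borel_Times sub) auto
  have "emeasure upper_half_plane ({a<..b} \<times> {0<..y}) = ennreal ((b - a) * y)"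
    using assms by (simp add: emeasure_upper_half_plane[OF sub] emeasure_lborel_Times ennreal_mult)
  then show "prob {\<omega> \<in> space M. P \<omega> \<inter> {a<..b} \<times> {0<..y} = {}} = exp (- ((b - a) * y))"
    using assms by (subst prob_void[OF S]) (simp_all add: measure_def)
qed

lemma sets_half_strip: "{a<..b} \<times> {0<..} \<in> sets upper_half_plane" "{a<..b} \<times> {0<..<y} \<in> sets upper_half_plane"
  by (intro sets_upper_half_plane sets_borel_Times; auto)+

text \<open>If the strip is empty, so are all its boxes of height \<open>n\<close>, and the
  probabilities of that tend to 0.\<close>

lemma AE_strip_nonempty:
  assumes "a < b"
  shows "AE \<omega> in M. \<exists>p\<in>P \<omega>. a < fst p \<and> fst p \<le> b"
proof -
  let ?N = "{\<omega> \<in> space M. P \<omega> \<inter> {a<..b} \<times> {0<..} = {}}"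
  have N: "?N \<in> sets M" by (intro sets_void sets_half_strip)
  have "prob ?N \<le> exp (- ((b - a) * real n))" for n
  proof -
    have "prob ?N \<le> prob {\<omega> \<in> space M. P \<omega> \<inter> {a<..b} \<times> {0<..real n} = {}}"
      by (intro finite_measure_mono sets_void prob_void_box(2)) (use assms in auto)
    then show ?thesis using prob_void_box(1)[of a b "real n"] assms by simp
  qed
  moreover have "(\<lambda>n. exp (- ((b - a) * real n))) \<longlonglongrightarrow> 0"
  proof -
    have "filterlim (\<lambda>n. (b - a) * real n) at_top sequentially"
      using assms by (intro filterlim_tendsto_pos_mult_at_top[OF tendsto_const] filterlim_real_sequentially) simp
    then have "filterlim (\<lambda>n. - ((b - a) * real n)) at_bot sequentially" by (simp add: filterlim_uminus_at_bot)
    then show ?thesis by (rule filterlim_compose[OF exp_at_bot])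
  qed
  ultimately have "prob ?N \<le> 0" by (intro LIMSEQ_le_const) auto
  then have "prob ?N = 0" by (simp add: measure_le_0_iff)
  then have "AE \<omega> in M. \<omega> \<notin> ?N" using N by (subst (asm) prob_eq_0) auto
  then show ?thesis
  proof (rule AE_mp, intro AE_I2 impI)
    fix \<omega> assume \<omega>: "\<omega> \<in> space M" "\<omega> \<notin> ?N"
    then obtain p where "p \<in> P \<omega>" "p \<in> {a<..b} \<times> {0<..}" by blast
    then show "\<exists>p\<in>P \<omega>. a < fst p \<and> fst p \<le> b" by (intro bexI[of _ p]) auto
  qed
qed

lemma AE_off_axis: "AE \<omega> in M. \<forall>p\<in>P \<omega>. fst p \<noteq> 0"
proof -
  have sub: "{0} \<times> {0<..} \<subseteq> {p :: real \<times> real. snd p > 0}" by auto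
  have S: "{0} \<times> {0<..} \<in> sets upper_half_plane" by (intro sets_upper_half_plane sets_borel_Times sub) auto
  have "emeasure upper_half_plane ({0} \<times> {0<..}) = 0"
    by (simp add: emeasure_upper_half_plane[OF sub] emeasure_lborel_Times)
  then have "prob {\<omega> \<in> space M. P \<omega> \<inter> {0} \<times> {0<..} = {}} = 1"
    by (subst prob_void[OF S]) (simp_all add: measure_def)
  then have "AE \<omega> in M. \<omega> \<in> {\<omega> \<in> space M. P \<omega> \<inter> {0} \<times> {0<..} = {}}"
    using sets_void[OF S] by (subst (asm) prob_eq_1) auto
  then show ?thesis
  proof eventually_elim
    case (elim \<omega>)
    show ?case
    proof (intro ballI notI)
      fix p assume p: "p \<in> P \<omega>" "fst p = 0"
      then have "p \<in> P \<omega> \<inter> {0} \<times> {0<..}" using points_pos[of \<omega> p] elim by (cases p) auto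
      then show False using elim by auto
    qed
  qed
qed

lemma AE_good_config: "AE \<omega> in M. good_config (P \<omega>)"
proof -
  have 1: "AE \<omega> in M. \<forall>p\<in>P \<omega>. snd p > 0" using points_pos by (intro AE_I2) auto
  have 2: "AE \<omega> in M. \<forall>m::nat. finite (P \<omega> \<inter> {- real m..real m} \<times> {0<..real m})"
    unfolding AE_all_countable
  proof
    fix m :: nat
    have sub: "{- real m..real m} \<times> {0<..real m} \<subseteq> {p. snd p > 0}" by auto
    show "AE \<omega> in M. finite (P \<omega> \<inter> {- real m..real m} \<times> {0<..real m})"
    proof (rule AE_finite_points)
      show "{- real m..real m} \<times> {0<..real m} \<in> sets upper_half_plane"
        by (intro sets_upper_half_plane sets_borel_Times sub) auto
      show "emeasure upper_half_plane ({- real m..real m} \<times> {0<..real m}) < \<infinity>"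
        by (simp add: emeasure_upper_half_plane[OF sub] emeasure_lborel_Times flip: ennreal_mult)
    qed
  qed
  have 3: "AE \<omega> in M. \<forall>j::nat. \<exists>p\<in>P \<omega>. 0 < fst p \<and> fst p \<le> 1 / real (Suc j)"
    unfolding AE_all_countable by (intro allI AE_strip_nonempty) simp
  have 4: "AE \<omega> in M. \<forall>k i::nat. \<exists>p\<in>P \<omega>. (real i - 1) / real (Suc k) < fst p \<and> fst p \<le> real i / real (Suc k)"
    unfolding AE_all_countable by (intro allI AE_strip_nonempty divide_strict_right_mono) auto
  from 1 2 3 AE_off_axis 4 show ?thesis
    by eventually_elim (simp only: good_config_def simp_thms)
qed

lemma measurable_lowest: "(\<lambda>\<omega>. lowest (P \<omega>) a b) \<in> borel_measurable M"
proof (rule borel_measurableI_less)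
  fix y
  let ?A = "{a<..b} \<times> {0<..} :: (real \<times> real) set" and ?B = "{a<..b} \<times> {0<..<y} :: (real \<times> real) set"
  \<comment> \<open>On an empty strip \<open>lowest\<close> is the constant \<open>Inf {}\<close>,
    whatever its value; otherwise its being below \<open>y\<close> says that a box contains a
    point.\<close>
  have eq: "{\<omega> \<in> space M. lowest (P \<omega>) a b < y} =
      ({\<omega> \<in> space M. P \<omega> \<inter> ?A = {}} \<inter> {\<omega> \<in> space M. Inf {} < y}) \<union>
      ((space M - {\<omega> \<in> space M. P \<omega> \<inter> ?A = {}}) \<inter> (space M - {\<omega> \<in> space M. P \<omega> \<inter> ?B = {}}))"
  proof -
    have "lowest (P \<omega>) a b < y \<longleftrightarrow> (if P \<omega> \<inter> ?A = {} then Inf {} < y else P \<omega> \<inter> ?B \<noteq> {})" if \<omega>: "\<omega> \<in> space M" for \<omega>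
    proof -
      define E where "E = {y. \<exists>x. a < x \<and> x \<le> b \<and> (x, y) \<in> P \<omega>}"
      have pos: "e > 0" if "e \<in> E" for e using that points_pos[OF \<omega>] by (auto simp: E_def)
      have A: "P \<omega> \<inter> ?A = {} \<longleftrightarrow> E = {}"
        using points_pos[OF \<omega>] by (force simp: E_def)
      have B: "P \<omega> \<inter> ?B \<noteq> {} \<longleftrightarrow> (\<exists>e\<in>E. e < y)"
        using points_pos[OF \<omega>] by (force simp: E_def)
      show ?thesis
      proof (cases "E = {}")
        case True
        then show ?thesis using A by (simp add: lowest_def E_def[symmetric])
      next
        case False
        have "bdd_below E" using pos by (intro bdd_belowI[of _ 0]) (auto intro: less_imp_le)
        then have "Inf E < y \<longleftrightarrow> (\<exists>e\<in>E. e < y)" using False by (intro cInf_less_iff)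
        then show ?thesis using A B False by (simp add: lowest_def E_def[symmetric])
      qed
    qed
    then show ?thesis
    proof (intro set_eqI)
      fix \<omega>
      assume *: "\<And>\<omega>. \<omega> \<in> space M \<Longrightarrow>
        (lowest (P \<omega>) a b < y) = (if P \<omega> \<inter> ?A = {} then Inf {} < y else P \<omega> \<inter> ?B \<noteq> {})"
      have "P \<omega> \<inter> ?B \<noteq> {} \<Longrightarrow> P \<omega> \<inter> ?A \<noteq> {}" by auto
      then show "(\<omega> \<in> {\<omega> \<in> space M. lowest (P \<omega>) a b < y}) = (\<omega> \<in> ({\<omega> \<in> space M. P \<omega> \<inter> ?A = {}} \<inter> {\<omega> \<in> space M. Inf {} < y}) \<union>
        ((space M - {\<omega> \<in> space M. P \<omega> \<inter> ?A = {}}) \<inter> (space M - {\<omega> \<in> space M. P \<omega> \<inter> ?B = {}})))"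
        using *[of \<omega>] by (cases "\<omega> \<in> space M"; cases "P \<omega> \<inter> ?A = {}") simp_all
    qed
  qed
  show "{\<omega> \<in> space M. lowest (P \<omega>) a b < y} \<in> sets M"
    unfolding eq by (intro sets.Un sets.Int sets.Diff sets.top sets_void sets_half_strip) simp
qed

lemma measurable_strip_uniform [measurable]: "(\<lambda>\<omega>. strip_uniform (P \<omega>) k i) \<in> borel_measurable M"
  unfolding strip_uniform_def
  using measurable_lowest[of "(real i - 1) / real k" "real i / real k"] by measurable

text \<open>The box has area \<open>- ln (1 - c)\<close>, so its void probability is
  \<open>1 - c\<close>, as it must be for a uniform variable to exceed \<open>c\<close>.\<close>

lemma strip_uniform_gt_iff:
  assumes "good_config S" "k \<ge> 1" "0 \<le> c" "c < 1"
  shows "c < strip_uniform S k i \<longleftrightarrow>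
    S \<inter> {(real i - 1) / real k<..real i / real k} \<times> {0<..- real k * ln (1 - c)} = {}" (is "_ \<longleftrightarrow> ?R")
proof -
  let ?l = "lowest S ((real i - 1) / real k) (real i / real k)"
  obtain x0 y0 where p: "(x0, y0) \<in> S" "(real i - 1) / real k < x0" "x0 \<le> real i / real k"
    by (rule strip_point[OF assms(1,2)])
  have "c < strip_uniform S k i \<longleftrightarrow> exp (- (?l / real k)) < 1 - c" by (auto simp: strip_uniform_def)
  also have "\<dots> \<longleftrightarrow> - (?l / real k) < ln (1 - c)"
    using assms by (metis diff_gt_0_iff_gt exp_less_cancel_iff exp_ln)
  also have "\<dots> \<longleftrightarrow> ?l > - real k * ln (1 - c)" using assms(2) by (auto simp: field_simps)
  also have "\<dots> \<longleftrightarrow> ?R"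
  proof
    assume l: "?l > - real k * ln (1 - c)"
    show ?R
    proof (rule ccontr)
      assume "\<not> ?R"
      then obtain x y where "(x, y) \<in> S" "(real i - 1) / real k < x" "x \<le> real i / real k" "y \<le> - real k * ln (1 - c)"
        by auto
      then show False using lowest_point(2)[OF assms(1) p, of x y] l by simp
    qed
  next
    assume R: ?R
    obtain x where x: "(real i - 1) / real k < x" "x \<le> real i / real k" "(x, ?l) \<in> S"
      using lowest_point(1)[OF assms(1) p] by blast
    show "?l > - real k * ln (1 - c)"
    proof (rule ccontr)
      assume "\<not> ?thesis"
      then have "(x, ?l) \<in> S \<inter> {(real i - 1) / real k<..real i / real k} \<times> {0<..- real k * ln (1 - c)}"
        using x config_pos[OF assms(1) x(3)] by auto
      then show False using R by blast
    qed
  qed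
  finally show ?thesis .
qed

text \<open>The joint law comes from one void probability: boxes over different strips are disjoint,
  their areas add, and the exponential turns the sum into a product.\<close>

lemma prob_strip_uniform_gt:
  assumes k: "k \<ge> 1" and J: "finite J"
  shows "prob {\<omega> \<in> space M. \<forall>j\<in>J. c j < strip_uniform (P \<omega>) k j} = (\<Prod>j\<in>J. 1 - max 0 (min 1 (c j)))"
proof (cases "\<exists>j\<in>J. c j \<ge> 1")
  case True
  then obtain j where j: "j \<in> J" "c j \<ge> 1" by auto
  have "AE \<omega> in M. \<omega> \<notin> {\<omega> \<in> space M. \<forall>j\<in>J. c j < strip_uniform (P \<omega>) k j}"
    using AE_good_config
  proof eventually_elim
    case (elim \<omega>)
    then show ?case using strip_uniform_bounds(2)[OF elim k, of j] j by force
  qed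
  then have "prob {\<omega> \<in> space M. \<forall>j\<in>J. c j < strip_uniform (P \<omega>) k j} = 0"
    using J by (subst prob_eq_0) auto
  moreover have "(\<Prod>j\<in>J. 1 - max 0 (min 1 (c j))) = 0"
    using J j by (intro prod_zero bexI[of _ j]) auto
  ultimately show ?thesis by simp
next
  case False
  \<comment> \<open>A negative threshold imposes nothing on a positive variable; it is replaced by
    0, for which the box is empty.\<close>
  define c' where "c' j = max 0 (c j)" for j
  have c': "0 \<le> c' j" "c' j < 1" if "j \<in> J" for j using False that by (auto simp: c'_def not_le)
  define R where "R j = {(real j - 1) / real k<..real j / real k} \<times> {0<..- real k * ln (1 - c' j)}" for j :: nat
  have sub: "R j \<subseteq> {p. snd p > 0}" for j by (auto simp: R_def)
  have R: "R j \<in> sets upper_half_plane" for j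
    unfolding R_def by (intro sets_upper_half_plane sets_borel_Times) auto
  have len: "real j / real k - (real j - 1) / real k = 1 / real k" for j by (simp flip: diff_divide_distrib)
  have emR: "emeasure upper_half_plane (R j) = ennreal (- ln (1 - c' j))" if "j \<in> J" for j
  proof -
    have "ln (1 - c' j) \<le> 0" using c'[OF that] by simp
    then show ?thesis
      using k unfolding emeasure_upper_half_plane[OF sub] unfolding R_def
      by (simp add: emeasure_lborel_Times divide_right_mono len mult_nonneg_nonpos flip: ennreal_mult)
  qed
  have disj: "disjoint_family_on R J"
    unfolding disjoint_family_on_def
  proof (intro ballI impI)
    fix i j :: nat assume "i \<noteq> j"
    have "x \<le> real i / real k \<Longrightarrow> (real j - 1) / real k < x \<Longrightarrow> j \<le> i" for x and i j :: nat
    proof -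
      assume "x \<le> real i / real k" "(real j - 1) / real k < x"
      then have "(real j - 1) / real k < real i / real k" by simp
      then have "real j - 1 < real i" using k by (simp add: divide_less_cancel)
      then show "j \<le> i" by linarith
    qed
    note le = this
    show "R i \<inter> R j = {}"
    proof (rule ccontr)
      assume "R i \<inter> R j \<noteq> {}"
      then obtain x where "(real i - 1) / real k < x" "x \<le> real i / real k"
        "(real j - 1) / real k < x" "x \<le> real j / real k" unfolding R_def by auto
      then show False using le[of x i j] le[of x j i] \<open>i \<noteq> j\<close> by simp
    qed
  qed
  have U: "(\<Union>j\<in>J. R j) \<in> sets upper_half_plane" using R J by auto
  have emU: "emeasure upper_half_plane (\<Union>j\<in>J. R j) = ennreal (\<Sum>j\<in>J. - ln (1 - c' j))"
  proof -
    have "emeasure upper_half_plane (\<Union>j\<in>J. R j) = (\<Sum>j\<in>J. emeasure upper_half_plane (R j))"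
      using R J disj by (intro sum_emeasure[symmetric]) auto
    also have "\<dots> = (\<Sum>j\<in>J. ennreal (- ln (1 - c' j)))" by (intro sum.cong refl emR)
    also have "\<dots> = ennreal (\<Sum>j\<in>J. - ln (1 - c' j))"
      using c' by (intro sum_ennreal) auto
    finally show ?thesis .
  qed
  have "prob {\<omega> \<in> space M. \<forall>j\<in>J. c j < strip_uniform (P \<omega>) k j} = prob {\<omega> \<in> space M. P \<omega> \<inter> (\<Union>j\<in>J. R j) = {}}"
  proof (rule finite_measure_eq_AE)
    show "AE \<omega> in M. (\<omega> \<in> {\<omega> \<in> space M. \<forall>j\<in>J. c j < strip_uniform (P \<omega>) k j})
        = (\<omega> \<in> {\<omega> \<in> space M. P \<omega> \<inter> (\<Union>j\<in>J. R j) = {}})"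
      using AE_good_config
    proof eventually_elim
      case (elim \<omega>)
      have "c j < strip_uniform (P \<omega>) k j \<longleftrightarrow> P \<omega> \<inter> R j = {}" if "j \<in> J" for j
      proof -
        have "c j < strip_uniform (P \<omega>) k j \<longleftrightarrow> c' j < strip_uniform (P \<omega>) k j"
          using strip_uniform_bounds(1)[OF elim k, of j] by (auto simp: c'_def)
        then show ?thesis using strip_uniform_gt_iff[OF elim k c'[OF that], of j] by (simp add: R_def)
      qed
      then have "(\<forall>j\<in>J. c j < strip_uniform (P \<omega>) k j) \<longleftrightarrow> P \<omega> \<inter> (\<Union>j\<in>J. R j) = {}" by auto
      then show ?case by auto
    qed
    show "{\<omega> \<in> space M. \<forall>j\<in>J. c j < strip_uniform (P \<omega>) k j} \<in> sets M"
      using J by (intro sets.sets_Collect_finite_All) auto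
  qed (rule sets_void[OF U])
  also have "\<dots> = exp (- measure upper_half_plane (\<Union>j\<in>J. R j))"
    by (rule prob_void[OF U]) (simp add: emU)
  also have "measure upper_half_plane (\<Union>j\<in>J. R j) = (\<Sum>j\<in>J. - ln (1 - c' j))"
    unfolding measure_def emU using c' by (intro enn2real_ennreal sum_nonneg) auto
  also have "exp (- (\<Sum>j\<in>J. - ln (1 - c' j))) = (\<Prod>j\<in>J. exp (ln (1 - c' j)))"
    using J by (simp add: sum_negf exp_sum)
  also have "\<dots> = (\<Prod>j\<in>J. 1 - max 0 (min 1 (c j)))"
    using c' False by (intro prod.cong refl) (auto simp: c'_def not_le)
  finally show ?thesis .
qed

end

section \<open>The coupling with the Poisson process\<close>

lemma cdf_unit_uniform: "cdf unit_uniform y = max 0 (min 1 y)"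
proof -
  have "{0..1} \<inter> {..y} = {0..min 1 y}" by auto
  then show ?thesis by (cases "0 \<le> y") (auto simp: cdf_def measure_uniform_measure)
qed

context poisson_half_plane
begin

lemma distr_strip_uniform:
  assumes "k \<ge> 1"
  shows "distr M borel (\<lambda>\<omega>. strip_uniform (P \<omega>) k i) = unit_uniform" (is "?L = _")
proof (rule cdf_unique')
  interpret L: prob_space ?L by (rule prob_space_distr) simp
  interpret U: prob_space unit_uniform by (rule prob_space_unit_uniform)
  show "finite_borel_measure ?L" "finite_borel_measure unit_uniform"
    by (auto simp: finite_borel_measure_def finite_borel_measure_axioms_def L.finite_measure_axioms U.finite_measure_axioms)
  show "cdf ?L = cdf unit_uniform"
  proof
    fix y :: real
    define E where "E = {\<omega> \<in> space M. y < strip_uniform (P \<omega>) k i}"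
    have E: "E \<in> sets M" unfolding E_def by measurable
    have "cdf ?L y = prob (space M - E)"
      unfolding cdf_def by (subst measure_distr) (auto simp: E_def not_less intro!: arg_cong[where f = prob])
    also have "\<dots> = 1 - prob E" by (rule prob_compl[OF E])
    also have "prob E = 1 - max 0 (min 1 y)"
      using prob_strip_uniform_gt[OF assms, of "{i}" "\<lambda>_. y"] by (simp add: E_def)
    finally show "cdf ?L y = cdf unit_uniform y" by (simp add: cdf_unit_uniform)
  qed
qed

lemma measurable_strip_seq:
  "(\<lambda>\<omega> i. strip_uniform (P \<omega>) k i) \<in> measurable M (PiM UNIV (\<lambda>_. borel))"
  by (rule measurable_PiM_single') auto

lemma distr_strip_seq:
  assumes "k \<ge> 1"
  shows "distr M (PiM UNIV (\<lambda>_. borel)) (\<lambda>\<omega> i. strip_uniform (P \<omega>) k i) = PiM UNIV (\<lambda>_. unit_uniform)"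
proof -
  have "indep_vars (\<lambda>_. borel) (\<lambda>i \<omega>. strip_uniform (P \<omega>) k i) UNIV"
    by (rule indep_vars_greaterThanI[where g = "\<lambda>c. 1 - max 0 (min 1 c)"])
       (auto intro: prob_strip_uniform_gt[OF assms])
  then have "distr M (PiM UNIV (\<lambda>_. borel)) (\<lambda>\<omega>. \<lambda>i\<in>UNIV. strip_uniform (P \<omega>) k i)
      = PiM UNIV (\<lambda>i. distr M borel (\<lambda>\<omega>. strip_uniform (P \<omega>) k i))"
    by (subst (asm) indep_vars_iff_distr_eq_PiM') auto
  then show ?thesis by (simp add: distr_strip_uniform[OF assms] restrict_def)
qed

end

section \<open>From the levels back to the pivots\<close>

context offspring_law
begin

text \<open>By \<open>nn_integral_advance\<close> the law of the advanced sample has the density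
  \<open>\<psi>' (entry_cdf (entry \<omega>))\<close> with respect to the original law, so null sets
  stay null.\<close>

lemma AE_advance:
  assumes S: "{\<omega>. Q \<omega>} \<in> sets GW" and Q: "AE \<omega> in GW. Q \<omega>"
  shows "AE \<omega> in GW. Q (advance \<omega>)"
proof -
  have [measurable]: "Measurable.pred GW Q" using S by (simp add: pred_def)
  have S': "{\<omega>. \<not> Q \<omega>} \<in> sets GW" by (rule sets_Collect_GW) measurable
  have S'': "{\<omega>. \<not> Q (advance \<omega>)} \<in> sets GW" by (rule sets_Collect_GW) measurable
  have "emeasure GW {\<omega>. \<not> Q (advance \<omega>)} = (\<integral>\<^sup>+\<omega>. indicator {\<omega>. \<not> Q (advance \<omega>)} \<omega> \<partial>GW)"
    using S'' by simp
  also have "\<dots> = (\<integral>\<^sup>+\<omega>. indicator {\<omega>. \<not> Q \<omega>} (advance \<omega>) \<partial>GW)"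
    by (simp add: indicator_def)
  also have "\<dots> = (\<integral>\<^sup>+\<omega>. indicator {\<omega>. \<not> Q \<omega>} \<omega> * ennreal (\<psi>' (entry_cdf (entry \<omega>))) \<partial>GW)"
  proof (rule nn_integral_advance[of "\<lambda>x \<omega>. indicator {\<omega>. \<not> Q \<omega>} \<omega>"])
    have "(\<lambda>z. indicator {\<omega>. \<not> Q \<omega>} (snd z) :: ennreal) \<in> borel_measurable (borel \<Otimes>\<^sub>M GW)"
      by (rule measurable_compose[OF measurable_snd]) (use S' in simp)
    then show "(\<lambda>(x, \<omega>). indicator {\<omega>. \<not> Q \<omega>} \<omega> :: ennreal) \<in> borel_measurable (borel \<Otimes>\<^sub>M GW)"
      by (simp add: case_prod_beta)
  qed
  also have "\<dots> = (\<integral>\<^sup>+\<omega>. 0 \<partial>GW)"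
    by (rule nn_integral_cong_AE, rule eventually_mono[OF Q]) simp
  finally have "emeasure GW {\<omega>. \<not> Q (advance \<omega>)} = 0" by simp
  then show ?thesis using S'' by (intro AE_I[of _ _ "{\<omega>. \<not> Q (advance \<omega>)}"]) auto
qed

lemma AE_advance_pow:
  assumes S: "{\<omega>. Q \<omega>} \<in> sets GW" and Q: "AE \<omega> in GW. Q \<omega>"
  shows "AE \<omega> in GW. Q ((advance ^^ n) \<omega>)"
proof (induction n)
  case (Suc n)
  have [measurable]: "Measurable.pred GW Q" using S by (simp add: pred_def)
  have "Measurable.pred GW (\<lambda>\<omega>. Q ((advance ^^ n) \<omega>))"
    by (rule measurable_compose[OF measurable_advance_pow]) measurable
  from AE_advance[OF sets_Collect_GW[OF this] Suc] show ?case
    by (simp only: funpow_Suc_right comp_def)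
qed (use Q in simp)

lemma AE_root_pivot_levels: "AE \<omega> in GW. \<forall>n. root_pivot ((advance ^^ n) \<omega>) = b (level ((advance ^^ n) \<omega>))"
  unfolding AE_all_countable
proof
  fix n
  show "AE \<omega> in GW. root_pivot ((advance ^^ n) \<omega>) = b (level ((advance ^^ n) \<omega>))"
  proof (rule AE_advance_pow)
    show "{\<omega>. root_pivot \<omega> = b (level \<omega>)} \<in> sets GW"
      by (rule sets_Collect_GW) (unfold pred_def, rule borel_measurable_eq, measurable)
    show "AE \<omega> in GW. root_pivot \<omega> = b (level \<omega>)" using AE_level by eventually_elim simp
  qed
qed

lemma critical_prob_eq: "critical_prob Z = 1 / \<mu>"
  by (simp add: critical_prob_def \<mu>_def)

lemma AE_pivot_excess:
  "AE \<omega> in GW. \<forall>n. pivot_excess Z \<omega> n / critical_prob Z = H (level ((advance ^^ n) \<omega>))"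
  using AE_root_pivot_levels AE_pivot_backbone
proof eventually_elim
  case (elim \<omega>)
  have "(x - 1 / \<mu>) / (1 / \<mu>) = \<mu> * x - 1" for x using \<mu>_gt_1 by (simp add: field_simps)
  then show ?case using elim by (simp add: pivot_excess_def critical_prob_eq H_def)
qed

end

lemma right_continuous_version_ceiling:
  assumes "t \<ge> 0"
  shows "right_continuous_version (\<lambda>t. real k * g (nat \<lceil>real k * t\<rceil>)) t = real k * g (nat \<lfloor>real k * t\<rfloor> + 1)"
  unfolding right_continuous_version_def
proof (rule tendsto_Lim[OF trivial_limit_at_right_real tendsto_eventually])
  show "eventually (\<lambda>s. real k * g (nat \<lceil>real k * s\<rceil>) = real k * g (nat \<lfloor>real k * t\<rfloor> + 1)) (at_right t)"
  proof (cases "k = 0")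
    case False
    then have k: "real k > 0" by simp
    have "nat \<lceil>real k * s\<rceil> = nat \<lfloor>real k * t\<rfloor> + 1" if "t < s" "s < (of_int \<lfloor>real k * t\<rfloor> + 1) / real k" for s
    proof -
      have "real k * t < real k * s" "real k * s < of_int \<lfloor>real k * t\<rfloor> + 1"
        using that k by (auto simp: field_simps)
      then have "\<lceil>real k * s\<rceil> = \<lfloor>real k * t\<rfloor> + 1" by linarith
      moreover have "\<lfloor>real k * t\<rfloor> \<ge> 0" using assms by simp
      ultimately show ?thesis by (simp add: nat_add_distrib)
    qed
    moreover have "t < (of_int \<lfloor>real k * t\<rfloor> + 1) / real k"
      using k by (simp add: pos_less_divide_eq mult.commute)
    ultimately show ?thesis unfolding eventually_at_right_field by (intro exI[of _ "(of_int \<lfloor>real k * t\<rfloor> + 1) / real k"]) auto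
  qed simp
qed

lemma skorohod_tendsto_const:
  assumes "x \<in> cadlag_paths a"
  shows "skorohod_tendsto a (\<lambda>_. x) x"
  unfolding skorohod_tendsto_def using assms by (auto intro!: skorohod_nbhd_refl always_eventually)

lemma skorohod_tendsto_Suc: "skorohod_tendsto a f x \<Longrightarrow> skorohod_tendsto a (\<lambda>n. f (Suc n)) x"
  unfolding skorohod_tendsto_def by (simp add: eventually_sequentially_Suc[of "\<lambda>n. f n \<in> _"])

theorem corollary4p10:
  fixes Z :: "nat pmf" and M :: "'w measure" and P :: "'w \<Rightarrow> (real \<times> real) set" and \<epsilon> :: real
  assumes "0 \<notin> set_pmf Z"
    and "measure_pmf.expectation Z real > 1"
    and "integrable (measure_pmf Z) (\<lambda>n. (real n)\<^sup>2)"
    and "poisson_point_process M upper_half_plane P"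
    and "\<epsilon> > 0"
  shows "converges_in_distribution (skorohod_topology \<epsilon>)
           (GW_space Z)
           (\<lambda>k \<omega>. restrict (right_continuous_version
              (\<lambda>t. real k * pivot_excess Z \<omega> (nat \<lceil>real k * t\<rceil>) / critical_prob Z)) {\<epsilon>..})
           M
           (\<lambda>\<omega>. restrict (lower_envelope (P \<omega>)) {\<epsilon>..})"
proof -
  interpret offspring_law Z using assms(1-3) by (rule offspring_law.intro)
  interpret poisson_half_plane M P using assms(4) by (rule poisson_half_plane.intro)
  let ?T = "skorohod_topology \<epsilon>"
  define path where "path k x = grid_path \<epsilon> k (\<lambda>n. real k * H (x n))" for k and x :: "nat \<Rightarrow> real"
  have path: "path k \<in> measurable (PiM UNIV (\<lambda>_. borel)) (borel_space_of ?T)" for k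
  proof -
    have "(\<lambda>x n. real k * H (x n)) \<in> measurable (PiM UNIV (\<lambda>_. borel)) (PiM UNIV (\<lambda>_. borel))"
      by (rule measurable_PiM_single') measurable
    from measurable_compose[OF this grid_path_measurable] show ?thesis by (simp add: path_def[abs_def])
  qed
  define X' where "X' k \<omega> = path k (\<lambda>n. level ((advance ^^ n) \<omega>))" for k \<omega>
  have X': "measurable_version GW ?T (\<lambda>\<omega>. restrict (right_continuous_version
      (\<lambda>t. real k * pivot_excess Z \<omega> (nat \<lceil>real k * t\<rceil>) / critical_prob Z)) {\<epsilon>..}) (X' k)" for k
    unfolding measurable_version_def
  proof
    show "X' k \<in> measurable GW (borel_space_of ?T)"
      unfolding X'_def by (rule measurable_compose[OF measurable_levels path])
    show "AE \<omega> in GW. restrict (right_continuous_version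
        (\<lambda>t. real k * pivot_excess Z \<omega> (nat \<lceil>real k * t\<rceil>) / critical_prob Z)) {\<epsilon>..} = X' k \<omega>"
      using AE_pivot_excess
    proof eventually_elim
      case (elim \<omega>)
      then have e: "real k * pivot_excess Z \<omega> n / critical_prob Z = real k * H (level ((advance ^^ n) \<omega>))" for n
        by (simp flip: times_divide_eq_right)
      show ?case
        unfolding X'_def path_def grid_path_def e
      proof (rule restrict_ext)
        fix t assume "t \<in> {\<epsilon>..}"
        then have "t \<ge> 0" using assms(5) by simp
        from right_continuous_version_ceiling[OF this, of k "\<lambda>n. H (level ((advance ^^ n) \<omega>))"]
        show "right_continuous_version (\<lambda>t. real k * H (level ((advance ^^ nat \<lceil>real k * t\<rceil>) \<omega>))) t
            = real k * H (level ((advance ^^ (nat \<lfloor>real k * t\<rfloor> + 1)) \<omega>))" .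
      qed
    qed
  qed
  obtain N where N: "N \<in> null_sets M" "{\<omega> \<in> space M. \<not> good_config (P \<omega>)} \<subseteq> N"
    using AE_good_config unfolding eventually_ae_filter by blast
  \<comment> \<open>The exceptional null set gets one fixed path, so that convergence holds at every
    sample point, as \<open>skorohod_limit_measurable\<close> demands.\<close>
  define W where "W k \<omega> = (if \<omega> \<in> N then path 0 (\<lambda>_. 0) else path k (driven_chain (strip_uniform (P \<omega>) k)))" for k \<omega>
  define Y' where "Y' \<omega> = (if \<omega> \<in> N then path 0 (\<lambda>_. 0) else restrict (lower_envelope (P \<omega>)) {\<epsilon>..})" for \<omega>
  have path_top: "path k x \<in> cadlag_paths \<epsilon>" for k x by (simp add: path_def grid_path_cadlag)
  have strip: "(\<lambda>\<omega>. strip_uniform (P \<omega>) k) \<in> measurable M (PiM UNIV (\<lambda>_. borel))" for k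
    by (rule measurable_strip_seq)
  have driven: "driven_chain \<in> measurable (PiM UNIV (\<lambda>_. borel)) (PiM UNIV (\<lambda>_. borel))"
    using measurable_driven_chain_seq
    by (subst measurable_cong_sets[OF sets_PiM_cong[OF refl, of _ _ "\<lambda>_. unit_uniform"] refl]) auto
  have W: "W k \<in> measurable M (borel_space_of ?T)" for k
    unfolding W_def
  proof (rule measurable_If_set)
    show "(\<lambda>\<omega>. path 0 (\<lambda>_. 0)) \<in> measurable M (borel_space_of ?T)"
      by (rule measurable_const) (simp add: topspace_skorohod_topology path_top)
    show "(\<lambda>\<omega>. path k (driven_chain (strip_uniform (P \<omega>) k))) \<in> measurable M (borel_space_of ?T)"
      by (rule measurable_compose[OF measurable_compose[OF strip driven] path])
    show "N \<inter> space M \<in> sets M" using N by auto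
  qed
  have lim: "skorohod_tendsto \<epsilon> (\<lambda>k. W (Suc k) \<omega>) (Y' \<omega>)" if "\<omega> \<in> space M" for \<omega>
  proof (cases "\<omega> \<in> N")
    case True
    then show ?thesis by (simp add: W_def Y'_def skorohod_tendsto_const path_top)
  next
    case False
    then have "good_config (P \<omega>)" using N that by auto
    from skorohod_tendsto_Suc[OF skorohod_tendsto_envelope[OF this assms(5)]] show ?thesis
      using False by (simp add: W_def Y'_def path_def)
  qed
  have Y'_meas: "Y' \<in> measurable M (borel_space_of ?T)"
    by (rule skorohod_limit_measurable[OF W lim])
  have Y': "measurable_version M ?T (\<lambda>\<omega>. restrict (lower_envelope (P \<omega>)) {\<epsilon>..}) Y'"
    unfolding measurable_version_def
  proof
    have "AE \<omega> in M. \<omega> \<notin> N" using N(1) by (rule AE_not_in)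
    then show "AE \<omega> in M. restrict (lower_envelope (P \<omega>)) {\<epsilon>..} = Y' \<omega>"
      by eventually_elim (simp add: Y'_def)
  qed (rule Y'_meas)
  have conv: "(\<lambda>k. \<integral>\<omega>. F (X' k \<omega>) \<partial>GW) \<longlonglongrightarrow> (\<integral>\<omega>. F (Y' \<omega>) \<partial>M)"
    if F: "continuous_map ?T euclideanreal F" "bounded (F ` topspace ?T)" for F
  proof -
    have Fm: "F \<in> borel_measurable (borel_space_of ?T)" by (rule measurable_continuous_map[OF F(1)])
    obtain C where C: "\<And>x. x \<in> cadlag_paths \<epsilon> \<Longrightarrow> \<bar>F x\<bar> \<le> C"
      using F(2) by (auto simp: bounded_iff topspace_skorohod_topology)
    \<comment> \<open>The levels are exchanged for the driven chain, the uniform sequence for the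
      strip variables, and a null set is modified. At \<open>k = 0\<close> there are no strips,
      hence the shift to \<open>Suc k\<close> in the limit.\<close>
    have law: "(\<integral>\<omega>. F (X' k \<omega>) \<partial>GW) = (\<integral>\<omega>. F (W k \<omega>) \<partial>M)" if k: "k \<ge> 1" for k
    proof -
      have Fp: "(\<lambda>x. F (path k x)) \<in> borel_measurable (PiM UNIV (\<lambda>_. borel))"
        by (rule measurable_compose[OF path Fm])
      have "(\<integral>\<omega>. F (X' k \<omega>) \<partial>GW)
          = (\<integral>x. F (path k x) \<partial>distr GW (PiM UNIV (\<lambda>_. borel)) (\<lambda>\<omega> n. level ((advance ^^ n) \<omega>)))"
        unfolding X'_def by (rule integral_distr[OF measurable_levels Fp, symmetric])
      also have "\<dots> = (\<integral>u. F (path k (driven_chain u)) \<partial>uniform_seq)"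
        unfolding distr_levels by (rule integral_distr[OF measurable_driven_chain_seq Fp])
      also have "\<dots> = (\<integral>\<omega>. F (path k (driven_chain (strip_uniform (P \<omega>) k))) \<partial>M)"
        unfolding distr_strip_seq[OF k, symmetric]
        by (rule integral_distr[OF strip measurable_compose[OF driven Fp]])
      also have "\<dots> = (\<integral>\<omega>. F (W k \<omega>) \<partial>M)"
      proof (rule integral_cong_AE)
        show "AE \<omega> in M. F (path k (driven_chain (strip_uniform (P \<omega>) k))) = F (W k \<omega>)"
          using AE_not_in[OF N(1)] by eventually_elim (simp add: W_def)
        show "(\<lambda>\<omega>. F (path k (driven_chain (strip_uniform (P \<omega>) k)))) \<in> borel_measurable M"
          by (rule measurable_compose[OF strip measurable_compose[OF driven Fp]])
        show "(\<lambda>\<omega>. F (W k \<omega>)) \<in> borel_measurable M" by (rule measurable_compose[OF W Fm])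
      qed
      finally show ?thesis .
    qed
    have "(\<lambda>k. \<integral>\<omega>. F (W (Suc k) \<omega>) \<partial>M) \<longlonglongrightarrow> (\<integral>\<omega>. F (Y' \<omega>) \<partial>M)"
    proof (rule integral_dominated_convergence[where w = "\<lambda>_. C"])
      show "(\<lambda>\<omega>. F (Y' \<omega>)) \<in> borel_measurable M" by (rule measurable_compose[OF Y'_meas Fm])
      show "(\<lambda>\<omega>. F (W (Suc k) \<omega>)) \<in> borel_measurable M" for k by (rule measurable_compose[OF W Fm])
      show "AE \<omega> in M. (\<lambda>k. F (W (Suc k) \<omega>)) \<longlonglongrightarrow> F (Y' \<omega>)"
        using skorohod_tendsto_continuous[OF lim F(1)] by (intro AE_I2)
      show "AE \<omega> in M. norm (F (W (Suc k) \<omega>)) \<le> C" for k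
        by (intro AE_I2) (simp add: W_def C path_top)
    qed simp
    then have "(\<lambda>k. \<integral>\<omega>. F (X' (Suc k) \<omega>) \<partial>GW) \<longlonglongrightarrow> (\<integral>\<omega>. F (Y' \<omega>) \<partial>M)"
      by (simp add: law)
    then show ?thesis by (rule LIMSEQ_imp_Suc)
  qed
  show ?thesis
    unfolding converges_in_distribution_def
    by (intro exI[of _ X'] exI[of _ Y'] conjI allI impI X' Y' conv)
qed

end
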